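(* Let $\Gamma$ be a finite simplicial connected graph. Let $H_\Phi$ be a strong generalized Bestvina-Brady subgroup of the right-angled Artin group $A_\Gamma$ with basis subgraphs $\{\Gamma_i\}_{1\le i\le d}$. Then the distortion of $H_\Phi$ in $A_\Gamma$ is quadratic if there is a non-empty subset $I$ of $\{1,2,\dots,d\}$ such that the subgraph $\Gamma'$ generated by $\{\Gamma_i\}_{i\in I}$ is not a join. Moreover, the distortion of $H_\Phi$ in $A_\Gamma$ is linear if one of the following conditions holds: (1) $H_\Phi$ is a special generalized Bestvina-Brady subgroup. (2) Each basis subgraph in $\{\Gamma_i\}_{1\le i\le d}$ is a join and each pair of basis subgraphs in $\{\Gamma_i\}_{1\le i\le d}$ commutes.
   Context: For a finite simplicial graph $\Gamma$, the right-angled Artin group $A_\Gamma$ has generating set the vertices of $\Gamma$ and relations $st=ts$ whenever $s,t$ are adjacent vertices. Generalized Bestvina-Brady subgroups: let $S$ be the vertex set of $\Gamma$ and let $d$ be a positive integer with $d\le |S|$. Label each vertex of $\Gamma$ with an integer in $\{1,\dots,d\}$ so that the homomorphism $\Phi:A_\Gamma\to\mathbb{Z}^d$ sending each vertex with label $i$ to the $i$-th standard basis vector $e_i$ is an epimorphism (i.e. every label is used). The subgroup $H_\Phi=\ker\Phi$ is the generalized Bestvina-Brady subgroup of $A_\Gamma$ with respect to $\Phi$. For $1\le i\le d$ let $S_i$ be the set of vertices mapped to $e_i$ by $\Phi$; the basis subgraph $\Gamma_i$ is the induced subgraph of $\Gamma$ with vertex set $S_i$. A subgraph $\Gamma_1$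 of $\Gamma$ is strongly dominating if there is a vertex $u$ in $\Gamma_1$ adjacent to all vertices of $\Gamma$ not in $\Gamma_1$; it is specially dominating if there is a vertex $u$ in $\Gamma_1$ adjacent to all vertices of $\Gamma$ other than $u$. $H_\Phi$ is strong if each basis subgraph is connected and strongly dominating, and special if each basis subgraph is connected and specially dominating. The subgraph generated by a collection of subgraphs is the induced subgraph of $\Gamma$ on the union of their vertex sets. Two subgraphs commute if each vertex of one is joined by an edge to every vertex of the other, and vice versa. The join of two graphs is obtained by connecting every vertex of the first to every vertex of the second by an edge; a graph is a join if it can be decomposed as the join of two of its (nonempty) subgraphs. For functions $f,g$ from $[0,\infty)$ to $[0,\infty]$ (only values at large arguments matter, so functions on $(0,\infty)$ are allowed), $f\preceq g$ if there are positive constants $A,B,C,D$ such that $f(x)\le A\,g(Bx)+Cx$ for all $x>D$; $f\sim g$ means $f\preceq g$ and $g\preceq f$. A function is linear (respectively quadratic) if it is equivalent ($\sim$) to a polynomial of degree one (respectively two). Let $G$ be a group with finite generating set $S$ and $H$ a subgroup with finite generating set $T$; $|\cdot|_S$, $|\cdot|_T$ are the word lengths. The distortion of $H$ in $G$ is $Dist_G^H(r)=\max\{|h|_T : h\in H,\ |h|_S\le r\}$ for $r>0$; up to $\sim$ it does not depend on $S$ and $T$.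
   Formalization: In the quadratic case Γ' is also required to have at least two vertices: a one-vertex graph is not a join, and for Γ a single vertex with d = 1 the subgroup is trivial, so its distortion is 0 and not quadratic. *)

theory Defs
  imports
    "HOL-Algebra.Generated_Groups"
    "HOL-Algebra.Elementary_Groups"
    "HOL-Algebra.Product_Groups"
    "HOL-Library.Extended_Nonnegative_Real"
    "HOL-Computational_Algebra.Polynomial"
    "Graph_Theory.Graph_Theory"
begin

section \<open>Groups given by generators and relations\<close>

text \<open>A letter \<open>(s, True)\<close> stands for \<open>s\<close> and \<open>(s, False)\<close> for its inverse. A relation
  \<open>l = r\<close> is a pair of words.\<close>

type_synonym 'a word = "('a \<times> bool) list"

abbreviation words :: "'a set \<Rightarrow> 'a word set" where
  "words S \<equiv> lists (S \<times> UNIV)"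

inductive word_eq :: "'a set \<Rightarrow> ('a word \<times> 'a word) set \<Rightarrow> 'a word \<Rightarrow> 'a word \<Rightarrow> bool"
  for S :: "'a set" and R :: "('a word \<times> 'a word) set" where
  refl: "w \<in> words S \<Longrightarrow> word_eq S R w w"
| sym: "word_eq S R v w \<Longrightarrow> word_eq S R w v"
| trans: "word_eq S R u v \<Longrightarrow> word_eq S R v w \<Longrightarrow> word_eq S R u w"
| cancel: "u \<in> words S \<Longrightarrow> v \<in> words S \<Longrightarrow> s \<in> S \<Longrightarrow>
    word_eq S R (u @ [(s, b), (s, \<not> b)] @ v) (u @ v)"
| relation: "u \<in> words S \<Longrightarrow> v \<in> words S \<Longrightarrow> (l, r) \<in> R \<Longrightarrow> l \<in> words S \<Longrightarrow> r \<in> words S \<Longrightarrow>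
    word_eq S R (u @ l @ v) (u @ r @ v)"

definition word_class :: "'a set \<Rightarrow> ('a word \<times> 'a word) set \<Rightarrow> 'a word \<Rightarrow> 'a word set" where
  "word_class S R w = {v. word_eq S R w v}"

definition presented_group :: "'a set \<Rightarrow> ('a word \<times> 'a word) set \<Rightarrow> 'a word set monoid" where
  "presented_group S R =
    \<lparr>carrier = word_class S R ` words S,
     monoid.mult = (\<lambda>X Y. {w. \<exists>x\<in>X. \<exists>y\<in>Y. word_eq S R (x @ y) w}),
     one = word_class S R []\<rparr>"

lemma word_eq_in_words: "word_eq S R v w \<Longrightarrow> v \<in> words S \<and> w \<in> words S"
  by (induction rule: word_eq.induct) auto

lemma word_eq_append_left:
  assumes "word_eq S R v w" "u \<in> words S"
  shows "word_eq S R (u @ v) (u @ w)"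
  using assms
proof (induction rule: word_eq.induct)
  case (refl w)
  then show ?case by (intro word_eq.refl) auto
next
  case (cancel x y s b)
  then show ?case using word_eq.cancel[of "u @ x" S y s R b] by auto
next
  case (relation x y l r)
  then show ?case using word_eq.relation[of "u @ x" S y l r R] by auto
qed (blast intro: word_eq.intros)+

lemma word_eq_append_right:
  assumes "word_eq S R v w" "u \<in> words S"
  shows "word_eq S R (v @ u) (w @ u)"
  using assms
proof (induction rule: word_eq.induct)
  case (refl w)
  then show ?case by (intro word_eq.refl) auto
next
  case (cancel x y s b)
  then show ?case using word_eq.cancel[of x S "y @ u" s R b] by auto
next
  case (relation x y l r)
  then show ?case using word_eq.relation[of x S "y @ u" l r R] by auto
qed (blast intro: word_eq.intros)+

lemma word_eq_append:
  "word_eq S R v v' \<Longrightarrow> word_eq S R w w' \<Longrightarrow> word_eq S R (v @ w) (v' @ w')"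
  by (meson word_eq.trans word_eq_append_left word_eq_append_right word_eq_in_words)

lemma word_class_eq_iff:
  "v \<in> words S \<Longrightarrow> w \<in> words S \<Longrightarrow> word_class S R v = word_class S R w \<longleftrightarrow> word_eq S R v w"
  unfolding word_class_def by (blast intro: word_eq.refl word_eq.sym word_eq.trans)

lemma presented_group_mult:
  assumes "v \<in> words S" "w \<in> words S"
  shows "word_class S R v \<otimes>\<^bsub>presented_group S R\<^esub> word_class S R w = word_class S R (v @ w)"
  using assms unfolding presented_group_def word_class_def
  by simp (blast intro: word_eq.refl word_eq.trans word_eq_append)

lemma group_presented_group: "group (presented_group S R)"
proof (rule groupI)
  let ?G = "presented_group S R" and ?c = "word_class S R"
  have carr: "carrier ?G = ?c ` words S" and one: "\<one>\<^bsub>?G\<^esub> = ?c []"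
    by (auto simp: presented_group_def)
  have app: "v @ w \<in> words S" if "v \<in> words S" "w \<in> words S" for v w :: "'a word"
    using that by auto
  show "\<one>\<^bsub>?G\<^esub> \<in> carrier ?G" by (auto simp: carr one)
  show "x \<otimes>\<^bsub>?G\<^esub> y \<in> carrier ?G" if xy: "x \<in> carrier ?G" "y \<in> carrier ?G" for x y
  proof -
    obtain v w where "v \<in> words S" "w \<in> words S" "x = ?c v" "y = ?c w"
      using xy unfolding carr by blast
    then show ?thesis unfolding carr using app by (simp only: presented_group_mult imageI)
  qed
  show "x \<otimes>\<^bsub>?G\<^esub> y \<otimes>\<^bsub>?G\<^esub> z = x \<otimes>\<^bsub>?G\<^esub> (y \<otimes>\<^bsub>?G\<^esub> z)"
    if xyz: "x \<in> carrier ?G" "y \<in> carrier ?G" "z \<in> carrier ?G" for x y z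
  proof -
    obtain u v w where "u \<in> words S" "v \<in> words S" "w \<in> words S" "x = ?c u" "y = ?c v" "z = ?c w"
      using xyz unfolding carr by blast
    then show ?thesis using app by (simp only: presented_group_mult append_assoc)
  qed
  show "\<one>\<^bsub>?G\<^esub> \<otimes>\<^bsub>?G\<^esub> x = x" if x: "x \<in> carrier ?G" for x
  proof -
    obtain w where "w \<in> words S" "x = ?c w" using x unfolding carr by blast
    then show ?thesis by (simp only: one presented_group_mult lists.Nil append_Nil)
  qed
  show "\<exists>y\<in>carrier ?G. y \<otimes>\<^bsub>?G\<^esub> x = \<one>\<^bsub>?G\<^esub>" if x: "x \<in> carrier ?G" for x
  proof -
    have "\<exists>v\<in>words S. word_eq S R (v @ w) []" if "w \<in> words S" for w
      using that
    proof (induction w)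
      case Nil
      then show ?case by (auto intro!: bexI[of _ "[]"] word_eq.refl)
    next
      case (Cons a w)
      obtain s b where a: "a = (s, b)" by force
      from Cons have s: "s \<in> S" "w \<in> words S" by (auto simp: a)
      with Cons.IH obtain v where v: "v \<in> words S" "word_eq S R (v @ w) []" by auto
      have "word_eq S R ((v @ [(s, \<not> b)]) @ a # w) (v @ w)"
        using word_eq.cancel[OF v(1) s(2,1), of R "\<not> b"] by (simp add: a)
      then show ?case using v s
        by (intro bexI[of _ "v @ [(s, \<not> b)]"]) (auto intro: word_eq.trans)
    qed
    then obtain v w where "w \<in> words S" "x = ?c w" "v \<in> words S" "word_eq S R (v @ w) []"
      using x unfolding carr by blast
    moreover from this have "?c (v @ w) = ?c []"
      using app by (simp only: word_class_eq_iff lists.Nil)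
    ultimately show ?thesis
      unfolding carr one by (intro bexI[of _ "?c v"]) (simp_all only: presented_group_mult imageI)
  qed
qed

section \<open>Graphs\<close>

definition strongly_dominating :: "('v, 'e) pre_digraph \<Rightarrow> ('v, 'e) pre_digraph \<Rightarrow> bool" where
  "strongly_dominating G H \<longleftrightarrow> (\<exists>u\<in>verts H. \<forall>v\<in>verts G - verts H. u \<rightarrow>\<^bsub>G\<^esub> v)"

definition specially_dominating :: "('v, 'e) pre_digraph \<Rightarrow> ('v, 'e) pre_digraph \<Rightarrow> bool" where
  "specially_dominating G H \<longleftrightarrow> (\<exists>u\<in>verts H. \<forall>v\<in>verts G - {u}. u \<rightarrow>\<^bsub>G\<^esub> v)"

definition subgraphs_commute ::
    "('v, 'e) pre_digraph \<Rightarrow> ('v, 'e) pre_digraph \<Rightarrow> ('v, 'e) pre_digraph \<Rightarrow> bool" where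
  "subgraphs_commute G H K \<longleftrightarrow>
    (\<forall>u\<in>verts H. \<forall>v\<in>verts K. u \<rightarrow>\<^bsub>G\<^esub> v \<and> v \<rightarrow>\<^bsub>G\<^esub> u)"

definition graph_join :: "'v pair_pre_digraph \<Rightarrow> 'v pair_pre_digraph \<Rightarrow> 'v pair_pre_digraph" where
  "graph_join G H =
    \<lparr>pverts = pverts G \<union> pverts H,
     parcs = parcs G \<union> parcs H \<union> pverts G \<times> pverts H \<union> pverts H \<times> pverts G\<rparr>"

text \<open>Both factors are nonempty, so a graph with a single vertex is not a join.\<close>

definition is_join :: "('v, 'v \<times> 'v) pre_digraph \<Rightarrow> bool" where
  "is_join G \<longleftrightarrow> (\<exists>G1 G2 :: 'v pair_pre_digraph.
    subgraph (with_proj G1) G \<and> subgraph (with_proj G2) G \<and>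
    pverts G1 \<noteq> {} \<and> pverts G2 \<noteq> {} \<and> pverts G1 \<inter> pverts G2 = {} \<and>
    G = with_proj (graph_join G1 G2))"

section \<open>Right-angled Artin groups and generalized Bestvina--Brady subgroups\<close>

definition raag :: "'v pair_pre_digraph \<Rightarrow> 'v word set monoid" where
  "raag \<Gamma> = presented_group (pverts \<Gamma>)
    {([(s, True), (t, True)], [(t, True), (s, True)]) | s t. s \<rightarrow>\<^bsub>with_proj \<Gamma>\<^esub> t}"

definition raag_gen :: "'v pair_pre_digraph \<Rightarrow> 'v \<Rightarrow> 'v word set" where
  "raag_gen \<Gamma> s = word_class (pverts \<Gamma>)
    {([(s, True), (t, True)], [(t, True), (s, True)]) | s t. s \<rightarrow>\<^bsub>with_proj \<Gamma>\<^esub> t} [(s, True)]"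

definition int_lattice :: "nat \<Rightarrow> (nat \<Rightarrow> int) monoid" where
  "int_lattice d = product_group {1..d} (\<lambda>_. integer_group)"

definition basis_vec :: "nat \<Rightarrow> nat \<Rightarrow> nat \<Rightarrow> int" where
  "basis_vec d i = (\<lambda>j\<in>{1..d}. if j = i then 1 else 0)"

definition labelling_epi ::
    "'v pair_pre_digraph \<Rightarrow> nat \<Rightarrow> ('v \<Rightarrow> nat) \<Rightarrow> ('v word set \<Rightarrow> nat \<Rightarrow> int) \<Rightarrow> bool" where
  "labelling_epi \<Gamma> d lab \<Phi> \<longleftrightarrow>
    1 \<le> d \<and> d \<le> card (pverts \<Gamma>) \<and> (\<forall>v\<in>pverts \<Gamma>. lab v \<in> {1..d}) \<and>
    \<Phi> \<in> epi (raag \<Gamma>) (int_lattice d) \<and>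
    (\<forall>v\<in>pverts \<Gamma>. \<Phi> (raag_gen \<Gamma> v) = basis_vec d (lab v))"

definition bestvina_brady ::
    "'v pair_pre_digraph \<Rightarrow> nat \<Rightarrow> ('v word set \<Rightarrow> nat \<Rightarrow> int) \<Rightarrow> 'v word set set" where
  "bestvina_brady \<Gamma> d \<Phi> = kernel (raag \<Gamma>) (int_lattice d) \<Phi>"

definition basis_subgraph ::
    "'v pair_pre_digraph \<Rightarrow> nat \<Rightarrow> ('v word set \<Rightarrow> nat \<Rightarrow> int) \<Rightarrow> nat \<Rightarrow> ('v, 'v \<times> 'v) pre_digraph" where
  "basis_subgraph \<Gamma> d \<Phi> i =
    with_proj \<Gamma> \<restriction> {v \<in> pverts \<Gamma>. \<Phi> (raag_gen \<Gamma> v) = basis_vec d i}"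

definition generated_subgraph ::
    "'v pair_pre_digraph \<Rightarrow> nat \<Rightarrow> ('v word set \<Rightarrow> nat \<Rightarrow> int) \<Rightarrow> nat set \<Rightarrow> ('v, 'v \<times> 'v) pre_digraph" where
  "generated_subgraph \<Gamma> d \<Phi> I = with_proj \<Gamma> \<restriction> (\<Union>i\<in>I. verts (basis_subgraph \<Gamma> d \<Phi> i))"

definition strong_bb :: "'v pair_pre_digraph \<Rightarrow> nat \<Rightarrow> ('v word set \<Rightarrow> nat \<Rightarrow> int) \<Rightarrow> bool" where
  "strong_bb \<Gamma> d \<Phi> \<longleftrightarrow>
    (\<forall>i\<in>{1..d}. Digraph_Component.connected (basis_subgraph \<Gamma> d \<Phi> i) \<and>
      strongly_dominating (with_proj \<Gamma>) (basis_subgraph \<Gamma> d \<Phi> i))"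

definition special_bb :: "'v pair_pre_digraph \<Rightarrow> nat \<Rightarrow> ('v word set \<Rightarrow> nat \<Rightarrow> int) \<Rightarrow> bool" where
  "special_bb \<Gamma> d \<Phi> \<longleftrightarrow>
    (\<forall>i\<in>{1..d}. Digraph_Component.connected (basis_subgraph \<Gamma> d \<Phi> i) \<and>
      specially_dominating (with_proj \<Gamma>) (basis_subgraph \<Gamma> d \<Phi> i))"

section \<open>Growth types\<close>

text \<open>Functions from \<open>[0,\<infinity>)\<close> to \<open>[0,\<infinity>]\<close> are rendered as functions \<open>real \<Rightarrow> ennreal\<close>; the
  relations below never look at arguments \<open>\<le> 0\<close>.\<close>

definition growth_le :: "(real \<Rightarrow> ennreal) \<Rightarrow> (real \<Rightarrow> ennreal) \<Rightarrow> bool" where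
  "growth_le f g \<longleftrightarrow> (\<exists>A B C D :: real. A > 0 \<and> B > 0 \<and> C > 0 \<and> D > 0 \<and>
    (\<forall>x>D. f x \<le> ennreal A * g (B * x) + ennreal (C * x)))"

definition growth_equiv :: "(real \<Rightarrow> ennreal) \<Rightarrow> (real \<Rightarrow> ennreal) \<Rightarrow> bool" where
  "growth_equiv f g \<longleftrightarrow> growth_le f g \<and> growth_le g f"

text \<open>The polynomial itself has to be a function into \<open>[0,\<infinity>]\<close>; without the sign condition,
  \<^const>\<open>ennreal\<close> would truncate negative values to \<open>0\<close>.\<close>

definition polynomial_growth :: "nat \<Rightarrow> (real \<Rightarrow> ennreal) \<Rightarrow> bool" where
  "polynomial_growth k f \<longleftrightarrow> (\<exists>p :: real poly. degree p = k \<and> (\<forall>x\<ge>0. poly p x \<ge> 0) \<and>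
    growth_equiv f (\<lambda>x. ennreal (poly p x)))"

section \<open>Subgroup distortion\<close>

definition finite_generating_set :: "('a, 'b) monoid_scheme \<Rightarrow> 'a set \<Rightarrow> 'a set \<Rightarrow> bool" where
  "finite_generating_set G H T \<longleftrightarrow> finite T \<and> T \<subseteq> carrier G \<and> generate G T = H"

definition word_length :: "('a, 'b) monoid_scheme \<Rightarrow> 'a set \<Rightarrow> 'a \<Rightarrow> nat" where
  "word_length G S g = (LEAST n. \<exists>xs. length xs = n \<and> set xs \<subseteq> S \<union> m_inv G ` S \<and>
    foldr (monoid.mult G) xs (one G) = g)"

text \<open>If \<open>S\<close> is a finite generating set of \<open>G\<close> and \<open>r > 0\<close>, balls of radius \<open>r\<close> are finite and
  contain the identity, so the maximum below is over a finite nonempty set.\<close>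

definition distortion ::
    "('a, 'b) monoid_scheme \<Rightarrow> 'a set \<Rightarrow> 'a set \<Rightarrow> 'a set \<Rightarrow> real \<Rightarrow> ennreal" where
  "distortion G S H T r =
    of_nat (Max {word_length G T h | h. h \<in> H \<and> real (word_length G S h) \<le> r})"

text \<open>The distortion is only defined for finitely generated \<open>G\<close> and \<open>H\<close>, so finite generation is
  part of the assertion; its growth type is required for every choice of generating sets.\<close>

definition distortion_growth :: "nat \<Rightarrow> ('a, 'b) monoid_scheme \<Rightarrow> 'a set \<Rightarrow> bool" where
  "distortion_growth k G H \<longleftrightarrow>
    (\<exists>S. finite_generating_set G (carrier G) S) \<and> (\<exists>T. finite_generating_set G H T) \<and>
    (\<forall>S T. finite_generating_set G (carrier G) S \<longrightarrow> finite_generating_set G H T \<longrightarrow>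
      polynomial_growth k (distortion G S H T))"

abbreviation linear_distortion :: "('a, 'b) monoid_scheme \<Rightarrow> 'a set \<Rightarrow> bool" where
  "linear_distortion \<equiv> distortion_growth 1"

abbreviation quadratic_distortion :: "('a, 'b) monoid_scheme \<Rightarrow> 'a set \<Rightarrow> bool" where
  "quadratic_distortion \<equiv> distortion_growth 2"

end

theory Submission
  imports Defs
begin

text \<open>
  The letters of a word representing the identity can be paired off, inverse to inverse, such that
  interleaving pairs have adjacent labels; the pairs are the dual curves of a van Kampen diagram.
  This property is invariant under insertion and deletion of cancelling pairs and under commutations,
  so no normal forms are needed.

  Lower bound. If \<open>\<Gamma>'\<close> is not a join, its complement graph is connected, hence has a closed walk
  \<open>\<gamma>\<close> of period \<open>k\<close> through all vertices of \<open>\<Gamma>'\<close>. Take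
  \<open>h\<^sub>n = (\<gamma>\<^sub>1 \<cdots> \<gamma>\<^sub>k)\<^sup>n (\<gamma>\<^sub>1\<inverse> \<cdots> \<gamma>\<^sub>k\<inverse>)\<^sup>n\<close> and let \<open>W\<close> be a word for \<open>h\<^sub>n\<close> whose prefixes have
  bounded height (exponent sum over the letters in \<open>\<Gamma>'\<close>). Consecutive letters of \<open>h\<^sub>n\<close> do not
  commute, so they are paired with letters of \<open>W\<close>, in order. The prefix of \<open>h\<^sub>n\<close> of length \<open>j\<close> has height \<open>j\<close>, whereas \<open>W\<close> stays low; so
  about \<open>j\<close> pairs inside \<open>W\<close> cross the chord at \<open>j\<close>. None of them crosses all of the chords
  \<open>j, \<dots>, j + k\<close>, since its label would be adjacent to itself. Hence the partners of \<open>j\<close> and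
  \<open>j + k\<close> are about \<open>j\<close> apart, and summing over \<open>j = k, 2k, \<dots>\<close> shows that \<open>W\<close> is quadratically long.

  Upper bounds. \<open>H\<^sub>\<Phi>\<close> is generated by the elements \<open>v w\<inverse>\<close> for edges \<open>vw\<close> inside a basis
  subgraph. With \<open>u\<^sub>i\<close> the dominating vertex of \<open>\<Gamma>\<^sub>i\<close>, replace every letter \<open>s\<close> with label \<open>i\<close>
  by \<open>u\<^sub>i\<close>. For an element of \<open>H\<^sub>\<Phi>\<close> the resulting word is trivial as the \<open>u\<^sub>i\<close> commute, and the
  replacement costs a factor \<open>u\<^sub>i\<^sup>m s u\<^sub>i\<inverse> u\<^sub>i\<^sup>-\<^sup>m\<close>, which has length \<open>O(\<bar>m\<bar>)\<close> by following a path
  from \<open>u\<^sub>i\<close> to \<open>s\<close>. In the special case this factor is a single generator. If every \<open>\<Gamma>\<^sub>i\<close> is the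
  join of \<open>K\<^sub>i\<close> and \<open>L\<^sub>i\<close>, letters in \<open>K\<^sub>i\<close> are first replaced by a fixed \<open>l\<^sub>i \<in> L\<^sub>i\<close> and then,
  like the letters in \<open>L\<^sub>i\<close>, by a fixed \<open>k\<^sub>i \<in> K\<^sub>i\<close>.
\<close>

section \<open>Pairings of trivial words\<close>

text \<open>The sign condition excludes fixed points, so \<open>f\<close> is a perfect matching of
  the positions of \<open>U\<close>. Two interleaving pairs are tested once, starting from the
  leftmost of their four ends; for symmetric \<open>E\<close> the order of the two labels is
  immaterial.\<close>

definition pairing :: "('v \<times> 'v) set \<Rightarrow> ('v \<times> bool) list \<Rightarrow> (nat \<Rightarrow> nat) \<Rightarrow> bool" where
  "pairing E U f \<longleftrightarrow>
    (\<forall>i<length U. f i < length U \<and> f (f i) = i \<and> fst (U ! f i) = fst (U ! i) \<and> snd (U ! f i) \<noteq> snd (U ! i)) \<and>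
    (\<forall>i j. i < j \<longrightarrow> j < f i \<longrightarrow> f i < f j \<longrightarrow> j < length U \<longrightarrow> (fst (U ! i), fst (U ! j)) \<in> E)"

lemma pairingD:
  assumes "pairing E U f" "i < length U"
  shows "f i < length U" "f (f i) = i" "fst (U ! f i) = fst (U ! i)" "snd (U ! f i) = (\<not> snd (U ! i))"
    "f i \<noteq> i"
  using assms unfolding pairing_def by metis+

lemma pairing_cross:
  assumes "pairing E U f" "i < j" "j < f i" "f i < f j" "j < length U"
  shows "(fst (U ! i), fst (U ! j)) \<in> E"
  using assms unfolding pairing_def by blast

lemma pairingI:
  assumes "\<And>i. i < length U \<Longrightarrow> f i < length U \<and> f (f i) = i \<and> fst (U ! f i) = fst (U ! i) \<and> snd (U ! f i) = (\<not> snd (U ! i))"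
    and "\<And>i j. i < j \<Longrightarrow> j < f i \<Longrightarrow> f i < f j \<Longrightarrow> j < length U \<Longrightarrow> (fst (U ! i), fst (U ! j)) \<in> E"
  shows "pairing E U f"
  using assms unfolding pairing_def by blast

text \<open>\<open>skip p\<close> is the increasing enumeration of the positions other than
  \<open>p\<close> and \<open>Suc p\<close>. It carries positions of a word to positions of the same
  word with two letters inserted at \<open>p\<close>.\<close>

definition skip :: "nat \<Rightarrow> nat \<Rightarrow> nat" where
  "skip p i = (if i < p then i else i + 2)"

definition unskip :: "nat \<Rightarrow> nat \<Rightarrow> nat" where
  "unskip p i = (if i < p then i else i - 2)"

lemma unskip_skip [simp]: "unskip p (skip p i) = i"
  by (auto simp: skip_def unskip_def)

lemma skip_unskip: "i \<noteq> p \<Longrightarrow> i \<noteq> Suc p \<Longrightarrow> skip p (unskip p i) = i"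
  by (auto simp: skip_def unskip_def)

lemma skip_less_iff [simp]: "skip p i < skip p j \<longleftrightarrow> i < j"
  by (auto simp: skip_def)

lemma skip_neq [simp]: "skip p i \<noteq> p" "skip p i \<noteq> Suc p"
  by (auto simp: skip_def)

lemma nth_skip: "(u @ [a, b] @ v) ! skip (length u) i = (u @ v) ! i"
  by (auto simp: skip_def nth_append nth_Cons split: nat.splits) (simp add: Suc_diff_le less_imp_le not_less)

lemma skip_less_length_iff: "skip (length u) i < length (u @ [a, b] @ v) \<longleftrightarrow> i < length (u @ v)"
  by (auto simp: skip_def)

text \<open>The new letters are neighbours and are paired with each other, so no other pair
  interleaves with theirs; the old pairs keep their relative order.\<close>

lemma pairing_insert:
  assumes "pairing E (u @ v) f"
  shows "\<exists>g. pairing E (u @ [(s, b), (s, \<not> b)] @ v) g"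
proof -
  let ?p = "length u" and ?U = "u @ [(s, b), (s, \<not> b)] @ v"
  let ?e = "skip ?p" and ?d = "unskip ?p"
  define g where "g i = (if i = ?p then Suc ?p else if i = Suc ?p then ?p else ?e (f (?d i)))" for i
  have g1: "g (?e i) = ?e (f i)" for i by (simp add: g_def)
  have ex: "\<exists>k < length (u @ v). i = ?e k" if "i < length ?U" "i \<noteq> ?p" "i \<noteq> Suc ?p" for i
    using skip_unskip[OF that(2,3)] skip_less_length_iff[of u "?d i" "(s,b)" "(s, \<not> b)" v] that(1) by metis
  have [simp]: "g ?p = Suc ?p" "g (Suc ?p) = ?p" by (auto simp: g_def)
  have "pairing E ?U g"
  proof (rule pairingI)
    fix i assume i: "i < length ?U"
    show "g i < length ?U \<and> g (g i) = i \<and> fst (?U ! g i) = fst (?U ! i) \<and> snd (?U ! g i) = (\<not> snd (?U ! i))"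
    proof (cases "i = ?p \<or> i = Suc ?p")
      case True then show ?thesis by (auto simp: nth_append)
    next
      case False
      then obtain k where k: "k < length (u @ v)" "i = ?e k" using ex i by blast
      show ?thesis unfolding k(2) g1 nth_skip skip_less_length_iff using pairingD[OF assms k(1)] by simp
    qed
  next
    fix i j assume *: "i < j" "j < g i" "g i < g j" "j < length ?U"
    then have "i \<noteq> ?p" "i \<noteq> Suc ?p" by auto
    then obtain k where k: "k < length (u @ v)" "i = ?e k" using ex * by (meson less_trans)
    have "j \<noteq> ?p" "j \<noteq> Suc ?p" using * skip_neq[of ?p "f k"] g1[of k] k(2) by auto
    then obtain l where l: "l < length (u @ v)" "j = ?e l" using ex * by blast
    show "(fst (?U ! i), fst (?U ! j)) \<in> E"
      using * pairing_cross[OF assms, of k l] unfolding k(2) l(2) g1 nth_skip using l(1) by simp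
  qed
  then show ?thesis by blast
qed

text \<open>The partners of the two deleted letters are paired with each other.\<close>

lemma pairing_delete:
  assumes P: "pairing E (u @ [(s, b), (s, \<not> b)] @ v) f" and "sym E"
  shows "\<exists>g. pairing E (u @ v) g"
proof -
  let ?p = "length u" and ?U = "u @ [(s, b), (s, \<not> b)] @ v"
  let ?e = "skip ?p" and ?d = "unskip ?p"
  \<comment> \<open>\<open>h\<close> is the new pairing in the positions of the long word,
    \<open>g\<close> the same pairing in those of the short word.\<close>
  define h where "h i = (if f i = ?p then f (Suc ?p) else if f i = Suc ?p then f ?p else f i)" for i
  define g where "g i = ?d (h (?e i))" for i
  have p: "?p < length ?U" "Suc ?p < length ?U" by auto
  have lab: "?U ! ?p = (s, b)" "?U ! Suc ?p = (s, \<not> b)" by (auto simp: nth_append)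
  note D = pairingD[OF P]
  have h: "h i < length ?U \<and> h i \<noteq> ?p \<and> h i \<noteq> Suc ?p \<and> h (h i) = i \<and> fst (?U ! h i) = fst (?U ! i)
      \<and> snd (?U ! h i) = (\<not> snd (?U ! i))"
    if i: "i < length ?U" "i \<noteq> ?p" "i \<noteq> Suc ?p" for i
    using D[OF i(1)] D[OF p(1)] D[OF p(2)] i lab unfolding h_def
    by (smt (verit, del_insts) fst_conv snd_conv)
  have e: "?e i < length ?U" "?e i \<noteq> ?p" "?e i \<noteq> Suc ?p" if "i < length (u @ v)" for i
    using that by (simp_all only: skip_less_length_iff skip_neq not_False_eq_True)
  have eg: "?e (g i) = h (?e i)" if "i < length (u @ v)" for i
    unfolding g_def using h[OF e[OF that]] by (intro skip_unskip) blast+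
  \<comment> \<open>A merged pair follows two old pairs through the deleted neighbours, all with
    label \<open>s\<close>. Whatever interleaves with it interleaves with one of these two, because
    no position lies between the deleted ones.\<close>
  have cross: "(fst (?U ! x), fst (?U ! y)) \<in> E"
    if xy: "x < y" "y < h x" "h x < h y" "y < length ?U" "x \<noteq> ?p" "x \<noteq> Suc ?p" "y \<noteq> ?p" "y \<noteq> Suc ?p" for x y
  proof -
    have x: "x < length ?U" using xy by simp
    note Dx = D[OF x] and Dy = D[OF xy(4)] and Dp = D[OF p(1)] and Dq = D[OF p(2)]
    have C: "(fst (?U ! i), fst (?U ! j)) \<in> E" 
      if "i < j \<and> j < f i \<and> f i < f j \<or> j < i \<and> i < f j \<and> f j < f i" "i < length ?U" "j < length ?U" for i j
      using that pairing_cross[OF P, of i j] pairing_cross[OF P, of j i] \<open>sym E\<close> by (meson symD)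
    \<comment> \<open>If \<open>f x\<close> and \<open>f y\<close> are both deleted positions, then
      either \<open>x = y\<close> or \<open>h x = y\<close>, against \<open>x < y\<close> and
      \<open>y < h x\<close>.\<close>
    consider "f x = ?p" "f y = ?p" | "f x = ?p" "f y = Suc ?p" | "f x = Suc ?p" "f y = ?p" | "f x = Suc ?p" "f y = Suc ?p"
      | "f x \<noteq> ?p" "f x \<noteq> Suc ?p" "f y \<noteq> ?p" "f y \<noteq> Suc ?p"
      | q where "f x = q" "q = ?p \<or> q = Suc ?p" "f y \<noteq> ?p" "f y \<noteq> Suc ?p"
      | q where "f y = q" "q = ?p \<or> q = Suc ?p" "f x \<noteq> ?p" "f x \<noteq> Suc ?p" by blast
    then show ?thesis
    proof cases
      case 5
      then show ?thesis using xy C[of x y] x by (simp add: h_def)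
    next
      case (6 q)
      define q' where "q' = (if q = ?p then Suc ?p else ?p)"
      have q': "q' < length ?U" "q < length ?U" "q = Suc q' \<or> q' = Suc q" "h x = f q'" "h y = f y"
        using 6 p by (auto simp: q'_def h_def)
      have labq: "fst (?U ! q) = s" "fst (?U ! q') = s" using 6(2) lab by (auto simp: q'_def)
      have "fst (?U ! x) = s" using Dx 6 labq by simp
      have neq: "y \<noteq> q" "y \<noteq> q'" "f y \<noteq> q" "f y \<noteq> q'" using 6 xy by (auto simp: q'_def)
      have "x < y" "y < f q'" "f q' < f y" using xy q' by auto
      moreover have "f (f q') = q'" using D(2)[OF q'(1)] .
      ultimately consider "x < y \<and> y < f x \<and> f x < f y" | "q' < y \<and> y < f q' \<and> f q' < f y"
        | "y < f q' \<and> f q' < f y \<and> f y < f (f q')"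
        using neq 6(1) q'(3) by linarith
      then show ?thesis
      proof cases
        case 1 then show ?thesis using C[of x y] x xy by blast
      next
        case 2 then show ?thesis using C[of q' y] q' xy labq \<open>fst (?U ! x) = s\<close> by simp
      next
        case 3 then show ?thesis using C[of "f q'" y] D[OF q'(1)] xy labq \<open>fst (?U ! x) = s\<close> by simp
      qed
    next
      case (7 q)
      define q' where "q' = (if q = ?p then Suc ?p else ?p)"
      have q': "q' < length ?U" "q < length ?U" "q = Suc q' \<or> q' = Suc q" "h y = f q'" "h x = f x"
        using 7 p by (auto simp: q'_def h_def)
      have labq: "fst (?U ! q) = s" "fst (?U ! q') = s" using 7(2) lab by (auto simp: q'_def)
      have "fst (?U ! y) = s" using Dy 7 labq by simp
      have neq: "x \<noteq> q" "x \<noteq> q'" "f x \<noteq> q" "f x \<noteq> q'" using 7 xy by (auto simp: q'_def)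
      have "x < y" "y < f x" "f x < f q'" using xy q' by auto
      moreover have "f (f q') = q'" using D(2)[OF q'(1)] .
      ultimately consider "x < y \<and> y < f x \<and> f x < f y" | "x < q' \<and> q' < f x \<and> f x < f q'"
        | "q < x \<and> x < y \<and> y < f x"
        using neq 7(1) q'(3) by linarith
      then show ?thesis
      proof cases
        case 1 then show ?thesis using C[of x y] x xy by blast
      next
        case 2 then show ?thesis using C[of x q'] q' x labq \<open>fst (?U ! y) = s\<close> by simp
      next
        case 3
        moreover have "f q = y" using 7(1) Dy by simp
        ultimately show ?thesis using C[of x q] x q' labq \<open>fst (?U ! y) = s\<close> by simp
      qed
    qed (use xy Dx Dy in \<open>auto simp: h_def\<close>)
  qed
  have "pairing E (u @ v) g"
  proof (rule pairingI)
    fix i assume i: "i < length (u @ v)"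
    have gl: "g i < length (u @ v)" using h[OF e[OF i]] eg[OF i] skip_less_length_iff by metis
    have "?e (g (g i)) = ?e i" using eg[OF gl] eg[OF i] h[OF e[OF i]] by simp
    then have "g (g i) = i" by (metis unskip_skip)
    then show "g i < length (u @ v) \<and> g (g i) = i \<and> fst ((u @ v) ! g i) = fst ((u @ v) ! i) \<and> snd ((u @ v) ! g i) = (\<not> snd ((u @ v) ! i))"
      using h[OF e[OF i]] gl eg[OF i] nth_skip[of u "(s,b)" "(s, \<not> b)" v] by metis
  next
    fix i j assume *: "i < j" "j < g i" "g i < g j" "j < length (u @ v)"
    then have il: "i < length (u @ v)" by simp
    have "?e i < ?e j" "?e j < h (?e i)" "h (?e i) < h (?e j)" 
      using * eg[OF il] eg[OF *(4)] skip_less_iff by metis+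
    then show "(fst ((u @ v) ! i), fst ((u @ v) ! j)) \<in> E"
      using cross[of "?e i" "?e j"] e[OF *(4)] e[OF il] nth_skip[of u "(s,b)" "(s, \<not> b)" v] by metis
  qed
  then show ?thesis by blast
qed

text \<open>The pairing is conjugated by the transposition of the two positions. No other two
  positions change their relative order, so a new interleaving can only occur between the pairs of
  \<open>a\<close> and \<open>b\<close>, whose labels are adjacent.\<close>

lemma pairing_swap:
  assumes P: "pairing E (u @ [a, b] @ v) f" and E: "(fst a, fst b) \<in> E" "sym E" "irrefl E"
  shows "\<exists>g. pairing E (u @ [b, a] @ v) g"
proof -
  let ?p = "length u" and ?U = "u @ [a, b] @ v" and ?U' = "u @ [b, a] @ v"
  define t where "t i = (if i = ?p then Suc ?p else if i = Suc ?p then ?p else i)" for i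
  define g where "g i = t (f (t i))" for i
  have tt [simp]: "t (t i) = i" for i by (auto simp: t_def)
  have tl [simp]: "t i < length ?U \<longleftrightarrow> i < length ?U" for i by (auto simp: t_def)
  have nth: "?U' ! i = ?U ! t i" for i
    by (auto simp: t_def nth_append nth_Cons split: nat.splits)
  have lab: "?U ! ?p = a" "?U ! Suc ?p = b" by (auto simp: nth_append)
  have len: "length ?U' = length ?U" by simp
  note D = pairingD[OF P]
  have "pairing E ?U' g"
  proof (rule pairingI, unfold len)
    fix i assume "i < length ?U"
    then have "t i < length ?U" using tl by blast
    from D[OF this] show "g i < length ?U \<and> g (g i) = i \<and> fst (?U' ! g i) = fst (?U' ! i) \<and> snd (?U' ! g i) = (\<not> snd (?U' ! i))"
      unfolding nth g_def tt tl by (metis tt)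
  next
    fix i j assume *: "i < j" "j < g i" "g i < g j" "j < length ?U"
    then have ti: "t i < length ?U" "t j < length ?U" using tl less_trans[OF *(1,4)] by blast+
    have tm: "t x < t y" if "x < y" "\<not> (x = ?p \<and> y = Suc ?p)" for x y using that by (auto simp: t_def)
    have L: "fst (?U' ! g i) = fst (?U' ! i)" "fst (?U' ! g j) = fst (?U' ! j)"
      using D(3)[OF ti(1)] D(3)[OF ti(2)] unfolding nth g_def tt by blast+
    have L': "fst (?U' ! ?p) = fst b" "fst (?U' ! Suc ?p) = fst a" by (simp_all add: nth_append)
    have E': "(fst b, fst a) \<in> E" using E by (meson symD)
    consider "i = ?p \<and> j = Suc ?p" | "j = ?p \<and> g i = Suc ?p" | "g i = ?p \<and> g j = Suc ?p"
      | "t i < t j" "t j < t (g i)" "t (g i) < t (g j)" using tm * by blast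
    then show "(fst (?U' ! i), fst (?U' ! j)) \<in> E"
    proof cases
      case 4
      then show ?thesis unfolding nth using pairing_cross[OF P, of "t i" "t j"] ti by (simp add: g_def)
    qed (use L L' E E' in metis)+
  qed
  then show ?thesis by blast
qed

section \<open>The quadratic lower bound\<close>

definition letter_height :: "'v set \<Rightarrow> 'v \<times> bool \<Rightarrow> int" where
  "letter_height V x = (if fst x \<in> V then if snd x then 1 else - 1 else 0)"

definition height :: "'v set \<Rightarrow> ('v \<times> bool) list \<Rightarrow> int" where
  "height V w = sum_list (map (letter_height V) w)"

lemma height_simps [simp]:
  "height V [] = 0" "height V (x # w) = letter_height V x + height V w"
  "height V (v @ w) = height V v + height V w"
  by (auto simp: height_def)

lemma height_conv_sum: "height V w = (\<Sum>i<length w. letter_height V (w ! i))"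
  by (simp add: height_def sum_list_sum_nth atLeast0LessThan)

text \<open>A pair inside \<open>Y\<close> would trap the pair of the next letter strictly inside
  itself, since the two labels are distinct and not adjacent; descent on \<open>f p - p\<close>
  excludes this. So all pairs leave \<open>Y\<close>, and as those of consecutive letters must not
  interleave, the partners occur in reverse order.\<close>

lemma pairing_alternating_prefix:
  assumes P: "pairing E (Y @ W) f" and "sym E"
    and Y: "\<And>p. Suc p < length Y \<Longrightarrow> fst (Y ! p) \<noteq> fst (Y ! Suc p) \<and> (fst (Y ! p), fst (Y ! Suc p)) \<notin> E"
  shows "p < length Y \<Longrightarrow> length Y \<le> f p" and "p < q \<Longrightarrow> q < length Y \<Longrightarrow> f q < f p"
proof -
  let ?L = "length Y" and ?U = "Y @ W"
  note D = pairingD[OF P]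
  have lab: "?U ! p = Y ! p" if "p < ?L" for p using that by (simp add: nth_append)
  have no: "\<not> (p < f p \<and> f p < ?L)" for p
  proof (induction "f p - p" arbitrary: p rule: less_induct)
    case less
    show ?case
    proof
      assume p: "p < f p \<and> f p < ?L"
      have pl: "p < length ?U" "Suc p < length ?U" using p by auto
      have yp: "fst (Y ! p) \<noteq> fst (Y ! Suc p)" "(fst (Y ! p), fst (Y ! Suc p)) \<notin> E"
        "(fst (Y ! Suc p), fst (Y ! p)) \<notin> E"
        using Y[of p] p \<open>sym E\<close> by (auto dest: symD)
      have "f p \<noteq> Suc p" using yp(1) D(3)[OF pl(1)] lab[of p] lab[of "Suc p"] p by auto
      then have lt: "Suc p < f p" using p by linarith
      have labs: "fst (?U ! p) = fst (Y ! p)" "fst (?U ! Suc p) = fst (Y ! Suc p)" using lab p lt by auto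
      have neq: "f (Suc p) \<noteq> p" "f (Suc p) \<noteq> f p" using D[OF pl(1)] D[OF pl(2)] lt by (metis less_irrefl n_not_Suc_n)+
      have 1: "\<not> f (Suc p) > f p" using pairing_cross[OF P, of p "Suc p"] lt pl labs yp by auto
      have 2: "\<not> f (Suc p) < p"
      proof
        assume r: "f (Suc p) < p"
        have "f (f (Suc p)) = Suc p" using D(2)[OF pl(2)] .
        then have "(fst (?U ! f (Suc p)), fst (?U ! p)) \<in> E"
          using pairing_cross[OF P, of "f (Suc p)" p] r lt pl by simp
        then show False using D(3)[OF pl(2)] labs yp by simp
      qed
      have "f (Suc p) \<noteq> Suc p" using D(5)[OF pl(2)] .
      then have "Suc p < f (Suc p)" "f (Suc p) < f p" using 1 2 neq by auto
      then show False using less[of "Suc p"] p by linarith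
    qed
  qed
  have ge: "?L \<le> f p" if "p < ?L" for p
    using no[of p] no[of "f p"] D[of p] that by (metis leI length_append nat_neq_iff trans_less_add1)
  then show "p < ?L \<Longrightarrow> ?L \<le> f p" .
  have step: "f (Suc p) < f p" if "Suc p < ?L" for p
  proof (rule ccontr)
    assume "\<not> f (Suc p) < f p"
    moreover have "f (Suc p) \<noteq> f p" using D(2)[of p] D(2)[of "Suc p"] that by auto
    ultimately have "f p < f (Suc p)" by simp
    then have "(fst (?U ! p), fst (?U ! Suc p)) \<in> E"
      using pairing_cross[OF P, of p "Suc p"] ge[of p] that by simp
    then show False using Y[OF that] lab that by simp
  qed
  show "p < q \<Longrightarrow> q < ?L \<Longrightarrow> f q < f p"
  proof (induction q)
    case (Suc q) then show ?case using step[of q] by (cases "p = q") auto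
  qed simp
qed

text \<open>Partners have the same label and opposite exponents, so reindexing by \<open>f\<close>
  turns the sum into its negative.\<close>

lemma sum_pairing_closed:
  assumes P: "pairing E U f" and "finite Z" "\<And>x. x \<in> Z \<Longrightarrow> x < length U" "\<And>x. x \<in> Z \<Longrightarrow> f x \<in> Z"
  shows "(\<Sum>x\<in>Z. letter_height V (U ! x)) = 0"
proof -
  have "bij_betw f Z Z"
    by (rule bij_betw_byWitness[of _ f]) (use assms pairingD[OF P] in auto)
  then have "(\<Sum>x\<in>Z. letter_height V (U ! x)) = (\<Sum>x\<in>Z. letter_height V (U ! f x))"
    by (rule sum.reindex_bij_betw[symmetric])
  also have "\<dots> = (\<Sum>x\<in>Z. - letter_height V (U ! x))"
    by (rule sum.cong) (use assms(3) pairingD[OF P] in \<open>auto simp: letter_height_def\<close>)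
  finally show ?thesis by (simp add: sum_negf)
qed

text \<open>The inverse letters of the second half run in the same direction as the letters of the
  first half. Hence nothing cancels in the middle if consecutive values of \<gamma> differ, while
  all exponent sums vanish if \<open>N\<close> is a period of \<gamma>.\<close>

definition commutator_word :: "(nat \<Rightarrow> 'v) \<Rightarrow> nat \<Rightarrow> ('v \<times> bool) list" where
  "commutator_word \<gamma> N = map (\<lambda>j. (\<gamma> j, j < N)) [0..<2 * N]"

definition inv_word :: "('v \<times> bool) list \<Rightarrow> ('v \<times> bool) list" where
  "inv_word w = rev (map (\<lambda>(s, b). (s, \<not> b)) w)"

section \<open>Chords between the commutator word and a word of low height\<close>

context
  fixes E :: "('v \<times> 'v) set" and \<gamma> :: "nat \<Rightarrow> 'v" and V :: "'v set" and k N :: nat and c :: int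
    and W :: "('v \<times> bool) list" and f :: "nat \<Rightarrow> nat"
  assumes E: "sym E" "irrefl E"
    and \<gamma>: "\<And>j. \<gamma> j \<in> V" "\<And>j. \<gamma> j \<noteq> \<gamma> (Suc j)" "\<And>j. (\<gamma> j, \<gamma> (Suc j)) \<notin> E"
    and cover: "\<And>j v. v \<in> V \<Longrightarrow> \<exists>i<k. \<gamma> (j + i) = v"
    and P: "pairing E (inv_word (commutator_word \<gamma> N) @ W) f"
    and low: "\<And>a. height V (take a W) \<le> c"
begin

abbreviation (input) "Y \<equiv> inv_word (commutator_word \<gamma> N)"

lemma length_Y: "length Y = 2 * N"
  by (simp add: inv_word_def commutator_word_def)

lemma nth_Y: "p < 2 * N \<Longrightarrow> Y ! p = (\<gamma> (2 * N - Suc p), \<not> 2 * N - Suc p < N)"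
  by (simp add: inv_word_def commutator_word_def rev_nth)

lemma Y_alternating:
  assumes "Suc p < length Y"
  shows "fst (Y ! p) \<noteq> fst (Y ! Suc p) \<and> (fst (Y ! p), fst (Y ! Suc p)) \<notin> E"
proof -
  have "2 * N - Suc p = Suc (2 * N - Suc (Suc p))" using assms length_Y by simp
  then show ?thesis
    using assms length_Y nth_Y[of p] nth_Y[of "Suc p"] \<gamma>(2,3)[of "2 * N - Suc (Suc p)"] \<open>sym E\<close>
    by (metis Suc_lessD fst_conv symD)
qed

lemma Y_ge: "p < 2 * N \<Longrightarrow> 2 * N \<le> f p"
  using pairing_alternating_prefix(1)[OF P E(1) Y_alternating] length_Y by simp

lemma Y_anti: "p < q \<Longrightarrow> q < 2 * N \<Longrightarrow> f q < f p"
  using pairing_alternating_prefix(2)[OF P E(1) Y_alternating] length_Y by simp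

text \<open>The \<open>j\<close>-th letter of the commutator word, counted from \<open>0\<close>, sits at position \<open>2 * N - Suc j\<close>
  of its inverse.\<close>

lemma crossing_step:
  assumes jN: "j \<le> N" and jk: "j + k < 2 * N"
  shows "int (f (2 * N - Suc (j + k))) \<ge> int (f (2 * N - Suc j)) + int j - c"
proof -
  let ?L = "2 * N" and ?U = "Y @ W" and ?h = "\<lambda>x. letter_height V ((Y @ W) ! x)"
  define a where "a = f (?L - Suc j)"
  define b where "b = f (?L - Suc (j + k))"
  note D = pairingD[OF P]
  have k: "0 < k" using cover[of "\<gamma> 0" 0] \<gamma>(1) by (cases k) auto
  have len: "length ?U = ?L + length W" by (simp add: length_Y)
  have fa: "f a = ?L - Suc j" and aU: "a < length ?U" and aL: "?L \<le> a"
    unfolding a_def using D[of "?L - Suc j"] Y_ge[of "?L - Suc j"] jk len by auto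
  have fb: "f b = ?L - Suc (j + k)" and bU: "b < length ?U" and bL: "?L \<le> b"
    unfolding b_def using D[of "?L - Suc (j + k)"] Y_ge[of "?L - Suc (j + k)"] jk len by auto
  have ab: "a < b" unfolding a_def b_def by (rule Y_anti) (use jk k in auto)
  define Z where "Z = {?L - j..<a}"
  \<comment> \<open>\<open>Z\<close> is the region cut off by the chord at \<open>j\<close>; only the pairs leaving it contribute to its height.\<close>
  define X where "X = {x \<in> Z. f x \<notin> Z}"
  have ZU: "x < length ?U" if "x \<in> Z" for x using that aU by (simp add: Z_def)
  have "sum ?h Z = sum ?h {?L - j..<?L} + sum ?h {?L..<a}"
    unfolding Z_def by (rule sum.atLeastLessThan_concat[symmetric]) (use aL in auto)
  \<comment> \<open>These positions hold the inverses of the first \<open>j\<close> letters of the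
    commutator word, which are positive because \<open>j \<le> N\<close>.\<close>
  also have "sum ?h {?L - j..<?L} = (\<Sum>x\<in>{?L - j..<?L}. - 1)"
  proof (rule sum.cong)
    fix x assume x: "x \<in> {?L - j..<?L}"
    then have "?L - Suc x < N" using jN jk by auto
    then show "?h x = - 1"
      using x nth_Y[of x] \<gamma>(1) by (simp add: nth_append length_Y letter_height_def)
  qed simp
  also have "\<dots> = - int j" using jk by simp
  also have "sum ?h {?L..<a} = height V (take (a - ?L) W)"
  proof -
    have "height V (take (a - ?L) W) = (\<Sum>i<a - ?L. letter_height V (W ! i))"
      unfolding height_conv_sum using aU len by (intro sum.cong) auto
    also have "\<dots> = sum ?h {?L..<a}"
      by (rule sum.reindex_bij_witness[of _ "\<lambda>i. i - ?L" "\<lambda>i. i + ?L"])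
        (use aL in \<open>auto simp: nth_append length_Y\<close>)
    finally show ?thesis by simp
  qed
  finally have sumZ: "sum ?h Z \<le> c - int j" using low[of "a - ?L"] by linarith
  have "sum ?h Z = sum ?h (Z - X) + sum ?h X"
    by (rule sum.subset_diff) (auto simp: X_def Z_def)
  moreover have "sum ?h (Z - X) = 0"
    by (rule sum_pairing_closed[OF P]) (use ZU D in \<open>auto simp: X_def Z_def\<close>)
  ultimately have sumX: "sum ?h X \<le> c - int j" using sumZ by simp
  \<comment> \<open>The pairs starting in \<open>Y\<close> are nested: those at positions above
    \<open>2 * N - Suc j\<close> end before \<open>a\<close>, those at lower positions end after
    \<open>a\<close>. So a pair leaving \<open>Z\<close> joins a letter of \<open>W\<close> before
    \<open>a\<close> to one after \<open>a\<close>.\<close>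
  have X: "?L \<le> x \<and> x < a \<and> a < f x" if "x \<in> X" for x
  proof -
    have x: "x \<in> Z" "f x \<notin> Z" "x < length ?U" using that ZU by (auto simp: X_def)
    have "?L \<le> x"
    proof (rule ccontr)
      assume l: "\<not> ?L \<le> x"
      then have "?L - Suc j < x" using x jk by (auto simp: Z_def)
      then have "f x < a" unfolding a_def using Y_anti l by simp
      moreover have "?L \<le> f x" using Y_ge l by simp
      ultimately show False using x by (auto simp: Z_def)
    qed
    have ff: "f (f x) = x" using D(2)[OF x(3)] .
    have "\<not> f x < ?L - j"
    proof
      assume l: "f x < ?L - j"
      have "a \<le> x"
      proof (cases "f x = ?L - Suc j")
        case True then show ?thesis using ff a_def by simp
      next
        case False
        then have "f x < ?L - Suc j" using l by linarith
        then have "f (?L - Suc j) < f (f x)" by (rule Y_anti) (use jk in auto)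
        then show ?thesis using ff a_def by simp
      qed
      then show False using x by (simp add: Z_def)
    qed
    then have "a \<le> f x" using x by (auto simp: Z_def)
    moreover have "f x \<noteq> a" using ff fa \<open>?L \<le> x\<close> jk by auto
    ultimately show ?thesis using x \<open>?L \<le> x\<close> by (auto simp: Z_def)
  qed
  define X' where "X' = {x \<in> X. fst (?U ! x) \<in> V}"
  have fin: "finite X" by (simp add: X_def Z_def)
  have "f ` X' \<subseteq> {a<..<b}"
  proof
    fix y assume "y \<in> f ` X'"
    then obtain x where x: "x \<in> X" "fst (?U ! x) \<in> V" "y = f x" by (auto simp: X'_def)
    note Xx = X[OF x(1)]
    have xU: "x < length ?U" using Xx aU by simp
    have "f x \<noteq> b" using fb D(2)[OF xU] Xx jk by auto
    \<comment> \<open>A partner beyond \<open>b\<close> would make the pair of \<open>x\<close>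
      interleave with all \<open>k\<close> chords at \<open>j\<close>, ...,
      \<open>j + k - 1\<close>. By \<open>cover\<close> one of them carries the label of
      \<open>x\<close>, which is impossible for irreflexive \<open>E\<close>.\<close>
    moreover have "\<not> b < f x"
    proof
      assume bf: "b < f x"
      obtain i where i: "i < k" "\<gamma> (j + i) = fst (?U ! x)" using cover[OF x(2)] by blast
      define p where "p = ?L - Suc (j + i)"
      have p: "p < ?L" using jk i by (auto simp: p_def)
      have "f p < b" unfolding b_def by (rule Y_anti) (use jk i p in \<open>auto simp: p_def\<close>)
      moreover have "x < f p"
      proof (cases "i = 0")
        case True then show ?thesis using Xx by (simp add: p_def a_def)
      next
        case False
        have "a < f p" unfolding a_def by (rule Y_anti) (use jk i False in \<open>auto simp: p_def\<close>)
        then show ?thesis using Xx by simp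
      qed
      ultimately have "(fst (?U ! p), fst (?U ! x)) \<in> E"
        using pairing_cross[OF P, of p x] p Xx bf xU by linarith
      moreover have "fst (?U ! p) = fst (?U ! x)"
        using p jk i nth_Y[OF p] by (simp add: nth_append length_Y p_def)
      ultimately show False using \<open>irrefl E\<close> by (metis irreflD)
    qed
    ultimately show "y \<in> {a<..<b}" using Xx x by simp
  qed
  moreover have "inj_on f X'"
  proof (rule inj_onI)
    fix x y assume "x \<in> X'" "y \<in> X'" "f x = f y"
    then show "x = y" using D(2)[of x] D(2)[of y] ZU by (metis (no_types, lifting) X'_def X_def mem_Collect_eq)
  qed
  ultimately have "card X' \<le> card {a<..<b}"
    using card_inj_on_le finite_greaterThanLessThan by blast
  then have card: "card X' \<le> b - a" by simp
  have "sum ?h X = sum ?h X'"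
    using fin by (intro sum.mono_neutral_right) (auto simp: X'_def letter_height_def)
  \<comment> \<open>Every letter contributes at least \<open>- 1\<close>, so a sum of at most
    \<open>c - j\<close> takes at least \<open>j - c\<close> letters.\<close>
  also have "\<dots> \<ge> (\<Sum>x\<in>X'. - 1)" by (rule sum_mono) (auto simp: letter_height_def)
  finally have "int (card X') \<ge> int j - c" using sumX by simp
  then show ?thesis using card ab unfolding a_def[symmetric] b_def[symmetric] by linarith
qed

text \<open>The estimates of \<open>crossing_step\<close> at \<open>0\<close>, \<open>k\<close>,
  \<open>2 * k\<close>, ... are summed. The one at \<open>i * k\<close> moves the partner by at
  least \<open>i - c\<close>, so the last partner lies at least
  \<open>n * (n - 1) / 2 - c * n\<close> positions inside \<open>W\<close>.\<close>

lemma commutator_word_lower_bound: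
  assumes N: "N = k * n" "n > 0"
  shows "int (n * (n - 1)) \<le> 2 * int (length W) + 2 * c * int n"
proof -
  let ?L = "2 * N" and ?U = "Y @ W"
  have k: "0 < k" using cover[of "\<gamma> 0" 0] \<gamma>(1) by (cases k) auto
  have "int (i * (i - 1)) \<le> 2 * (int (f (?L - Suc (i * k))) - int ?L) + 2 * c * int i" if "i \<le> n" for i
    using that
  proof (induction i)
    case 0
    have "?L - Suc 0 < ?L" using N k by simp
    from Y_ge[OF this] show ?case by simp
  next
    case (Suc i)
    have ik: "i * k \<le> N" using Suc.prems N by (simp add: mult.commute)
    have "Suc i * k \<le> k * n" using mult_le_mono1[OF Suc.prems, of k] by (simp only: mult.commute)
    then have "i * k + k < ?L" using N k by (simp add: add.commute)
    from crossing_step[OF ik this]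
    have "int (f (?L - Suc (Suc i * k))) \<ge> int (f (?L - Suc (i * k))) + int (i * k) - c"
      by (simp add: add.commute)
    moreover have "int (i * k) \<ge> int i" using k by (simp only: of_nat_le_iff) simp
    moreover have "int (Suc i * (Suc i - 1)) = int (i * (i - 1)) + 2 * int i"
      by (cases i) (auto simp: algebra_simps)
    moreover have "int (i * (i - 1)) \<le> 2 * (int (f (?L - Suc (i * k))) - int ?L) + 2 * c * int i"
      using Suc by simp
    moreover have "2 * c * int (Suc i) = 2 * c * int i + 2 * c" by (simp add: algebra_simps)
    \<comment> \<open>One step of the sum, for arbitrary integers so that the nonlinear terms act as
      atoms.\<close>
    moreover have "A' \<le> 2 * (F' - L) + C'"
      if "F' \<ge> F + p - c" "p \<ge> q" "A' = A + 2 * q" "A \<le> 2 * (F - L) + C" "C' = C + 2 * c"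
      for A A' F F' L C C' p q :: int
    proof -
      have "2 * F' \<ge> 2 * F + 2 * q - 2 * c" using that(1,2) by simp
      then show ?thesis using that(3,4,5) by (simp add: right_diff_distrib)
    qed
    ultimately show ?case by blast
  qed
  from this[of n] have "int (n * (n - 1)) \<le> 2 * (int (f (?L - Suc (n * k))) - int ?L) + 2 * c * int n" by simp
  moreover have "f (?L - Suc (n * k)) < length ?U"
  proof (rule pairingD(1)[OF P])
    have "0 < N" using N k by simp
    then show "?L - Suc (n * k) < length ?U" using length_Y by simp
  qed
  ultimately show ?thesis by (simp add: length_Y)
qed

end

section \<open>Word length and growth\<close>

text \<open>An upper bound on the length which, unlike the \<open>LEAST\<close> in
  \<open>word_length\<close>, composes directly under products, inverses and powers, and which at
  the same time certifies membership in the generated subgroup.\<close>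

definition spelled :: "('a, 'b) monoid_scheme \<Rightarrow> 'a set \<Rightarrow> nat \<Rightarrow> 'a \<Rightarrow> bool" where
  "spelled G T n g \<longleftrightarrow> (\<exists>xs. length xs \<le> n \<and> set xs \<subseteq> T \<union> m_inv G ` T \<and> foldr (monoid.mult G) xs (one G) = g)"

section \<open>Spellings, word length and change of generating sets\<close>

context group
begin

lemma foldr_closed: "set xs \<subseteq> carrier G \<Longrightarrow> foldr (\<otimes>) xs \<one> \<in> carrier G"
  by (induction xs) auto

lemma foldr_append_mult:
  "set xs \<subseteq> carrier G \<Longrightarrow> set ys \<subseteq> carrier G \<Longrightarrow>
    foldr (\<otimes>) (xs @ ys) \<one> = foldr (\<otimes>) xs \<one> \<otimes> foldr (\<otimes>) ys \<one>"
  by (induction xs) (auto simp: m_assoc foldr_closed)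

lemma inv_foldr:
  "set xs \<subseteq> carrier G \<Longrightarrow> inv (foldr (\<otimes>) xs \<one>) = foldr (\<otimes>) (rev (map (m_inv G) xs)) \<one>"
proof (induction xs)
  case (Cons x xs)
  then have "foldr (\<otimes>) (rev (map (m_inv G) xs) @ [inv x]) \<one> = foldr (\<otimes>) (rev (map (m_inv G) xs)) \<one> \<otimes> inv x"
    by (subst foldr_append_mult) auto
  then show ?case using Cons by (simp add: inv_mult_group foldr_closed)
qed simp

context
  fixes T assumes T: "T \<subseteq> carrier G"
begin

lemma letters_subset: "T \<union> m_inv G ` T \<subseteq> carrier G"
  using T by auto

lemma spelled_closed: "spelled G T n g \<Longrightarrow> g \<in> carrier G"
  unfolding spelled_def using letters_subset foldr_closed by blast

lemma spelled_one: "spelled G T n \<one>"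
  unfolding spelled_def by (intro exI[of _ "[]"]) simp

lemma spelled_mono: "spelled G T m g \<Longrightarrow> m \<le> n \<Longrightarrow> spelled G T n g"
  unfolding spelled_def using le_trans by blast

lemma spelled_letter: "g \<in> T \<Longrightarrow> spelled G T 1 g"
  unfolding spelled_def using T by (intro exI[of _ "[g]"]) auto

lemma spelled_mult:
  assumes "spelled G T m g" "spelled G T n h"
  shows "spelled G T (m + n) (g \<otimes> h)"
proof -
  obtain xs ys where "length xs \<le> m" "set xs \<subseteq> T \<union> m_inv G ` T" "foldr (\<otimes>) xs \<one> = g"
    "length ys \<le> n" "set ys \<subseteq> T \<union> m_inv G ` T" "foldr (\<otimes>) ys \<one> = h"
    using assms unfolding spelled_def by blast
  then show ?thesis unfolding spelled_def
    using letters_subset foldr_append_mult[of xs ys]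
    by (intro exI[of _ "xs @ ys"]) (simp del: foldr_append add: order.trans)
qed

lemma spelled_inv:
  assumes "spelled G T n g"
  shows "spelled G T n (inv g)"
proof -
  obtain xs where xs: "length xs \<le> n" "set xs \<subseteq> T \<union> m_inv G ` T" "foldr (\<otimes>) xs \<one> = g"
    using assms unfolding spelled_def by blast
  have "inv x \<in> T \<union> m_inv G ` T" if "x \<in> T \<union> m_inv G ` T" for x
    using that T by auto
  then have "set (rev (map (m_inv G) xs)) \<subseteq> T \<union> m_inv G ` T" using xs(2) by fastforce
  then show ?thesis unfolding spelled_def
    using xs(1,3) inv_foldr[OF order.trans[OF xs(2) letters_subset]]
    by (intro exI[of _ "rev (map (m_inv G) xs)"]) simp
qed

lemma spelled_pow:
  assumes "spelled G T n g"
  shows "spelled G T (m * n) (g [^] m)"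
proof (induction m)
  case (Suc m)
  then show ?case using spelled_mult[OF Suc assms] by (simp add: add.commute)
qed (simp add: spelled_one)

lemma spelled_int_pow:
  assumes "spelled G T n g"
  shows "spelled G T (nat \<bar>m\<bar> * n) (g [^] (m :: int))"
proof (cases m rule: int_cases2)
  case (nonneg n')
  then show ?thesis using spelled_pow[OF assms, of n'] by (simp add: int_pow_int)
next
  case (nonpos n')
  then show ?thesis using spelled_inv[OF spelled_pow[OF assms, of n']] spelled_closed[OF assms]
    by (simp add: int_pow_neg_int)
qed

lemma spelled_generate: "spelled G T n g \<Longrightarrow> g \<in> generate G T"
proof -
  have "foldr (\<otimes>) xs \<one> \<in> generate G T" if "set xs \<subseteq> T \<union> m_inv G ` T" for xs
    using that by (induction xs) (auto intro: generate.intros)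
  then show "spelled G T n g \<Longrightarrow> g \<in> generate G T" unfolding spelled_def by blast
qed

lemma generate_spelled: "g \<in> generate G T \<Longrightarrow> \<exists>n. spelled G T n g"
proof (induction rule: generate.induct)
  case one then show ?case using spelled_one by blast
next
  case (incl h) then show ?case using spelled_letter by blast
next
  case (inv h) then show ?case using spelled_letter spelled_inv by blast
next
  case (eng h1 h2) then show ?case using spelled_mult by blast
qed

lemma word_length_le:
  assumes "spelled G T n g"
  shows "word_length G T g \<le> n"
proof -
  obtain xs where xs: "length xs \<le> n" "set xs \<subseteq> T \<union> m_inv G ` T" "foldr (\<otimes>) xs \<one> = g"
    using assms unfolding spelled_def by blast
  have "word_length G T g \<le> length xs"
    unfolding word_length_def by (rule Least_le) (use xs in blast)
  then show ?thesis using xs(1) by simp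
qed

lemma spelled_word_length: "g \<in> generate G T \<Longrightarrow> spelled G T (word_length G T g) g"
proof -
  assume "g \<in> generate G T"
  then obtain xs where "set xs \<subseteq> T \<union> m_inv G ` T \<and> foldr (\<otimes>) xs \<one> = g"
    using generate_spelled unfolding spelled_def by blast
  then have "\<exists>n xs. length xs = n \<and> set xs \<subseteq> T \<union> m_inv G ` T \<and> foldr (\<otimes>) xs \<one> = g" by blast
  from LeastI_ex[OF this] show ?thesis unfolding spelled_def word_length_def by (metis order_refl)
qed

lemma finite_spelled: "finite T \<Longrightarrow> finite {g. spelled G T n g}"
proof -
  assume "finite T"
  then have "finite {xs. set xs \<subseteq> T \<union> m_inv G ` T \<and> length xs \<le> n}"
    by (intro finite_lists_length_le) auto
  moreover have "{g. spelled G T n g} \<subseteq> (\<lambda>xs. foldr (\<otimes>) xs \<one>) ` {xs. set xs \<subseteq> T \<union> m_inv G ` T \<and> length xs \<le> n}"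
    unfolding spelled_def by blast
  ultimately show ?thesis using finite_surj by blast
qed

end

text \<open>Every letter of \<open>S\<close> is replaced by a word over \<open>T\<close>; the
  finitely many replacements have bounded length.\<close>

lemma word_length_change:
  assumes S: "finite S" "S \<subseteq> carrier G" and T: "T \<subseteq> carrier G" and ST: "S \<subseteq> generate G T"
  shows "\<exists>c>0. \<forall>g\<in>generate G S. word_length G T g \<le> c * word_length G S g"
proof -
  \<comment> \<open>The successor makes \<open>c\<close> positive, also when \<open>S\<close> is
    empty.\<close>
  define c where "c = Suc (Max (word_length G T ` S))"
  have c: "spelled G T c s" if s: "s \<in> S" for s
  proof -
    have "word_length G T s \<le> c" unfolding c_def using S s by (simp add: le_SucI)
    then show ?thesis using spelled_mono[OF T spelled_word_length[OF T]] ST s by blast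
  qed
  have step: "spelled G T (length xs * c) (foldr (\<otimes>) xs \<one>)" if "set xs \<subseteq> S \<union> m_inv G ` S" for xs
    using that
  proof (induction xs)
    case Nil then show ?case using spelled_one[OF T] by simp
  next
    case (Cons x xs)
    have "spelled G T c x" using Cons.prems c spelled_inv[OF T] by auto
    from spelled_mult[OF T this Cons.IH] show ?case using Cons.prems by simp
  qed
  have *: "spelled G T (n * c) g" if sp: "spelled G S n g" for n g
  proof -
    obtain xs where "length xs \<le> n" "set xs \<subseteq> S \<union> m_inv G ` S" "foldr (\<otimes>) xs \<one> = g"
      using sp unfolding spelled_def by blast
    then show ?thesis using step[of xs] spelled_mono[OF T] mult_le_mono1 by blast
  qed
  show ?thesis
  proof (intro exI[of _ c] conjI ballI)
    fix g assume "g \<in> generate G S"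
    from word_length_le[OF T *[OF spelled_word_length[OF S(2) this]]]
    show "word_length G T g \<le> c * word_length G S g" by (simp add: mult.commute)
  qed (simp add: c_def)
qed

text \<open>For \<open>k = 1\<close> the lower bound is trivially satisfied by \<open>h = \<one>\<close>.\<close>

lemma distortion_growthI:
  assumes X: "finite_generating_set G (carrier G) X" and T\<^sub>0: "finite_generating_set G H T\<^sub>0"
    and HG: "H \<subseteq> carrier G"
    and k: "k > 0"
    and upper: "\<And>h. h \<in> H \<Longrightarrow> word_length G T\<^sub>0 h \<le> C * word_length G X h ^ k"
    and lower: "\<And>n. \<exists>h\<in>H. word_length G X h \<le> K * n \<and> n ^ k \<le> K * word_length G T\<^sub>0 h + K * n"
  shows "distortion_growth k G H"
  unfolding distortion_growth_def
proof (intro conjI allI impI)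
  show "\<exists>S. finite_generating_set G (carrier G) S" "\<exists>T. finite_generating_set G H T"
    using X T\<^sub>0 by blast+
next
  fix S T assume S: "finite_generating_set G (carrier G) S" and T: "finite_generating_set G H T"
  note fS = S[unfolded finite_generating_set_def] and fT = T[unfolded finite_generating_set_def]
    and fX = X[unfolded finite_generating_set_def] and fT0 = T\<^sub>0[unfolded finite_generating_set_def]
  have change: "\<exists>c>0. \<forall>g\<in>A. word_length G Q g \<le> c * word_length G P g"
    if "finite P" "P \<subseteq> carrier G" "generate G P = A" "Q \<subseteq> carrier G" "generate G Q = A" for P A Q
  proof -
    have "P \<subseteq> generate G Q" using that generate.incl by (metis subsetI)
    with word_length_change[OF that(1,2,4)] that(3) show ?thesis by simp
  qed
  obtain c1 where c1: "c1 > 0" "\<And>g. g \<in> carrier G \<Longrightarrow> word_length G X g \<le> c1 * word_length G S g"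
    using change[of S "carrier G" X] fS fX by meson
  obtain c2 where c2: "c2 > 0" "\<And>g. g \<in> carrier G \<Longrightarrow> word_length G S g \<le> c2 * word_length G X g"
    using change[of X "carrier G" S] fX fS by meson
  obtain c3 where c3: "c3 > 0" "\<And>g. g \<in> H \<Longrightarrow> word_length G T g \<le> c3 * word_length G T\<^sub>0 g"
    using change[of T\<^sub>0 "H" T] fT0 fT by meson
  obtain c4 where c4: "c4 > 0" "\<And>g. g \<in> H \<Longrightarrow> word_length G T\<^sub>0 g \<le> c4 * word_length G T g"
    using change[of T "H" T\<^sub>0] fT fT0 by meson
  define B where "B r = {word_length G T h | h. h \<in> H \<and> real (word_length G S h) \<le> r}" for r
  have dist: "distortion G S H T r = of_nat (Max (B r))" for r by (simp add: distortion_def B_def)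
  \<comment> \<open>Balls are finite, so that \<open>Max\<close> is a genuine maximum.\<close>
  have finB: "finite (B r)" for r
  proof -
    have "{h \<in> H. real (word_length G S h) \<le> r} \<subseteq> {h. spelled G S (nat \<lfloor>r\<rfloor>) h}"
    proof
      fix h assume "h \<in> {h \<in> H. real (word_length G S h) \<le> r}"
      then have "h \<in> carrier G" "real (word_length G S h) \<le> r" using HG by blast+
      then have "h \<in> carrier G" "word_length G S h \<le> nat \<lfloor>r\<rfloor>" by (simp_all only: le_nat_floor)
      then show "h \<in> {h. spelled G S (nat \<lfloor>r\<rfloor>) h}"
        using spelled_mono[of S "word_length G S h" h] spelled_word_length[of S h] fS by simp
    qed
    moreover have "finite {h. spelled G S (nat \<lfloor>r\<rfloor>) h}" using finite_spelled fS by blast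
    ultimately have "finite {h \<in> H. real (word_length G S h) \<le> r}" using finite_subset by blast
    moreover have "B r = word_length G T ` {h \<in> H. real (word_length G S h) \<le> r}" by (auto simp: B_def)
    ultimately show ?thesis by simp
  qed
  define p where "p = monom (1::real) k"
  have p: "poly p x = x ^ k" for x by (simp add: p_def poly_monom)
  define A where "A = real (c3 * C * c1 ^ k) + 1"
  have one_H: "\<one> \<in> H" using fT0 generate.one by blast
  have one_len: "word_length G S \<one> = 0" using word_length_le[of S 0 "\<one>"] spelled_one[of S 0] fS by simp
  have up: "distortion G S H T x \<le> ennreal A * ennreal (poly p (1 * x)) + ennreal (1 * x)" if x: "x > 1" for x
  proof -
    \<comment> \<open>The identity lies in every ball, so the maximum is attained by some element of
      \<open>H\<close>.\<close>
    have "word_length G T \<one> \<in> B x"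
      unfolding B_def using one_H one_len x by (intro CollectI exI[of _ "\<one>"]) simp
    then have "Max (B x) \<in> B x" using finB Max_in[of "B x"] by blast
    then obtain h where h: "h \<in> H" "real (word_length G S h) \<le> x" "Max (B x) = word_length G T h"
      by (auto simp: B_def)
    have hG: "h \<in> carrier G" using h HG by auto
    have "word_length G T h \<le> c3 * word_length G T\<^sub>0 h" using c3 h by blast
    also have "\<dots> \<le> c3 * (C * word_length G X h ^ k)" using upper h by simp
    also have "\<dots> \<le> c3 * (C * (c1 * word_length G S h) ^ k)"
      by (intro mult_left_mono power_mono c1 hG) auto
    finally have "real (word_length G T h) \<le> real (c3 * (C * (c1 * word_length G S h) ^ k))"
      by (simp only: of_nat_le_iff)
    also have "\<dots> = real (c3 * C * c1 ^ k) * real (word_length G S h) ^ k"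
      by (simp add: power_mult_distrib)
    also have "\<dots> \<le> real (c3 * C * c1 ^ k) * x ^ k"
      by (intro mult_left_mono power_mono h) auto
    also have "\<dots> \<le> A * x ^ k" unfolding A_def using x by (intro mult_right_mono) auto
    finally have "ennreal (real (word_length G T h)) \<le> ennreal (A * x ^ k)" by (rule ennreal_leI)
    moreover have "ennreal (A * x ^ k) = ennreal A * ennreal (x ^ k)"
      using x by (intro ennreal_mult) (auto simp: A_def)
    ultimately show ?thesis
      by (simp add: dist h(3) p ennreal_of_nat_eq_real_of_nat add_increasing2)
  qed
  \<comment> \<open>The element provided for \<open>n\<close> has \<open>S\<close>-length at most
    \<open>c2 * K * n\<close>. The factor 2 comes from rounding \<open>x > 1\<close> up to an
    integer \<open>n \<le> 2 * x\<close>, and adding 1 keeps the constants positive.\<close>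
  define A' where "A' = real (K * c4) + 1"
  define B' where "B' = 2 * real (c2 * K) + 1"
  define C' where "C' = 2 * real K + 1"
  have lo: "ennreal (poly p x) \<le> ennreal A' * distortion G S H T (B' * x) + ennreal (C' * x)" if x: "x > 1" for x
  proof -
    define n where "n = nat \<lceil>x\<rceil>"
    have n: "x \<le> real n" "real n \<le> 2 * x" using x unfolding n_def by linarith+
    obtain h where h: "h \<in> H" "word_length G X h \<le> K * n" "n ^ k \<le> K * word_length G T\<^sub>0 h + K * n"
      using lower by blast
    have hG: "h \<in> carrier G" using h HG by auto
    have "word_length G S h \<le> c2 * (K * n)" using c2(2)[OF hG] h(2) le_trans mult_le_mono2 by blast
    then have "real (word_length G S h) \<le> real (c2 * (K * n))" by (simp only: of_nat_le_iff)
    also have "\<dots> = real (c2 * K) * real n" by simp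
    also have "\<dots> \<le> real (c2 * K) * (2 * x)" using n by (intro mult_left_mono) auto
    also have "\<dots> \<le> B' * x" using x by (simp add: B'_def algebra_simps)
    finally have "word_length G T h \<in> B (B' * x)" using h by (auto simp: B_def)
    then have M: "word_length G T h \<le> Max (B (B' * x))" using finB by simp
    have "n ^ k \<le> K * (c4 * Max (B (B' * x))) + K * n"
      using h(3) c4(2)[OF h(1)] M by (meson add_le_mono1 le_trans mult_le_mono2)
    then have "real (n ^ k) \<le> real (K * (c4 * Max (B (B' * x))) + K * n)" by (simp only: of_nat_le_iff)
    then have "real n ^ k \<le> real (K * c4) * real (Max (B (B' * x))) + real K * real n" by simp
    moreover have "x ^ k \<le> real n ^ k" using n x by (intro power_mono) auto
    moreover have "real (K * c4) * real (Max (B (B' * x))) \<le> A' * real (Max (B (B' * x)))"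
      by (intro mult_right_mono) (auto simp: A'_def)
    moreover have "real K * real n \<le> C' * x"
      using mult_left_mono[OF n(2), of "real K"] x by (simp add: C'_def algebra_simps)
    ultimately have "x ^ k \<le> A' * real (Max (B (B' * x))) + C' * x" by linarith
    then have "ennreal (x ^ k) \<le> ennreal (A' * real (Max (B (B' * x))) + C' * x)" by (rule ennreal_leI)
    also have "\<dots> = ennreal A' * ennreal (real (Max (B (B' * x)))) + ennreal (C' * x)"
      using x by (subst ennreal_plus) (auto simp: A'_def C'_def ennreal_mult)
    finally show ?thesis by (simp add: p dist ennreal_of_nat_eq_real_of_nat)
  qed
  have pos: "0 < A" "0 < A'" "0 < B'" "0 < C'"
    by (auto simp: A_def A'_def B'_def C'_def intro: add_nonneg_pos)
  show "polynomial_growth k (distortion G S H T)"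
    unfolding polynomial_growth_def growth_equiv_def growth_le_def
  proof (intro exI[of _ p] conjI allI impI)
    show "degree p = k" by (simp add: p_def degree_monom_eq)
    show "0 \<le> poly p x" if "0 \<le> x" for x using that by (simp add: p)
    show "\<exists>A B C D::real. 0 < A \<and> 0 < B \<and> 0 < C \<and> 0 < D \<and> (\<forall>x>D. distortion G S H T x \<le> ennreal A * ennreal (poly p (B * x)) + ennreal (C * x))"
      by (rule exI[of _ A], rule exI[of _ 1], rule exI[of _ 1], rule exI[of _ 1]) (use up pos in simp)
    show "\<exists>A B C D::real. 0 < A \<and> 0 < B \<and> 0 < C \<and> 0 < D \<and> (\<forall>x>D. ennreal (poly p x) \<le> ennreal A * distortion G S H T (B * x) + ennreal (C * x))"
      by (rule exI[of _ A'], rule exI[of _ B'], rule exI[of _ C'], rule exI[of _ 1]) (use lo pos in simp)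
  qed
qed

end

section \<open>Words in right-angled Artin groups\<close>

context group
begin

lemma commute_inv:
  assumes "x \<in> carrier G" "y \<in> carrier G" "x \<otimes> y = y \<otimes> x"
  shows "x \<otimes> inv y = inv y \<otimes> x"
  using assms by (metis inv_closed inv_solve_left inv_solve_right m_assoc m_closed)

lemma commute_mult:
  assumes "x \<in> carrier G" "y \<in> carrier G" "z \<in> carrier G" "x \<otimes> y = y \<otimes> x" "x \<otimes> z = z \<otimes> x"
  shows "x \<otimes> (y \<otimes> z) = (y \<otimes> z) \<otimes> x"
  using assms by (metis m_assoc)

lemma commute_int_pow:
  assumes "x \<in> carrier G" "y \<in> carrier G" "x \<otimes> y = y \<otimes> x"
  shows "x \<otimes> y [^] (m :: int) = y [^] m \<otimes> x"
proof (cases m rule: int_cases2)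
  case (nonneg n)
  have "x \<otimes> y [^] n = y [^] n \<otimes> x" using assms by (simp add: group_commutes_pow)
  then show ?thesis using nonneg by (simp add: int_pow_int)
next
  case (nonpos n)
  have "x \<otimes> y [^] n = y [^] n \<otimes> x" using assms by (simp add: group_commutes_pow)
  then show ?thesis using nonpos assms commute_inv[of x "y [^] n"] by (simp add: int_pow_neg_int)
qed

end

section \<open>Formal inverses and exponent sums\<close>

lemma height_inv_word [simp]: "height A (inv_word w) = - height A w"
  by (induction w) (auto simp: inv_word_def letter_height_def)

lemma abs_height_le: "\<bar>height A w\<bar> \<le> int (length w)"
  by (induction w) (auto simp: letter_height_def)

lemma inv_word_Cons: "inv_word ((s, b) # w) = inv_word w @ [(s, \<not> b)]"
  by (simp add: inv_word_def)

lemma inv_word_in_words: "w \<in> words V \<Longrightarrow> inv_word w \<in> words V"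
  by (induction w) (auto simp: inv_word_def)

lemma height_one_sign:
  assumes "\<forall>x\<in>set w. fst x \<in> A \<longrightarrow> snd x = b"
  shows "if b then height A w \<ge> 0 else height A w \<le> 0"
  using assms by (induction w) (auto simp: letter_height_def split: if_splits)

definition raag_relations :: "'v pair_pre_digraph \<Rightarrow> ('v word \<times> 'v word) set" where
  "raag_relations \<Gamma> = {([(s, True), (t, True)], [(t, True), (s, True)]) | s t. s \<rightarrow>\<^bsub>with_proj \<Gamma>\<^esub> t}"

lemma raag_conv: "raag \<Gamma> = presented_group (pverts \<Gamma>) (raag_relations \<Gamma>)"
  by (simp add: raag_def raag_relations_def)

section \<open>Words as representatives of group elements\<close>

locale raag_graph =
  fixes \<Gamma> :: "'v pair_pre_digraph"
  assumes pair_graph: "pair_graph \<Gamma>"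
begin

abbreviation "V \<equiv> pverts \<Gamma>"
abbreviation "E \<equiv> parcs \<Gamma>"
abbreviation "G \<equiv> raag \<Gamma>"
abbreviation "gens \<equiv> raag_gen \<Gamma> ` V"

definition cls :: "'v word \<Rightarrow> 'v word set" where
  "cls = word_class V (raag_relations \<Gamma>)"

lemma sym_E: "sym E" and irrefl_E: "irrefl E" and finite_V: "finite V" and E_V: "E \<subseteq> V \<times> V"
proof -
  interpret pair_graph \<Gamma> by (rule pair_graph)
  show "sym E" using arcs_symmetric by (auto intro: symI)
  show "irrefl E" using no_loops' by (auto intro: irreflI)
  show "finite V" by (rule pair_finite_verts)
  show "E \<subseteq> V \<times> V" using in_arcsD1 in_arcsD2 by auto
qed

sublocale group "raag \<Gamma>"
  unfolding raag_conv by (rule group_presented_group)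

lemma carrier_raag: "carrier G = cls ` words V"
  by (simp add: raag_conv presented_group_def cls_def)

lemma cls_closed: "w \<in> words V \<Longrightarrow> cls w \<in> carrier G"
  by (simp add: carrier_raag)

lemma cls_append: "v \<in> words V \<Longrightarrow> w \<in> words V \<Longrightarrow> cls (v @ w) = cls v \<otimes>\<^bsub>G\<^esub> cls w"
  unfolding raag_conv cls_def by (rule presented_group_mult[symmetric])

lemma cls_Nil: "cls [] = \<one>\<^bsub>G\<^esub>"
  by (simp add: raag_conv presented_group_def cls_def)

lemma cls_Cons: "s \<in> V \<Longrightarrow> w \<in> words V \<Longrightarrow> cls ((s, b) # w) = cls [(s, b)] \<otimes>\<^bsub>G\<^esub> cls w"
  using cls_append[of "[(s, b)]" w] by simp

lemma cls_eq_iff: "v \<in> words V \<Longrightarrow> w \<in> words V \<Longrightarrow> cls v = cls w \<longleftrightarrow> word_eq V (raag_relations \<Gamma>) v w"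
  unfolding cls_def by (rule word_class_eq_iff)

lemma raag_gen_conv: "raag_gen \<Gamma> s = cls [(s, True)]"
  by (simp add: raag_gen_def cls_def raag_relations_def)

lemma gen_closed: "s \<in> V \<Longrightarrow> raag_gen \<Gamma> s \<in> carrier G"
  unfolding raag_gen_conv by (rule cls_closed) auto

lemma cls_cancel: "s \<in> V \<Longrightarrow> cls [(s, b)] \<otimes>\<^bsub>G\<^esub> cls [(s, \<not> b)] = \<one>\<^bsub>G\<^esub>"
  using word_eq.cancel[of "[]" V "[]" s "raag_relations \<Gamma>" b] cls_append[of "[(s, b)]" "[(s, \<not> b)]"]
    cls_eq_iff[of "[(s, b), (s, \<not> b)]" "[]"]
  by (simp add: cls_Nil)

lemma cls_inv_letter: "s \<in> V \<Longrightarrow> cls [(s, \<not> b)] = inv\<^bsub>G\<^esub> cls [(s, b)]"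
  using cls_cancel[of s "\<not> b"] by (intro inv_equality[symmetric] cls_closed) auto

lemma cls_letter: "s \<in> V \<Longrightarrow> cls [(s, b)] = raag_gen \<Gamma> s [^]\<^bsub>G\<^esub> (if b then 1 else - 1 :: int)"
  using cls_inv_letter[of s True] gen_closed[of s] by (auto simp: raag_gen_conv int_pow_neg)

lemma cls_inv_word: "w \<in> words V \<Longrightarrow> cls (inv_word w) = inv\<^bsub>G\<^esub> cls w"
proof (induction w)
  case (Cons a w)
  obtain s b where a: "a = (s, b)" by force
  have w: "s \<in> V" "w \<in> words V" using Cons.prems a by auto
  have "cls (inv_word (a # w)) = cls (inv_word w) \<otimes>\<^bsub>G\<^esub> cls [(s, \<not> b)]"
    unfolding a inv_word_Cons using w by (intro cls_append inv_word_in_words) auto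
  also have "\<dots> = inv\<^bsub>G\<^esub> cls w \<otimes>\<^bsub>G\<^esub> inv\<^bsub>G\<^esub> cls [(s, b)]"
    using Cons.IH w cls_inv_letter by simp
  also have "\<dots> = inv\<^bsub>G\<^esub> (cls [(s, b)] \<otimes>\<^bsub>G\<^esub> cls w)"
    using w cls_closed[of "[(s, b)]"] cls_closed[of w] by (simp add: inv_mult_group)
  finally show ?case using cls_Cons[OF w] a by simp
qed (simp add: inv_word_def cls_Nil)

lemma height_word_eq: "word_eq V (raag_relations \<Gamma>) v w \<Longrightarrow> height A v = height A w"
  by (induction rule: word_eq.induct) (auto simp: letter_height_def raag_relations_def)

lemma height_cls_eq:
  "cls v = cls w \<Longrightarrow> v \<in> words V \<Longrightarrow> w \<in> words V \<Longrightarrow> height A v = height A w"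
  using height_word_eq cls_eq_iff by blast

text \<open>Only the existence of a pairing is preserved, not a particular one. Both directions of
  each elementary move are needed: insertion and deletion for cancellation, and two swaps for a
  commutation.\<close>

lemma word_eq_pairing:
  "word_eq V (raag_relations \<Gamma>) v w \<Longrightarrow> (\<exists>f. pairing E v f) \<longleftrightarrow> (\<exists>f. pairing E w f)"
proof (induction rule: word_eq.induct)
  case (cancel u v s b)
  then show ?case using pairing_insert[of E u v _ s b] pairing_delete[of E u s b v] sym_E by blast
next
  case (relation u v l r)
  then obtain s t where st: "l = [(s, True), (t, True)]" "r = [(t, True), (s, True)]" "(s, t) \<in> E"
    by (auto simp: raag_relations_def)
  then have "(t, s) \<in> E" using sym_E by (meson symD)
  then show ?case
    unfolding st using st(3) pairing_swap[of E u "(s, True)" "(t, True)" v] sym_E irrefl_E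
      pairing_swap[of E u "(t, True)" "(s, True)" v] by auto
qed auto

lemma trivial_word_pairing:
  assumes "w \<in> words V" "cls w = \<one>\<^bsub>G\<^esub>"
  shows "\<exists>f. pairing E w f"
proof -
  have "word_eq V (raag_relations \<Gamma>) w []"
    using assms cls_eq_iff[of w "[]"] by (simp add: cls_Nil)
  moreover have "pairing E [] id" by (rule pairingI) auto
  ultimately show ?thesis using word_eq_pairing by blast
qed

lemma gen_commute:
  assumes "(s, t) \<in> E"
  shows "raag_gen \<Gamma> s \<otimes>\<^bsub>G\<^esub> raag_gen \<Gamma> t = raag_gen \<Gamma> t \<otimes>\<^bsub>G\<^esub> raag_gen \<Gamma> s"
proof -
  have st: "s \<in> V" "t \<in> V" using assms E_V by auto
  have "word_eq V (raag_relations \<Gamma>) ([] @ [(s, True), (t, True)] @ []) ([] @ [(t, True), (s, True)] @ [])"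
    by (rule word_eq.relation) (use assms st in \<open>auto simp: raag_relations_def\<close>)
  then have "cls ([(s, True)] @ [(t, True)]) = cls ([(t, True)] @ [(s, True)])"
    using cls_eq_iff[of "[(s, True), (t, True)]" "[(t, True), (s, True)]"] st by simp
  then show ?thesis
    using st cls_append[of "[(s, True)]" "[(t, True)]"] cls_append[of "[(t, True)]" "[(s, True)]"]
    by (simp add: raag_gen_conv)
qed

lemma commute_cls:
  assumes "g \<in> carrier G" "w \<in> words V"
    and "\<And>s. s \<in> fst ` set w \<Longrightarrow> g \<otimes>\<^bsub>G\<^esub> raag_gen \<Gamma> s = raag_gen \<Gamma> s \<otimes>\<^bsub>G\<^esub> g"
  shows "g \<otimes>\<^bsub>G\<^esub> cls w = cls w \<otimes>\<^bsub>G\<^esub> g"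
  using assms(2,3)
proof (induction w rule: list.induct)
  case Nil
  then show ?case using assms(1) by (simp add: cls_Nil)
next
  case (Cons a w)
  obtain s b where a: "a = (s, b)" by force
  have w: "s \<in> V" "w \<in> words V" using Cons.prems(1) a by auto
  have "g \<otimes>\<^bsub>G\<^esub> cls [(s, b)] = cls [(s, b)] \<otimes>\<^bsub>G\<^esub> g"
    unfolding cls_letter[OF w(1)] using Cons.prems(2) a gen_closed w assms(1)
    by (intro commute_int_pow) auto
  moreover have "g \<otimes>\<^bsub>G\<^esub> cls w = cls w \<otimes>\<^bsub>G\<^esub> g"
    using Cons.IH[OF w(2)] Cons.prems(2) by simp
  moreover have "cls [(s, b)] \<in> carrier G" "cls w \<in> carrier G"
    using w by (auto intro: cls_closed)
  ultimately show ?case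
    unfolding a cls_Cons[OF w] using assms(1) by (intro commute_mult)
qed

lemma gens_subset: "gens \<subseteq> carrier G"
  using gen_closed by auto

text \<open>The generators and their inverses are exactly the classes of one-letter words, so
  spellings in the group and formal words correspond with equal length.\<close>

lemma spelled_gens_iff:
  "spelled G gens n g \<longleftrightarrow> (\<exists>w\<in>words V. length w \<le> n \<and> cls w = g)"
proof
  have letter: "\<exists>s\<in>V. \<exists>b. x = cls [(s, b)]" if x: "x \<in> gens \<union> m_inv G ` gens" for x
  proof -
    consider s where "s \<in> V" "x = cls [(s, True)]" | s where "s \<in> V" "x = inv\<^bsub>G\<^esub> cls [(s, True)]"
      using x by (auto simp: raag_gen_conv)
    then show ?thesis using cls_inv_letter[of _ True] by metis
  qed
  have spell: "\<exists>w\<in>words V. length w = length xs \<and> cls w = foldr (\<otimes>\<^bsub>G\<^esub>) xs \<one>\<^bsub>G\<^esub>"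
    if "set xs \<subseteq> gens \<union> m_inv G ` gens" for xs
    using that
  proof (induction xs)
    case Nil show ?case by (rule bexI[of _ "[]"]) (simp_all add: cls_Nil)
  next
    case (Cons x xs)
    then have x: "x \<in> gens \<union> m_inv G ` gens" and xs: "set xs \<subseteq> gens \<union> m_inv G ` gens" by auto
    from letter[OF x] obtain s b where "s \<in> V" "x = cls [(s, b)]" by blast
    moreover from Cons.IH[OF xs] obtain w where
      "w \<in> words V" "length w = length xs" "cls w = foldr (\<otimes>\<^bsub>G\<^esub>) xs \<one>\<^bsub>G\<^esub>" by blast
    ultimately show ?case
      using cls_Cons[of s w b] by (intro bexI[of _ "(s, b) # w"]) simp_all
  qed
  assume "spelled G gens n g"
  then obtain xs where "length xs \<le> n" "set xs \<subseteq> gens \<union> m_inv G ` gens" "foldr (\<otimes>\<^bsub>G\<^esub>) xs \<one>\<^bsub>G\<^esub> = g"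
    unfolding spelled_def by blast
  with spell[of xs] show "\<exists>w\<in>words V. length w \<le> n \<and> cls w = g" by metis
next
  have gs: "spelled G gens 1 (cls [(s, b)])" if "s \<in> V" for s b
  proof -
    have "spelled G gens 1 (raag_gen \<Gamma> s)"
      using that by (intro spelled_letter gens_subset) auto
    from this spelled_inv[OF gens_subset this] show ?thesis
      using cls_inv_letter[OF that, of True] by (cases b) (auto simp: raag_gen_conv)
  qed
  have sp: "spelled G gens (length w) (cls w)" if "w \<in> words V" for w
    using that
  proof (induction w rule: list.induct)
    case Nil then show ?case using spelled_one[OF gens_subset] by (simp add: cls_Nil)
  next
    case (Cons a w)
    obtain s b where a: "a = (s, b)" by force
    have w: "s \<in> V" "w \<in> words V" using Cons.prems a by auto
    from spelled_mult[OF gens_subset gs[OF w(1)] Cons.IH[OF w(2)]]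
    show ?case by (simp add: a cls_Cons[OF w])
  qed
  assume "\<exists>w\<in>words V. length w \<le> n \<and> cls w = g"
  then show "spelled G gens n g"
  proof
    fix w assume "w \<in> words V" "length w \<le> n \<and> cls w = g"
    then show "spelled G gens n g" using sp[of w] spelled_mono[OF gens_subset] by auto
  qed
qed

lemma generate_gens: "generate G gens = carrier G"
proof
  show "generate G gens \<subseteq> carrier G" by (rule generate_incl[OF gens_subset])
  show "carrier G \<subseteq> generate G gens"
  proof
    fix g assume "g \<in> carrier G"
    then obtain w where "w \<in> words V" "cls w = g" by (auto simp: carrier_raag)
    then have "spelled G gens (length w) g" unfolding spelled_gens_iff by blast
    then show "g \<in> generate G gens" by (rule spelled_generate[OF gens_subset])
  qed
qed

lemma finite_generating_set_gens: "finite_generating_set G (carrier G) gens"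
  using generate_gens gens_subset finite_V by (simp add: finite_generating_set_def)

lemma word_length_gens_le: "w \<in> words V \<Longrightarrow> word_length G gens (cls w) \<le> length w"
  using word_length_le[OF gens_subset] spelled_gens_iff by blast

lemma geodesic_word:
  "g \<in> carrier G \<Longrightarrow> \<exists>w\<in>words V. length w \<le> word_length G gens g \<and> cls w = g"
  using spelled_word_length[OF gens_subset] generate_gens spelled_gens_iff by simp

end

section \<open>Rewriting words into edge generators\<close>

locale labelled_raag = raag_graph \<Gamma> for \<Gamma> :: "'v pair_pre_digraph" +
  fixes lab :: "'v \<Rightarrow> nat"
begin

definition label_class :: "nat \<Rightarrow> 'v set" where
  "label_class i = {v \<in> V. lab v = i}"

text \<open>The kernel of \<Phi> in terms of exponent sums, without reference to \<Phi>; the two are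
  identified in \<open>bestvina_brady_conv\<close>.\<close>

definition bb_subgroup :: "'v word set set" where
  "bb_subgroup = cls ` {w \<in> words V. \<forall>i. height (label_class i) w = 0}"

definition edge_gens :: "'v word set set" where
  "edge_gens = {cls [(v, True), (w, False)] | v w. (v, w) \<in> E \<and> lab v = lab w}"

definition relabel :: "('v \<Rightarrow> 'v) \<Rightarrow> 'v word \<Rightarrow> 'v word" where
  "relabel \<phi> w = map (\<lambda>(s, b). (\<phi> s, b)) w"

lemma relabel_simps [simp]:
  "relabel \<phi> [] = []" "relabel \<phi> ((s, b) # w) = (\<phi> s, b) # relabel \<phi> w"
  "relabel \<phi> (v @ w) = relabel \<phi> v @ relabel \<phi> w"
  by (auto simp: relabel_def)

lemma set_relabel: "fst ` set (relabel \<phi> w) = \<phi> ` fst ` set w"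
  by (force simp: relabel_def)

lemma relabel_in_words: "(\<And>s. s \<in> fst ` set w \<Longrightarrow> \<phi> s \<in> V) \<Longrightarrow> relabel \<phi> w \<in> words V"
  by (fastforce simp: relabel_def)

lemma finite_edge_gens: "finite edge_gens"
proof -
  have "finite E" using E_V finite_V by (meson finite_SigmaI finite_subset)
  then have "finite ((\<lambda>(v, w). cls [(v, True), (w, False)]) ` E)" by simp
  moreover have "edge_gens \<subseteq> (\<lambda>(v, w). cls [(v, True), (w, False)]) ` E"
    by (auto simp: edge_gens_def)
  ultimately show ?thesis by (rule finite_subset[rotated])
qed

lemma edge_gens_subset: "edge_gens \<subseteq> carrier G"
  using E_V by (auto simp: edge_gens_def intro!: cls_closed)

lemma edge_genI: "(v, w) \<in> E \<Longrightarrow> lab v = lab w \<Longrightarrow> raag_gen \<Gamma> v \<otimes>\<^bsub>G\<^esub> inv\<^bsub>G\<^esub> raag_gen \<Gamma> w \<in> edge_gens"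
proof -
  assume *: "(v, w) \<in> E" "lab v = lab w"
  then have "v \<in> V" "w \<in> V" using E_V by auto
  then have "raag_gen \<Gamma> v \<otimes>\<^bsub>G\<^esub> inv\<^bsub>G\<^esub> raag_gen \<Gamma> w = cls [(v, True), (w, False)]"
    using cls_append[of "[(v, True)]" "[(w, False)]"] cls_inv_letter[of w True]
    by (simp add: raag_gen_conv)
  then show ?thesis using * by (auto simp: edge_gens_def)
qed

lemma commute_letter:
  assumes "(s, t) \<in> E \<or> s = t" "s \<in> V" "t \<in> V"
  shows "cls [(s, b)] \<otimes>\<^bsub>G\<^esub> raag_gen \<Gamma> t = raag_gen \<Gamma> t \<otimes>\<^bsub>G\<^esub> cls [(s, b)]"
proof -
  have "raag_gen \<Gamma> t \<otimes>\<^bsub>G\<^esub> raag_gen \<Gamma> s = raag_gen \<Gamma> s \<otimes>\<^bsub>G\<^esub> raag_gen \<Gamma> t"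
    using assms(1) gen_commute by metis
  from commute_int_pow[OF gen_closed gen_closed this] show ?thesis
    unfolding cls_letter[OF assms(2)] using assms by simp
qed

text \<open>The relabelled word uses only the pairwise commuting vertices \<open>u i\<close>. Its
  first letter can therefore be moved next to a later one with the same label and opposite exponent
  and cancelled; this is an induction on the length.\<close>

lemma zero_height_trivial:
  assumes u: "\<And>i. i \<in> lab ` V \<Longrightarrow> u i \<in> V"
    "\<And>i j. i \<in> lab ` V \<Longrightarrow> j \<in> lab ` V \<Longrightarrow> i \<noteq> j \<Longrightarrow> (u i, u j) \<in> E"
  shows "w \<in> words V \<Longrightarrow> \<forall>i. height (label_class i) w = 0 \<Longrightarrow> cls (relabel (\<lambda>v. u (lab v)) w) = \<one>\<^bsub>G\<^esub>"
proof (induction "length w" arbitrary: w rule: less_induct)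
  case less
  show ?case
  proof (cases w)
    case Nil then show ?thesis by (simp add: cls_Nil)
  next
    case (Cons a w')
    obtain s b where a: "a = (s, b)" by force
    have sV: "s \<in> V" and w'V: "w' \<in> words V" using less.prems(1) Cons a by auto
    \<comment> \<open>If all later letters with the label of \<open>s\<close> had the same exponent
      as the first letter, the exponent sum over this class could not vanish.\<close>
    have "\<exists>t. (t, \<not> b) \<in> set w' \<and> lab t = lab s"
    proof (rule ccontr)
      assume none: "\<not> ?thesis"
      have "\<forall>x\<in>set w'. fst x \<in> label_class (lab s) \<longrightarrow> snd x = b"
      proof (intro ballI impI, rule ccontr)
        fix x assume x: "x \<in> set w'" "fst x \<in> label_class (lab s)" "snd x \<noteq> b"
        then have "(fst x, \<not> b) = x" by (simp add: prod_eq_iff)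
        then have "(fst x, \<not> b) \<in> set w'" using x(1) by simp
        then show False using none x(2) by (auto simp: label_class_def)
      qed
      from height_one_sign[OF this] have "height (label_class (lab s)) w \<noteq> 0"
        using Cons a sV by (auto simp: letter_height_def label_class_def split: if_splits)
      then show False using less.prems(2) by simp
    qed
    then obtain t where t: "(t, \<not> b) \<in> set w'" "lab t = lab s" by blast
    then obtain x y where xy: "w' = x @ (t, \<not> b) # y" by (meson split_list)
    have V: "t \<in> V" "x \<in> words V" "y \<in> words V" using w'V xy by auto
    let ?r = "relabel (\<lambda>v. u (lab v))" and ?U = "u (lab s)"
    have U: "?U \<in> V" using u sV by simp
    have rV: "?r v \<in> words V" if "v \<in> words V" for v using that u by (intro relabel_in_words) auto
    have comm: "cls [(?U, b)] \<otimes>\<^bsub>G\<^esub> cls (?r x) = cls (?r x) \<otimes>\<^bsub>G\<^esub> cls [(?U, b)]"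
    proof (rule commute_cls[OF _ rV[OF V(2)]])
      show "cls [(?U, b)] \<in> carrier G" using U by (intro cls_closed) auto
      fix q assume "q \<in> fst ` set (?r x)"
      then obtain p where "p \<in> V" "q = u (lab p)" using V(2) unfolding set_relabel by fastforce
      then show "cls [(?U, b)] \<otimes>\<^bsub>G\<^esub> raag_gen \<Gamma> q = raag_gen \<Gamma> q \<otimes>\<^bsub>G\<^esub> cls [(?U, b)]"
        using u sV U by (intro commute_letter) (metis imageI)+
    qed
    note C = cls_closed[OF rV[OF V(2)]] cls_closed[OF rV[OF V(3)]]
      cls_closed[of "[(?U, b)]"] cls_closed[of "[(?U, \<not> b)]"]
    have "cls (?r w) = cls [(?U, b)] \<otimes>\<^bsub>G\<^esub> cls (?r x @ (?U, \<not> b) # ?r y)"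
      using Cons a xy t(2) U rV[OF V(2)] rV[OF V(3)]
        cls_Cons[of ?U "?r x @ (?U, \<not> b) # ?r y" b] by simp
    also have "cls (?r x @ (?U, \<not> b) # ?r y) = cls (?r x) \<otimes>\<^bsub>G\<^esub> (cls [(?U, \<not> b)] \<otimes>\<^bsub>G\<^esub> cls (?r y))"
      using U rV[OF V(2)] rV[OF V(3)] cls_append[of "?r x" "(?U, \<not> b) # ?r y"] cls_Cons[of ?U "?r y" "\<not> b"] by simp
    also have "cls [(?U, b)] \<otimes>\<^bsub>G\<^esub> (cls (?r x) \<otimes>\<^bsub>G\<^esub> (cls [(?U, \<not> b)] \<otimes>\<^bsub>G\<^esub> cls (?r y)))
        = cls (?r x) \<otimes>\<^bsub>G\<^esub> (cls [(?U, b)] \<otimes>\<^bsub>G\<^esub> cls [(?U, \<not> b)]) \<otimes>\<^bsub>G\<^esub> cls (?r y)"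
    proof -
      have "cls [(?U, b)] \<otimes>\<^bsub>G\<^esub> (cls (?r x) \<otimes>\<^bsub>G\<^esub> (cls [(?U, \<not> b)] \<otimes>\<^bsub>G\<^esub> cls (?r y)))
        = (cls [(?U, b)] \<otimes>\<^bsub>G\<^esub> cls (?r x)) \<otimes>\<^bsub>G\<^esub> (cls [(?U, \<not> b)] \<otimes>\<^bsub>G\<^esub> cls (?r y))"
        using C U by (simp add: m_assoc)
      then show ?thesis unfolding comm using C U by (simp add: m_assoc)
    qed
    also have "\<dots> = cls (?r (x @ y))"
      using C U cls_cancel[OF U] cls_append[OF rV[OF V(2)] rV[OF V(3)]] by simp
    also have "\<dots> = \<one>\<^bsub>G\<^esub>"
    proof (rule less.hyps)
      show "length (x @ y) < length w" "x @ y \<in> words V" using Cons xy V by auto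
      show "\<forall>i. height (label_class i) (x @ y) = 0"
      proof
        fix i
        have "height (label_class i) w = height (label_class i) (x @ y)"
          using Cons a xy t V sV by (auto simp: letter_height_def label_class_def)
        then show "height (label_class i) (x @ y) = 0" using less.prems(2) by simp
      qed
    qed
    finally show ?thesis .
  qed
qed

text \<open>For a negative exponent the element is the product of \<open>inv s\<close> and
  \<open>t\<close>. Since \<open>s\<close> and \<open>t\<close> commute it is the edge generator of
  \<open>(t, s)\<close>, so either sign costs at most one generator.\<close>

lemma spelled_edge:
  assumes "s \<in> V" "t = s \<or> (s, t) \<in> E \<and> lab t = lab s"
  shows "spelled G edge_gens 1 (cls [(s, b)] \<otimes>\<^bsub>G\<^esub> inv\<^bsub>G\<^esub> cls [(t, b)])"
proof (cases "t = s")
  case True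
  have "cls [(s, b)] \<otimes>\<^bsub>G\<^esub> inv\<^bsub>G\<^esub> cls [(t, b)] = \<one>\<^bsub>G\<^esub>"
    unfolding True using assms by (intro r_inv cls_closed) auto
  then show ?thesis using spelled_one[OF edge_gens_subset] by simp
next
  case False
  then have st: "(s, t) \<in> E" "lab s = lab t" "(t, s) \<in> E" "t \<in> V"
    using assms sym_E E_V by (auto dest: symD)
  note C = gen_closed[OF assms(1)] gen_closed[OF st(4)]
  show ?thesis
  proof (cases b)
    case True
    then show ?thesis
      using spelled_letter[OF edge_gens_subset edge_genI[OF st(1,2)]] by (simp add: raag_gen_conv)
  next
    case b: False
    have "cls [(s, b)] \<otimes>\<^bsub>G\<^esub> inv\<^bsub>G\<^esub> cls [(t, b)] = inv\<^bsub>G\<^esub> raag_gen \<Gamma> s \<otimes>\<^bsub>G\<^esub> raag_gen \<Gamma> t"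
      using b C cls_letter[OF assms(1), of False] cls_letter[OF st(4), of False] by (simp add: int_pow_neg)
    also have "\<dots> = raag_gen \<Gamma> t \<otimes>\<^bsub>G\<^esub> inv\<^bsub>G\<^esub> raag_gen \<Gamma> s"
      by (rule commute_inv[symmetric]) (use C gen_commute[OF st(3)] in auto)
    finally show ?thesis
      using spelled_letter[OF edge_gens_subset edge_genI[OF st(3) st(2)[symmetric]]] by simp
  qed
qed

text \<open>Let \<open>x\<close> and \<open>y\<close> be the first letters before and after the
  replacement, and \<open>C\<close> and \<open>D\<close> the remaining words. As \<open>y\<close>
  commutes with \<open>C\<close> and \<open>D\<close>, the quotient of \<open>x C\<close> by
  \<open>y D\<close> is that of \<open>x\<close> by \<open>y\<close> times that of \<open>C\<close>
  by \<open>D\<close>. Every letter thus costs at most one generator, with no conjugation.\<close>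

lemma spelled_relabel:
  assumes "w \<in> words V"
    and "\<And>s. s \<in> fst ` set w \<Longrightarrow> \<phi> s \<in> V \<and> (\<phi> s = s \<or> (s, \<phi> s) \<in> E \<and> lab (\<phi> s) = lab s)"
    and "\<And>s t. s \<in> fst ` set w \<Longrightarrow> t \<in> fst ` set w \<Longrightarrow> (\<phi> s, t) \<in> E \<or> \<phi> s = t"
    and "\<And>s t. s \<in> fst ` set w \<Longrightarrow> t \<in> fst ` set w \<Longrightarrow> (\<phi> s, \<phi> t) \<in> E \<or> \<phi> s = \<phi> t"
  shows "spelled G edge_gens (length w) (cls w \<otimes>\<^bsub>G\<^esub> inv\<^bsub>G\<^esub> cls (relabel \<phi> w))"
  using assms
proof (induction w rule: list.induct)
  case Nil
  then show ?case using spelled_one[OF edge_gens_subset] by (simp add: cls_Nil)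
next
  case (Cons a w)
  obtain s b where a: "a = (s, b)" by force
  have sV: "s \<in> V" and wV: "w \<in> words V" using Cons.prems(1) a by auto
  have \<phi>: "\<phi> s \<in> V" "\<phi> s = s \<or> (s, \<phi> s) \<in> E \<and> lab (\<phi> s) = lab s" using Cons.prems(2)[of s] a by auto
  have IH: "spelled G edge_gens (length w) (cls w \<otimes>\<^bsub>G\<^esub> inv\<^bsub>G\<^esub> cls (relabel \<phi> w))"
    by (rule Cons.IH[OF wV]) (use Cons.prems(2-4) in auto)
  have rV: "relabel \<phi> w \<in> words V" using Cons.prems(2) by (intro relabel_in_words) auto
  let ?x = "cls [(s, b)]" and ?y = "cls [(\<phi> s, b)]" and ?C = "cls w" and ?D = "cls (relabel \<phi> w)"
  have C: "?x \<in> carrier G" "?y \<in> carrier G" "?C \<in> carrier G" "?D \<in> carrier G"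
    using sV wV \<phi>(1) rV by (auto intro!: cls_closed)
  have yC: "?y \<otimes>\<^bsub>G\<^esub> ?C = ?C \<otimes>\<^bsub>G\<^esub> ?y"
  proof (rule commute_cls[OF C(2) wV])
    fix t assume t: "t \<in> fst ` set w"
    then have "t \<in> V" using wV by auto
    then show "?y \<otimes>\<^bsub>G\<^esub> raag_gen \<Gamma> t = raag_gen \<Gamma> t \<otimes>\<^bsub>G\<^esub> ?y"
      using Cons.prems(3)[of s t] t a \<phi> by (intro commute_letter) auto
  qed
  have yD: "?y \<otimes>\<^bsub>G\<^esub> ?D = ?D \<otimes>\<^bsub>G\<^esub> ?y"
  proof (rule commute_cls[OF C(2) rV])
    fix t assume t: "t \<in> fst ` set (relabel \<phi> w)"
    then obtain r where r: "r \<in> fst ` set w" "t = \<phi> r" unfolding set_relabel by blast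
    then show "?y \<otimes>\<^bsub>G\<^esub> raag_gen \<Gamma> t = raag_gen \<Gamma> t \<otimes>\<^bsub>G\<^esub> ?y"
      using Cons.prems(4)[of s r] Cons.prems(2)[of r] a \<phi> by (intro commute_letter) auto
  qed
  have "?y \<otimes>\<^bsub>G\<^esub> (?C \<otimes>\<^bsub>G\<^esub> inv\<^bsub>G\<^esub> ?D) = (?C \<otimes>\<^bsub>G\<^esub> inv\<^bsub>G\<^esub> ?D) \<otimes>\<^bsub>G\<^esub> ?y"
    using C yC yD by (intro commute_mult commute_inv) auto
  then have "(?C \<otimes>\<^bsub>G\<^esub> inv\<^bsub>G\<^esub> ?D) \<otimes>\<^bsub>G\<^esub> inv\<^bsub>G\<^esub> ?y = inv\<^bsub>G\<^esub> ?y \<otimes>\<^bsub>G\<^esub> (?C \<otimes>\<^bsub>G\<^esub> inv\<^bsub>G\<^esub> ?D)"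
    using C by (intro commute_inv) auto
  then have "?x \<otimes>\<^bsub>G\<^esub> inv\<^bsub>G\<^esub> ?y \<otimes>\<^bsub>G\<^esub> (?C \<otimes>\<^bsub>G\<^esub> inv\<^bsub>G\<^esub> ?D) = ?x \<otimes>\<^bsub>G\<^esub> ((?C \<otimes>\<^bsub>G\<^esub> inv\<^bsub>G\<^esub> ?D) \<otimes>\<^bsub>G\<^esub> inv\<^bsub>G\<^esub> ?y)"
    using C by (simp add: m_assoc)
  also have "\<dots> = (?x \<otimes>\<^bsub>G\<^esub> ?C) \<otimes>\<^bsub>G\<^esub> inv\<^bsub>G\<^esub> (?y \<otimes>\<^bsub>G\<^esub> ?D)"
    using C by (simp add: m_assoc inv_mult_group)
  also have "\<dots> = cls (a # w) \<otimes>\<^bsub>G\<^esub> inv\<^bsub>G\<^esub> cls (relabel \<phi> (a # w))"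
    using cls_Cons[OF sV wV] cls_Cons[OF \<phi>(1) rV] a by simp
  finally show ?case using spelled_mult[OF edge_gens_subset spelled_edge[OF sV \<phi>(2)] IH, of b] by simp
qed

end

section \<open>Replacement by dominating vertices and its quadratic cost\<close>

locale dominated_raag = labelled_raag +
  fixes u :: "nat \<Rightarrow> 'a"
  assumes u_in: "\<And>i. i \<in> lab ` V \<Longrightarrow> u i \<in> V \<and> lab (u i) = i"
    and u_dom: "\<And>i v. i \<in> lab ` V \<Longrightarrow> v \<in> V \<Longrightarrow> lab v \<noteq> i \<Longrightarrow> (u i, v) \<in> E"
    and conn: "\<And>v. v \<in> V \<Longrightarrow> (u (lab v), v) \<in> {(v, w). (v, w) \<in> E \<and> lab v = lab w}\<^sup>*"
begin

abbreviation "ugen v \<equiv> raag_gen \<Gamma> (u (lab v))"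

lemma u_lab: "v \<in> V \<Longrightarrow> u (lab v) \<in> V" "v \<in> V \<Longrightarrow> lab (u (lab v)) = lab v"
  using u_in by auto

text \<open>Along an edge from \<open>s\<close> to \<open>t\<close> the two generators commute, so
  \<open>s^m t^(-m)\<close> is the \<open>m\<close>-th power of one edge generator. These quotients
  telescope along a path from the dominating vertex to \<open>v\<close>, and \<open>D\<close> counts
  the edges of the path.\<close>

lemma spelled_path:
  assumes "v \<in> V"
  shows "\<exists>D. \<forall>m :: int. spelled G edge_gens (D * nat \<bar>m\<bar>) (ugen v [^]\<^bsub>G\<^esub> m \<otimes>\<^bsub>G\<^esub> inv\<^bsub>G\<^esub> (raag_gen \<Gamma> v [^]\<^bsub>G\<^esub> m))"
proof -
  let ?U = "u (lab v)"
  have "w \<in> V \<and> (\<exists>D. \<forall>m :: int. spelled G edge_gens (D * nat \<bar>m\<bar>) (raag_gen \<Gamma> ?U [^]\<^bsub>G\<^esub> m \<otimes>\<^bsub>G\<^esub> inv\<^bsub>G\<^esub> (raag_gen \<Gamma> w [^]\<^bsub>G\<^esub> m)))"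
    if "(?U, w) \<in> {(v, w). (v, w) \<in> E \<and> lab v = lab w}\<^sup>*" for w
    using that
  proof (induction rule: rtrancl_induct)
    case base
    have "spelled G edge_gens (0 * nat \<bar>m\<bar>) (raag_gen \<Gamma> ?U [^]\<^bsub>G\<^esub> m \<otimes>\<^bsub>G\<^esub> inv\<^bsub>G\<^esub> (raag_gen \<Gamma> ?U [^]\<^bsub>G\<^esub> m))" for m :: int
      using spelled_one[OF edge_gens_subset] gen_closed[OF u_lab(1)[OF assms]] by simp
    then show ?case using u_lab(1)[OF assms] by blast
  next
    case (step s t)
    then obtain D where D: "\<And>m :: int. spelled G edge_gens (D * nat \<bar>m\<bar>)
        (raag_gen \<Gamma> ?U [^]\<^bsub>G\<^esub> m \<otimes>\<^bsub>G\<^esub> inv\<^bsub>G\<^esub> (raag_gen \<Gamma> s [^]\<^bsub>G\<^esub> m))" by blast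
    have st: "(s, t) \<in> E" "lab s = lab t" "s \<in> V" "t \<in> V" using step E_V by auto
    note C = gen_closed[OF st(3)] gen_closed[OF st(4)] gen_closed[OF u_lab(1)[OF assms]]
    have "spelled G edge_gens (Suc D * nat \<bar>m\<bar>) (raag_gen \<Gamma> ?U [^]\<^bsub>G\<^esub> m \<otimes>\<^bsub>G\<^esub> inv\<^bsub>G\<^esub> (raag_gen \<Gamma> t [^]\<^bsub>G\<^esub> m))" for m :: int
    proof -
      have "raag_gen \<Gamma> s \<otimes>\<^bsub>G\<^esub> inv\<^bsub>G\<^esub> raag_gen \<Gamma> t = inv\<^bsub>G\<^esub> raag_gen \<Gamma> t \<otimes>\<^bsub>G\<^esub> raag_gen \<Gamma> s"
        using C gen_commute[OF st(1)] by (intro commute_inv) auto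
      then have "(raag_gen \<Gamma> s \<otimes>\<^bsub>G\<^esub> inv\<^bsub>G\<^esub> raag_gen \<Gamma> t) [^]\<^bsub>G\<^esub> m
          = raag_gen \<Gamma> s [^]\<^bsub>G\<^esub> m \<otimes>\<^bsub>G\<^esub> inv\<^bsub>G\<^esub> (raag_gen \<Gamma> t [^]\<^bsub>G\<^esub> m)"
        using int_pow_mult_distrib[of "raag_gen \<Gamma> s" "inv\<^bsub>G\<^esub> raag_gen \<Gamma> t" m] C
        by (simp only: int_pow_inv inv_closed)
      then have "spelled G edge_gens (nat \<bar>m\<bar> * 1) (raag_gen \<Gamma> s [^]\<^bsub>G\<^esub> m \<otimes>\<^bsub>G\<^esub> inv\<^bsub>G\<^esub> (raag_gen \<Gamma> t [^]\<^bsub>G\<^esub> m))"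
        using spelled_int_pow[OF edge_gens_subset spelled_letter[OF edge_gens_subset edge_genI[OF st(1,2)]], of m] by simp
      from spelled_mult[OF edge_gens_subset D[of m] this]
      have "spelled G edge_gens (D * nat \<bar>m\<bar> + nat \<bar>m\<bar> * 1) ((raag_gen \<Gamma> ?U [^]\<^bsub>G\<^esub> m \<otimes>\<^bsub>G\<^esub> inv\<^bsub>G\<^esub> (raag_gen \<Gamma> s [^]\<^bsub>G\<^esub> m)) \<otimes>\<^bsub>G\<^esub>
          (raag_gen \<Gamma> s [^]\<^bsub>G\<^esub> m \<otimes>\<^bsub>G\<^esub> inv\<^bsub>G\<^esub> (raag_gen \<Gamma> t [^]\<^bsub>G\<^esub> m)))" .
      moreover have "(x \<otimes>\<^bsub>G\<^esub> inv\<^bsub>G\<^esub> y) \<otimes>\<^bsub>G\<^esub> (y \<otimes>\<^bsub>G\<^esub> inv\<^bsub>G\<^esub> z) = x \<otimes>\<^bsub>G\<^esub> inv\<^bsub>G\<^esub> z"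
        if "x \<in> carrier G" "y \<in> carrier G" "z \<in> carrier G" for x y z
        using that by (simp add: m_assoc inv_solve_left')
      ultimately show ?thesis using C by (simp add: add.commute)
    qed
    then show ?case using st by blast
  qed
  from this[OF conn[OF assms]] show ?thesis by blast
qed

lemma spelled_path_uniform:
  "\<exists>D. \<forall>v\<in>V. \<forall>m :: int. spelled G edge_gens (D * nat \<bar>m\<bar>) (ugen v [^]\<^bsub>G\<^esub> m \<otimes>\<^bsub>G\<^esub> inv\<^bsub>G\<^esub> (raag_gen \<Gamma> v [^]\<^bsub>G\<^esub> m))"
proof -
  obtain D where D: "\<And>v m. v \<in> V \<Longrightarrow> spelled G edge_gens (D v * nat \<bar>m :: int\<bar>) (ugen v [^]\<^bsub>G\<^esub> m \<otimes>\<^bsub>G\<^esub> inv\<^bsub>G\<^esub> (raag_gen \<Gamma> v [^]\<^bsub>G\<^esub> m))"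
    using bchoice[of V "\<lambda>v D. \<forall>m :: int. spelled G edge_gens (D * nat \<bar>m\<bar>) (ugen v [^]\<^bsub>G\<^esub> m \<otimes>\<^bsub>G\<^esub> inv\<^bsub>G\<^esub> (raag_gen \<Gamma> v [^]\<^bsub>G\<^esub> m))"]
      spelled_path by blast
  have "spelled G edge_gens (Max (D ` V) * nat \<bar>m\<bar>) (ugen v [^]\<^bsub>G\<^esub> m \<otimes>\<^bsub>G\<^esub> inv\<^bsub>G\<^esub> (raag_gen \<Gamma> v [^]\<^bsub>G\<^esub> m))"
    if "v \<in> V" for v and m :: int
    by (rule spelled_mono[OF edge_gens_subset D]) (use that finite_V in auto)
  then show ?thesis by blast
qed

text \<open>With \<open>u\<close> the dominating vertex and \<open>e\<close> the exponent of the
  letter, \<open>u^m (v^e u^(-e)) u^(-m)\<close> is the quotient of \<open>u^m v^(-m)\<close> by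
  \<open>u^(m+e) v^(-m-e)\<close>. Both have linear cost by \<open>D\<close>.\<close>

lemma spelled_conj:
  assumes D: "\<And>v m. v \<in> V \<Longrightarrow> spelled G edge_gens (D * nat \<bar>m :: int\<bar>) (ugen v [^]\<^bsub>G\<^esub> m \<otimes>\<^bsub>G\<^esub> inv\<^bsub>G\<^esub> (raag_gen \<Gamma> v [^]\<^bsub>G\<^esub> m))"
    and v: "v \<in> V"
  shows "spelled G edge_gens (D * (2 * nat \<bar>m :: int\<bar> + 1))
    (ugen v [^]\<^bsub>G\<^esub> m \<otimes>\<^bsub>G\<^esub> (cls [(v, b)] \<otimes>\<^bsub>G\<^esub> inv\<^bsub>G\<^esub> cls [(u (lab v), b)]) \<otimes>\<^bsub>G\<^esub> inv\<^bsub>G\<^esub> (ugen v [^]\<^bsub>G\<^esub> m))"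
proof -
  let ?s = "raag_gen \<Gamma> v" and ?U = "ugen v"
  define e where "e = (if b then 1 else - 1 :: int)"
  note C = gen_closed[OF v] gen_closed[OF u_lab(1)[OF v]]
  have letters: "cls [(v, b)] = ?s [^]\<^bsub>G\<^esub> e" "cls [(u (lab v), b)] = ?U [^]\<^bsub>G\<^esub> e"
    unfolding e_def by (rule cls_letter, use u_lab v in simp)+
  have "?U [^]\<^bsub>G\<^esub> m \<otimes>\<^bsub>G\<^esub> (?s [^]\<^bsub>G\<^esub> e \<otimes>\<^bsub>G\<^esub> inv\<^bsub>G\<^esub> (?U [^]\<^bsub>G\<^esub> e)) \<otimes>\<^bsub>G\<^esub> inv\<^bsub>G\<^esub> (?U [^]\<^bsub>G\<^esub> m)
      = ?U [^]\<^bsub>G\<^esub> m \<otimes>\<^bsub>G\<^esub> ?s [^]\<^bsub>G\<^esub> e \<otimes>\<^bsub>G\<^esub> inv\<^bsub>G\<^esub> (?U [^]\<^bsub>G\<^esub> (m + e))"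
    using C by (simp add: m_assoc int_pow_mult inv_mult_group)
  also have "\<dots> = (?U [^]\<^bsub>G\<^esub> m \<otimes>\<^bsub>G\<^esub> inv\<^bsub>G\<^esub> (?s [^]\<^bsub>G\<^esub> m)) \<otimes>\<^bsub>G\<^esub> (?s [^]\<^bsub>G\<^esub> (m + e) \<otimes>\<^bsub>G\<^esub> inv\<^bsub>G\<^esub> (?U [^]\<^bsub>G\<^esub> (m + e)))"
  proof -
    have "?s [^]\<^bsub>G\<^esub> e = inv\<^bsub>G\<^esub> (?s [^]\<^bsub>G\<^esub> m) \<otimes>\<^bsub>G\<^esub> ?s [^]\<^bsub>G\<^esub> (m + e)"
      using C by (simp add: int_pow_mult inv_solve_left)
    then show ?thesis using C by (simp add: m_assoc)
  qed
  also have "?s [^]\<^bsub>G\<^esub> (m + e) \<otimes>\<^bsub>G\<^esub> inv\<^bsub>G\<^esub> (?U [^]\<^bsub>G\<^esub> (m + e)) = inv\<^bsub>G\<^esub> (?U [^]\<^bsub>G\<^esub> (m + e) \<otimes>\<^bsub>G\<^esub> inv\<^bsub>G\<^esub> (?s [^]\<^bsub>G\<^esub> (m + e)))"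
    using C by (simp add: inv_mult_group)
  finally have "spelled G edge_gens (D * nat \<bar>m\<bar> + D * nat \<bar>m + e\<bar>)
    (?U [^]\<^bsub>G\<^esub> m \<otimes>\<^bsub>G\<^esub> (?s [^]\<^bsub>G\<^esub> e \<otimes>\<^bsub>G\<^esub> inv\<^bsub>G\<^esub> (?U [^]\<^bsub>G\<^esub> e)) \<otimes>\<^bsub>G\<^esub> inv\<^bsub>G\<^esub> (?U [^]\<^bsub>G\<^esub> m))"
    using spelled_mult[OF edge_gens_subset D[OF v, of m] spelled_inv[OF edge_gens_subset D[OF v, of "m + e"]]] by simp
  moreover have "D * nat \<bar>m\<bar> + D * nat \<bar>m + e\<bar> \<le> D * (2 * nat \<bar>m\<bar> + 1)"
  proof -
    have "nat \<bar>m\<bar> + nat \<bar>m + e\<bar> \<le> 2 * nat \<bar>m\<bar> + 1" by (auto simp: e_def)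
    then show ?thesis by (metis add_mult_distrib2 mult_le_mono2)
  qed
  ultimately show ?thesis unfolding letters using spelled_mono[OF edge_gens_subset] by blast
qed

text \<open>A letter \<open>u j\<close> with \<open>j \<noteq> i\<close> commutes with
  \<open>x\<close> and with \<open>u i\<close>, hence drops out of the conjugation. What remains is
  conjugation by \<open>u i\<close> to the exponent sum over the class of \<open>i\<close>.\<close>

lemma conj_relabel:
  assumes i: "i \<in> lab ` V" and x: "x \<in> carrier G"
    and comm: "\<And>j. j \<in> lab ` V \<Longrightarrow> j \<noteq> i \<Longrightarrow> x \<otimes>\<^bsub>G\<^esub> raag_gen \<Gamma> (u j) = raag_gen \<Gamma> (u j) \<otimes>\<^bsub>G\<^esub> x"
  shows "w \<in> words V \<Longrightarrow> cls (relabel (\<lambda>v. u (lab v)) w) \<otimes>\<^bsub>G\<^esub> x \<otimes>\<^bsub>G\<^esub> inv\<^bsub>G\<^esub> cls (relabel (\<lambda>v. u (lab v)) w) =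
    raag_gen \<Gamma> (u i) [^]\<^bsub>G\<^esub> height (label_class i) w \<otimes>\<^bsub>G\<^esub> x \<otimes>\<^bsub>G\<^esub> inv\<^bsub>G\<^esub> (raag_gen \<Gamma> (u i) [^]\<^bsub>G\<^esub> height (label_class i) w)"
proof (induction w rule: list.induct)
  case Nil
  then show ?case using x by (simp add: cls_Nil)
next
  case (Cons a w)
  obtain s b where a: "a = (s, b)" by force
  have sV: "s \<in> V" and wV: "w \<in> words V" using Cons.prems a by auto
  let ?U = "raag_gen \<Gamma> (u i)" and ?m = "height (label_class i) w" and ?X = "cls (relabel (\<lambda>v. u (lab v)) w)"
    and ?y = "cls [(u (lab s), b)]"
  have rV: "relabel (\<lambda>v. u (lab v)) w \<in> words V" using u_lab(1) wV by (intro relabel_in_words) auto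
  have C: "?U \<in> carrier G" "?X \<in> carrier G" "?y \<in> carrier G"
    using u_in[OF i] u_lab(1)[OF sV] rV by (auto intro!: cls_closed gen_closed)
  have split: "(p \<otimes>\<^bsub>G\<^esub> q) \<otimes>\<^bsub>G\<^esub> x \<otimes>\<^bsub>G\<^esub> inv\<^bsub>G\<^esub> (p \<otimes>\<^bsub>G\<^esub> q) = p \<otimes>\<^bsub>G\<^esub> (q \<otimes>\<^bsub>G\<^esub> x \<otimes>\<^bsub>G\<^esub> inv\<^bsub>G\<^esub> q) \<otimes>\<^bsub>G\<^esub> inv\<^bsub>G\<^esub> p"
    if "p \<in> carrier G" "q \<in> carrier G" for p q
    using that x by (simp add: m_assoc inv_mult_group)
  have "cls (relabel (\<lambda>v. u (lab v)) (a # w)) \<otimes>\<^bsub>G\<^esub> x \<otimes>\<^bsub>G\<^esub> inv\<^bsub>G\<^esub> cls (relabel (\<lambda>v. u (lab v)) (a # w))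
      = ?y \<otimes>\<^bsub>G\<^esub> (?X \<otimes>\<^bsub>G\<^esub> x \<otimes>\<^bsub>G\<^esub> inv\<^bsub>G\<^esub> ?X) \<otimes>\<^bsub>G\<^esub> inv\<^bsub>G\<^esub> ?y"
    using cls_Cons[OF u_lab(1)[OF sV] rV] split[OF C(3,2)] a by simp
  also have "\<dots> = ?y \<otimes>\<^bsub>G\<^esub> (?U [^]\<^bsub>G\<^esub> ?m \<otimes>\<^bsub>G\<^esub> x \<otimes>\<^bsub>G\<^esub> inv\<^bsub>G\<^esub> (?U [^]\<^bsub>G\<^esub> ?m)) \<otimes>\<^bsub>G\<^esub> inv\<^bsub>G\<^esub> ?y"
    using Cons.IH[OF wV] by simp
  also have "\<dots> = ?U [^]\<^bsub>G\<^esub> height (label_class i) (a # w) \<otimes>\<^bsub>G\<^esub> x \<otimes>\<^bsub>G\<^esub> inv\<^bsub>G\<^esub> (?U [^]\<^bsub>G\<^esub> height (label_class i) (a # w))"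
  proof (cases "lab s = i")
    case True
    define e where "e = (if b then 1 else - 1 :: int)"
    have "?y = ?U [^]\<^bsub>G\<^esub> e" unfolding e_def using cls_letter u_in[OF i] True by simp
    moreover have "height (label_class i) (a # w) = e + ?m"
      using True sV a by (simp add: e_def letter_height_def label_class_def)
    ultimately show ?thesis using C split[of "?U [^]\<^bsub>G\<^esub> e" "?U [^]\<^bsub>G\<^esub> ?m"] by (simp add: int_pow_mult)
  next
    case False
    let ?z = "?U [^]\<^bsub>G\<^esub> ?m \<otimes>\<^bsub>G\<^esub> x \<otimes>\<^bsub>G\<^esub> inv\<^bsub>G\<^esub> (?U [^]\<^bsub>G\<^esub> ?m)"
    have yU: "?y \<otimes>\<^bsub>G\<^esub> ?U = ?U \<otimes>\<^bsub>G\<^esub> ?y"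
      using False u_lab[OF sV] u_in[OF i] u_dom[of "lab s" "u i"] sV by (intro commute_letter) auto
    have "x \<otimes>\<^bsub>G\<^esub> ?y = ?y \<otimes>\<^bsub>G\<^esub> x"
      unfolding cls_letter[OF u_lab(1)[OF sV]]
      by (rule commute_int_pow[OF x gen_closed[OF u_lab(1)[OF sV]] comm]) (use False sV in auto)
    then have "?y \<otimes>\<^bsub>G\<^esub> ?z = ?z \<otimes>\<^bsub>G\<^esub> ?y"
      using C x yU by (intro commute_mult commute_inv commute_int_pow) auto
    then have "?y \<otimes>\<^bsub>G\<^esub> ?z \<otimes>\<^bsub>G\<^esub> inv\<^bsub>G\<^esub> ?y = ?z" using C x by (simp add: m_assoc)
    moreover have "height (label_class i) (a # w) = ?m"
      using False a by (simp add: letter_height_def label_class_def)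
    ultimately show ?thesis by simp
  qed
  finally show ?case .
qed

text \<open>Letters are replaced from the left. Replacing one letter costs a factor conjugated by
  the relabelled prefix, and the exponent sums of the prefix are at most its length. Fixing the
  bound \<open>N\<close> in advance makes the cost per letter uniform in the induction.\<close>

lemma spelled_dominated:
  assumes D: "\<And>v m. v \<in> V \<Longrightarrow> spelled G edge_gens (D * nat \<bar>m :: int\<bar>) (ugen v [^]\<^bsub>G\<^esub> m \<otimes>\<^bsub>G\<^esub> inv\<^bsub>G\<^esub> (raag_gen \<Gamma> v [^]\<^bsub>G\<^esub> m))"
  shows "w \<in> words V \<Longrightarrow> length w \<le> N \<Longrightarrow>
    spelled G edge_gens (length w * (D * (2 * N + 1))) (cls w \<otimes>\<^bsub>G\<^esub> inv\<^bsub>G\<^esub> cls (relabel (\<lambda>v. u (lab v)) w))"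
proof (induction w rule: rev_induct)
  case Nil
  then show ?case using spelled_one[OF edge_gens_subset] by (simp add: cls_Nil)
next
  case (snoc a w)
  obtain s b where a: "a = (s, b)" by force
  have sV: "s \<in> V" and wV: "w \<in> words V" using snoc.prems(1) a by auto
  have rV: "relabel (\<lambda>v. u (lab v)) w \<in> words V" using u_lab(1) wV by (intro relabel_in_words) auto
  note us = u_lab[OF sV]
  let ?x = "cls [(s, b)]" and ?y = "cls [(u (lab s), b)]" and ?C = "cls w" and ?X = "cls (relabel (\<lambda>v. u (lab v)) w)"
  let ?m = "height (label_class (lab s)) w"
  have C: "?x \<in> carrier G" "?y \<in> carrier G" "?C \<in> carrier G" "?X \<in> carrier G"
    using sV wV us rV by (auto intro!: cls_closed)
  \<comment> \<open>Both \<open>s\<close> and \<open>u (lab s)\<close> have the label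
    \<open>lab s\<close>, so the dominating vertices of the other classes commute with their
    quotient.\<close>
  have "?X \<otimes>\<^bsub>G\<^esub> (?x \<otimes>\<^bsub>G\<^esub> inv\<^bsub>G\<^esub> ?y) \<otimes>\<^bsub>G\<^esub> inv\<^bsub>G\<^esub> ?X
      = ugen s [^]\<^bsub>G\<^esub> ?m \<otimes>\<^bsub>G\<^esub> (?x \<otimes>\<^bsub>G\<^esub> inv\<^bsub>G\<^esub> ?y) \<otimes>\<^bsub>G\<^esub> inv\<^bsub>G\<^esub> (ugen s [^]\<^bsub>G\<^esub> ?m)"
  proof (rule conj_relabel[OF _ _ _ wV])
    fix j assume j: "j \<in> lab ` V" "j \<noteq> lab s"
    then have uj: "(u j, s) \<in> E" "(u j, u (lab s)) \<in> E" "u j \<in> V"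
      using u_dom[of j s] u_dom[of j "u (lab s)"] u_in[of j] sV us by auto
    then have "(s, u j) \<in> E" "(u (lab s), u j) \<in> E" using sym_E by (auto dest: symD)
    then have "raag_gen \<Gamma> (u j) \<otimes>\<^bsub>G\<^esub> ?x = ?x \<otimes>\<^bsub>G\<^esub> raag_gen \<Gamma> (u j)" "raag_gen \<Gamma> (u j) \<otimes>\<^bsub>G\<^esub> ?y = ?y \<otimes>\<^bsub>G\<^esub> raag_gen \<Gamma> (u j)"
      using commute_letter[of s "u j" b] commute_letter[of "u (lab s)" "u j" b] sV us uj by auto
    then have "raag_gen \<Gamma> (u j) \<otimes>\<^bsub>G\<^esub> (?x \<otimes>\<^bsub>G\<^esub> inv\<^bsub>G\<^esub> ?y) = (?x \<otimes>\<^bsub>G\<^esub> inv\<^bsub>G\<^esub> ?y) \<otimes>\<^bsub>G\<^esub> raag_gen \<Gamma> (u j)"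
      using C gen_closed[OF uj(3)] by (intro commute_mult commute_inv) auto
    then show "(?x \<otimes>\<^bsub>G\<^esub> inv\<^bsub>G\<^esub> ?y) \<otimes>\<^bsub>G\<^esub> raag_gen \<Gamma> (u j) = raag_gen \<Gamma> (u j) \<otimes>\<^bsub>G\<^esub> (?x \<otimes>\<^bsub>G\<^esub> inv\<^bsub>G\<^esub> ?y)" by simp
  qed (use C sV in auto)
  then have "spelled G edge_gens (D * (2 * nat \<bar>?m\<bar> + 1)) (?X \<otimes>\<^bsub>G\<^esub> (?x \<otimes>\<^bsub>G\<^esub> inv\<^bsub>G\<^esub> ?y) \<otimes>\<^bsub>G\<^esub> inv\<^bsub>G\<^esub> ?X)"
    using spelled_conj[OF D sV, where m = ?m and b = b] by simp
  moreover have "nat \<bar>?m\<bar> \<le> N" using abs_height_le[of "label_class (lab s)" w] snoc.prems(2) by simp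
  ultimately have "spelled G edge_gens (D * (2 * N + 1)) (?X \<otimes>\<^bsub>G\<^esub> (?x \<otimes>\<^bsub>G\<^esub> inv\<^bsub>G\<^esub> ?y) \<otimes>\<^bsub>G\<^esub> inv\<^bsub>G\<^esub> ?X)"
    by (elim spelled_mono[OF edge_gens_subset]) simp
  moreover have "spelled G edge_gens (length w * (D * (2 * N + 1))) (?C \<otimes>\<^bsub>G\<^esub> inv\<^bsub>G\<^esub> ?X)"
    using snoc.IH[OF wV] snoc.prems(2) by simp
  ultimately have "spelled G edge_gens (length w * (D * (2 * N + 1)) + D * (2 * N + 1))
      ((?C \<otimes>\<^bsub>G\<^esub> inv\<^bsub>G\<^esub> ?X) \<otimes>\<^bsub>G\<^esub> (?X \<otimes>\<^bsub>G\<^esub> (?x \<otimes>\<^bsub>G\<^esub> inv\<^bsub>G\<^esub> ?y) \<otimes>\<^bsub>G\<^esub> inv\<^bsub>G\<^esub> ?X))"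
    by (intro spelled_mult[OF edge_gens_subset])
  moreover have "(?C \<otimes>\<^bsub>G\<^esub> inv\<^bsub>G\<^esub> ?X) \<otimes>\<^bsub>G\<^esub> (?X \<otimes>\<^bsub>G\<^esub> (?x \<otimes>\<^bsub>G\<^esub> inv\<^bsub>G\<^esub> ?y) \<otimes>\<^bsub>G\<^esub> inv\<^bsub>G\<^esub> ?X)
      = (?C \<otimes>\<^bsub>G\<^esub> ?x) \<otimes>\<^bsub>G\<^esub> inv\<^bsub>G\<^esub> (?X \<otimes>\<^bsub>G\<^esub> ?y)"
  proof -
    have "inv\<^bsub>G\<^esub> ?X \<otimes>\<^bsub>G\<^esub> (?X \<otimes>\<^bsub>G\<^esub> z) = z" if "z \<in> carrier G" for z
      using that C by (simp add: m_assoc[symmetric])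
    then show ?thesis using C by (simp add: m_assoc inv_mult_group)
  qed
  moreover have "cls (w @ [a]) = ?C \<otimes>\<^bsub>G\<^esub> ?x" using cls_append[of w "[a]"] wV sV a by simp
  moreover have "cls (relabel (\<lambda>v. u (lab v)) (w @ [a])) = ?X \<otimes>\<^bsub>G\<^esub> ?y"
    using cls_append[of "relabel (\<lambda>v. u (lab v)) w" "[(u (lab s), b)]"] rV us a by simp
  ultimately show ?case by (simp add: add.commute)
qed

end

section \<open>Distortion bounds\<close>

context labelled_raag
begin

definition label_union :: "nat set \<Rightarrow> 'v set" where
  "label_union I = {v \<in> V. lab v \<in> I}"

lemma label_class_conv: "label_class i = label_union {i}"
  by (auto simp: label_class_def label_union_def)

lemma edge_letter_word:
  assumes "x \<in> edge_gens \<union> m_inv G ` edge_gens"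
  shows "\<exists>v w. v \<in> V \<and> w \<in> V \<and> lab v = lab w \<and> x = cls [(v, True), (w, False)]"
proof -
  have "x \<in> edge_gens \<Longrightarrow> ?thesis" using E_V by (auto simp: edge_gens_def)
  moreover have ?thesis if x: "x \<in> m_inv G ` edge_gens"
  proof -
    obtain v w where vw: "(v, w) \<in> E" "lab v = lab w" "x = inv\<^bsub>G\<^esub> cls [(v, True), (w, False)]"
      using x by (auto simp: edge_gens_def)
    then have "v \<in> V" "w \<in> V" using E_V by auto
    moreover from this have "x = cls [(w, True), (v, False)]"
      using cls_inv_word[of "[(v, True), (w, False)]"] vw(3) by (simp add: inv_word_def)
    ultimately show ?thesis using vw(2) by metis
  qed
  ultimately show ?thesis using assms by blast
qed

text \<open>Every edge generator, and every inverse of one, is written with its positive letter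
  first. Its two letters have the same label, so each height returns to 0 after every generator and
  is at most 1 in between. This yields the low word of the lower bound, with
  \<open>c = 1\<close>.\<close>

lemma spelled_edge_gens_word:
  assumes "spelled G edge_gens n g"
  shows "\<exists>W\<in>words V. cls W = g \<and> length W \<le> 2 * n \<and> (\<forall>I. height (label_union I) W = 0) \<and>
    (\<forall>I a. height (label_union I) (take a W) \<le> 1)"
proof -
  have "\<exists>W\<in>words V. cls W = foldr (\<otimes>\<^bsub>G\<^esub>) xs \<one>\<^bsub>G\<^esub> \<and> length W = 2 * length xs \<and> (\<forall>I. height (label_union I) W = 0) \<and>
    (\<forall>I a. height (label_union I) (take a W) \<le> 1)"
    if "set xs \<subseteq> edge_gens \<union> m_inv G ` edge_gens" for xs
    using that
  proof (induction xs)
    case Nil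
    show ?case by (rule bexI[of _ "[]"]) (simp_all add: cls_Nil)
  next
    case (Cons x xs)
    then have x: "x \<in> edge_gens \<union> m_inv G ` edge_gens" and xs: "set xs \<subseteq> edge_gens \<union> m_inv G ` edge_gens" by auto
    obtain W where W: "W \<in> words V" "cls W = foldr (\<otimes>\<^bsub>G\<^esub>) xs \<one>\<^bsub>G\<^esub>" "length W = 2 * length xs"
      "\<And>I. height (label_union I) W = 0" "\<And>I a. height (label_union I) (take a W) \<le> 1"
      using Cons.IH[OF xs] by blast
    obtain v w where vw: "v \<in> V" "w \<in> V" "lab v = lab w" "x = cls [(v, True), (w, False)]"
      using edge_letter_word[OF x] by blast
    let ?W = "[(v, True), (w, False)] @ W"
    have letters: "letter_height (label_union I) (v, True) + letter_height (label_union I) (w, False) = 0"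
      "letter_height (label_union I) (v, True) \<le> 1" for I
      using vw by (auto simp: letter_height_def label_union_def)
    show ?case
    proof (intro bexI[of _ ?W] conjI allI)
      show "cls ?W = foldr (\<otimes>\<^bsub>G\<^esub>) (x # xs) \<one>\<^bsub>G\<^esub>"
        using cls_append[of "[(v, True), (w, False)]" W] vw W by simp
      show "height (label_union I) ?W = 0" for I using letters(1)[of I] W(4)[of I] by simp
      show "height (label_union I) (take a ?W) \<le> 1" for I a
      proof (cases a)
        case (Suc a')
        then show ?thesis
          using letters[of I] W(5)[of I "a' - 1"] by (cases a') simp_all
      qed simp
    qed (use vw W in simp_all)
  qed
  note * = this
  obtain xs where xs: "length xs \<le> n" "set xs \<subseteq> edge_gens \<union> m_inv G ` edge_gens" "foldr (\<otimes>\<^bsub>G\<^esub>) xs \<one>\<^bsub>G\<^esub> = g"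
    using assms unfolding spelled_def by blast
  from *[OF xs(2)] obtain W where "W \<in> words V" "cls W = g" "length W = 2 * length xs"
    "\<forall>I. height (label_union I) W = 0" "\<forall>I a. height (label_union I) (take a W) \<le> 1"
    unfolding xs(3) by blast
  then show ?thesis using xs(1) by (intro bexI[of _ W]) simp_all
qed

lemma generate_edge_gens_subset: "generate G edge_gens \<subseteq> bb_subgroup"
proof
  fix g assume "g \<in> generate G edge_gens"
  then obtain n where "spelled G edge_gens n g" using generate_spelled[OF edge_gens_subset] by blast
  from spelled_edge_gens_word[OF this] show "g \<in> bb_subgroup"
    unfolding bb_subgroup_def label_class_conv by blast
qed

text \<open>The upper bound is applied to a shortest word over \<open>gens\<close>; this word also
  has vanishing heights, because heights depend only on the group element. The same bound shows that
  the edge generators generate the subgroup.\<close>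

lemma bb_subgroup_distortion:
  assumes k: "k > 0"
    and upper: "\<And>w. w \<in> words V \<Longrightarrow> \<forall>i. height (label_class i) w = 0 \<Longrightarrow> spelled G edge_gens (C * length w ^ k) (cls w)"
    and lower: "\<And>n. \<exists>h\<in>bb_subgroup. word_length G gens h \<le> K * n \<and> n ^ k \<le> K * word_length G edge_gens h + K * n"
  shows "distortion_growth k G bb_subgroup"
proof (rule distortion_growthI[OF finite_generating_set_gens _ _ k _ lower])
  have "bb_subgroup \<subseteq> generate G edge_gens"
    using upper spelled_generate[OF edge_gens_subset] by (auto simp: bb_subgroup_def)
  then show "finite_generating_set G bb_subgroup edge_gens"
    using generate_edge_gens_subset finite_edge_gens edge_gens_subset by (auto simp: finite_generating_set_def)
  show "bb_subgroup \<subseteq> carrier G" using cls_closed by (auto simp: bb_subgroup_def)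
  then show "word_length G edge_gens h \<le> C * word_length G gens h ^ k" if h: "h \<in> bb_subgroup" for h
  proof -
    obtain v where v: "v \<in> words V" "\<forall>i. height (label_class i) v = 0" "h = cls v"
      using h by (auto simp: bb_subgroup_def)
    obtain w where w: "w \<in> words V" "length w \<le> word_length G gens h" "cls w = h"
      using geodesic_word[OF cls_closed[OF v(1)]] v(3) by blast
    have "\<forall>i. height (label_class i) w = 0" using height_cls_eq[of w v] v w by simp
    from word_length_le[OF edge_gens_subset upper[OF w(1) this]]
    have "word_length G edge_gens h \<le> C * length w ^ k" using w(3) by simp
    also have "\<dots> \<le> C * word_length G gens h ^ k" using w(2) by (intro mult_le_mono2 power_mono) auto
    finally show ?thesis .
  qed
qed

lemma bb_subgroup_linear:
  assumes "\<And>w. w \<in> words V \<Longrightarrow> \<forall>i. height (label_class i) w = 0 \<Longrightarrow> spelled G edge_gens (C * length w) (cls w)"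
  shows "linear_distortion G bb_subgroup"
proof (rule bb_subgroup_distortion[where C = C and K = 1])
  show "\<exists>h\<in>bb_subgroup. word_length G gens h \<le> 1 * n \<and> n ^ 1 \<le> 1 * word_length G edge_gens h + 1 * n" for n
  proof (rule bexI)
    show "word_length G gens (cls []) \<le> 1 * n \<and> n ^ 1 \<le> 1 * word_length G edge_gens (cls []) + 1 * n"
      using word_length_gens_le[of "[]"] by simp
    show "cls [] \<in> bb_subgroup" unfolding bb_subgroup_def by (rule imageI) simp
  qed
qed (use assms in simp_all)

text \<open>By periodicity the two halves spell the same labels with opposite exponents.\<close>

lemma height_commutator_word:
  assumes per: "\<And>j. \<gamma> (j + N) = \<gamma> j"
  shows "height A (commutator_word \<gamma> N) = 0"
proof -
  have "[0..<2 * N] = [0..<N] @ map (\<lambda>j. j + N) [0..<N]"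
    by (simp only: map_add_upt mult_2 upt_add_eq_append[of 0 N N, simplified])
  then have "commutator_word \<gamma> N = map (\<lambda>j. (\<gamma> j, True)) [0..<N] @ map (\<lambda>j. (\<gamma> j, False)) [0..<N]"
    by (simp add: commutator_word_def per)
  moreover have "height A (map (\<lambda>j. (\<gamma> j, False)) xs) = - height A (map (\<lambda>j. (\<gamma> j, True)) xs)" for xs
    by (induction xs) (auto simp: letter_height_def)
  ultimately show ?thesis by simp
qed

text \<open>A shortest spelling by edge generators becomes a low word \<open>W\<close> of at most
  twice its length. Since \<open>W\<close> represents the same element as the commutator word,
  \<open>W\<close> preceded by the inverse of that word is trivial and has a pairing.\<close>

lemma commutator_word_length_ge:
  assumes \<gamma>: "\<And>j. \<gamma> j \<in> label_union I" "\<And>j. \<gamma> j \<noteq> \<gamma> (Suc j)" "\<And>j. (\<gamma> j, \<gamma> (Suc j)) \<notin> E"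
    and cover: "\<And>j v. v \<in> label_union I \<Longrightarrow> \<exists>i<k. \<gamma> (j + i) = v"
    and gen: "cls (commutator_word \<gamma> (k * n)) \<in> generate G edge_gens"
  shows "n ^ 2 \<le> 4 * word_length G edge_gens (cls (commutator_word \<gamma> (k * n))) + 3 * n"
proof (cases "n = 0")
  case False
  let ?C = "commutator_word \<gamma> (k * n)" and ?l = "word_length G edge_gens (cls (commutator_word \<gamma> (k * n)))"
  have CV: "?C \<in> words V" using \<gamma>(1) by (auto simp: commutator_word_def label_union_def)
  obtain W where W: "W \<in> words V" "cls W = cls ?C" "length W \<le> 2 * ?l"
    "\<And>a. height (label_union I) (take a W) \<le> 1"
    using spelled_edge_gens_word[OF spelled_word_length[OF edge_gens_subset gen]] by blast
  have "cls (inv_word ?C @ W) = \<one>\<^bsub>G\<^esub>"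
    using CV W cls_closed[OF CV] by (simp add: cls_append inv_word_in_words cls_inv_word)
  moreover have "inv_word ?C @ W \<in> words V" using inv_word_in_words[OF CV] W(1) by simp
  ultimately obtain f where "pairing E (inv_word ?C @ W) f"
    using trivial_word_pairing by blast
  from commutator_word_lower_bound[where \<gamma> = \<gamma> and k = k and c = 1, OF sym_E irrefl_E \<gamma> cover this W(4) HOL.refl]
  have "int (n * (n - 1)) \<le> 2 * int (length W) + 2 * int n" using False by simp
  then have "n * (n - 1) \<le> 2 * length W + 2 * n" by linarith
  moreover have "n ^ 2 = n * (n - 1) + n" using False by (cases n) (auto simp: power2_eq_square)
  ultimately show ?thesis using W(3) by linarith
qed simp

end

section \<open>Quadratic distortion, and linear distortion in the special case\<close>

context dominated_raag
begin

lemma relabel_u_trivial: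
  "w \<in> words V \<Longrightarrow> \<forall>i. height (label_class i) w = 0 \<Longrightarrow> cls (relabel (\<lambda>v. u (lab v)) w) = \<one>\<^bsub>G\<^esub>"
  using zero_height_trivial[of u w] u_in u_dom by simp

lemma bb_subgroup_quadratic:
  assumes \<gamma>: "\<And>j. \<gamma> j \<in> label_union I" "\<And>j. \<gamma> j \<noteq> \<gamma> (Suc j)" "\<And>j. (\<gamma> j, \<gamma> (Suc j)) \<notin> E"
    and period: "\<And>j. \<gamma> (j + k) = \<gamma> j"
    and cover: "\<And>j v. v \<in> label_union I \<Longrightarrow> \<exists>i<k. \<gamma> (j + i) = v"
  shows "quadratic_distortion G bb_subgroup"
proof -
  obtain D where D: "\<And>v m. v \<in> V \<Longrightarrow> spelled G edge_gens (D * nat \<bar>m :: int\<bar>) (ugen v [^]\<^bsub>G\<^esub> m \<otimes>\<^bsub>G\<^esub> inv\<^bsub>G\<^esub> (raag_gen \<Gamma> v [^]\<^bsub>G\<^esub> m))"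
    using spelled_path_uniform by blast
  \<comment> \<open>The constant 3 comes from \<open>2 * length w + 1 \<le> 3 * length w\<close> for
    nonempty \<open>w\<close>.\<close>
  have upper: "spelled G edge_gens (3 * D * length w ^ 2) (cls w)"
    if w: "w \<in> words V" "\<forall>i. height (label_class i) w = 0" for w
  proof -
    have "spelled G edge_gens (length w * (D * (2 * length w + 1))) (cls w)"
      using spelled_dominated[OF D w(1) order_refl] relabel_u_trivial[OF w] cls_closed[OF w(1)] by simp
    moreover have "length w * (D * (2 * length w + 1)) \<le> 3 * D * length w ^ 2"
    proof (cases "length w")
      case (Suc l)
      have "length w * (D * (2 * length w + 1)) \<le> length w * (D * (3 * length w))"
        using Suc by (intro mult_le_mono2) simp
      then show ?thesis by (simp add: power2_eq_square mult_ac)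
    qed simp
    ultimately show ?thesis by (rule spelled_mono[OF edge_gens_subset])
  qed
  show ?thesis
  proof (rule bb_subgroup_distortion[OF _ upper])
    fix n
    let ?C = "commutator_word \<gamma> (k * n)"
    have CV: "?C \<in> words V" using \<gamma>(1) by (auto simp: commutator_word_def label_union_def)
    have per: "\<gamma> (j + k * n) = \<gamma> j" for j
    proof (induction n)
      case (Suc n)
      then show ?case using period[of "j + k * n"] by (simp add: add_ac)
    qed simp
    then have h0: "\<forall>i. height (label_class i) ?C = 0" using height_commutator_word by blast
    then have "cls ?C \<in> bb_subgroup" using CV by (auto simp: bb_subgroup_def)
    \<comment> \<open>\<open>4 + 2 * k\<close> is one constant for both requirements: the word has
      length \<open>2 * k * n\<close>, and the lower bound holds with the constants 4 and 3.\<close>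
    moreover have "word_length G gens (cls ?C) \<le> (4 + 2 * k) * n"
    proof -
      have "length ?C = 2 * k * n" by (simp add: commutator_word_def)
      then show ?thesis using word_length_gens_le[OF CV] by (simp add: add_mult_distrib)
    qed
    moreover have "n ^ 2 \<le> (4 + 2 * k) * word_length G edge_gens (cls ?C) + (4 + 2 * k) * n"
      using commutator_word_length_ge[OF \<gamma> cover spelled_generate[OF edge_gens_subset upper[OF CV h0]]]
      by (simp add: add_mult_distrib)
    ultimately show "\<exists>h\<in>bb_subgroup. word_length G gens h \<le> (4 + 2 * k) * n \<and>
      n ^ 2 \<le> (4 + 2 * k) * word_length G edge_gens h + (4 + 2 * k) * n" by blast
  qed simp
qed

text \<open>Now \<open>u i\<close> is adjacent to all other vertices, so the replacement of a whole
  word by dominating vertices meets the commutation conditions of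
  \<open>spelled_relabel\<close>.\<close>

lemma bb_subgroup_special_linear:
  assumes special: "\<And>i v. i \<in> lab ` V \<Longrightarrow> v \<in> V \<Longrightarrow> v \<noteq> u i \<Longrightarrow> (u i, v) \<in> E"
  shows "linear_distortion G bb_subgroup"
proof (rule bb_subgroup_linear[where C = 1])
  fix w assume w: "w \<in> words V" "\<forall>i. height (label_class i) w = 0"
  have inV: "s \<in> V" if "s \<in> fst ` set w" for s using that w(1) by auto
  have "spelled G edge_gens (length w) (cls w \<otimes>\<^bsub>G\<^esub> inv\<^bsub>G\<^esub> cls (relabel (\<lambda>v. u (lab v)) w))"
  proof (rule spelled_relabel[OF w(1)])
    fix s assume s: "s \<in> fst ` set w"
    show "u (lab s) \<in> V \<and> (u (lab s) = s \<or> (s, u (lab s)) \<in> E \<and> lab (u (lab s)) = lab s)"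
      using u_lab[OF inV[OF s]] special[of "lab s" s] inV[OF s] sym_E by (auto dest: symD)
    fix t assume t: "t \<in> fst ` set w"
    show "(u (lab s), t) \<in> E \<or> u (lab s) = t" using special[of "lab s" t] inV s t by auto
    show "(u (lab s), u (lab t)) \<in> E \<or> u (lab s) = u (lab t)"
      using special[of "lab s" "u (lab t)"] inV s t u_lab(1) by auto
  qed
  then show "spelled G edge_gens (1 * length w) (cls w)"
    using relabel_u_trivial[OF w] cls_closed[OF w(1)] by simp
qed

end

section \<open>Linear distortion when all classes are joins and commute\<close>

context labelled_raag
begin

text \<open>The letters satisfying \<open>P\<close> commute with those that do not, so they can be
  moved to the front in their original order.\<close>

lemma cls_partition:
  assumes "w \<in> words V"
    and "\<And>s t. s \<in> fst ` set w \<Longrightarrow> t \<in> fst ` set w \<Longrightarrow> \<not> P s \<Longrightarrow> P t \<Longrightarrow> (s, t) \<in> E"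
  shows "cls w = cls (filter (\<lambda>x. P (fst x)) w) \<otimes>\<^bsub>G\<^esub> cls (filter (\<lambda>x. \<not> P (fst x)) w)"
  using assms
proof (induction w rule: list.induct)
  case Nil
  then show ?case by (simp add: cls_Nil)
next
  case (Cons a w)
  obtain s b where a: "a = (s, b)" by force
  have sV: "s \<in> V" and wV: "w \<in> words V" using Cons.prems(1) a by auto
  let ?p = "filter (\<lambda>x. P (fst x)) w" and ?q = "filter (\<lambda>x. \<not> P (fst x)) w"
  have V: "?p \<in> words V" "?q \<in> words V" using wV by auto
  note C = cls_closed[OF V(1)] cls_closed[OF V(2)]
  have C': "cls [(s, b)] \<in> carrier G" using sV by (intro cls_closed) auto
  have IH: "cls w = cls ?p \<otimes>\<^bsub>G\<^esub> cls ?q" by (rule Cons.IH[OF wV]) (use Cons.prems(2) in auto)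
  show ?case
  proof (cases "P s")
    case True
    then show ?thesis
      using a cls_Cons[OF sV wV, of b] cls_Cons[OF sV V(1), of b] IH C C' by (simp add: m_assoc)
  next
    case False
    have "cls [(s, b)] \<otimes>\<^bsub>G\<^esub> cls ?p = cls ?p \<otimes>\<^bsub>G\<^esub> cls [(s, b)]"
    proof (rule commute_cls[OF C' V(1)])
      fix t assume "t \<in> fst ` set ?p"
      then have "(s, t) \<in> E" using Cons.prems(2)[of s t] False a by auto
      then show "cls [(s, b)] \<otimes>\<^bsub>G\<^esub> raag_gen \<Gamma> t = raag_gen \<Gamma> t \<otimes>\<^bsub>G\<^esub> cls [(s, b)]"
        using E_V by (intro commute_letter) auto
    qed
    then have "cls [(s, b)] \<otimes>\<^bsub>G\<^esub> (cls ?p \<otimes>\<^bsub>G\<^esub> cls ?q) = cls ?p \<otimes>\<^bsub>G\<^esub> (cls [(s, b)] \<otimes>\<^bsub>G\<^esub> cls ?q)"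
      using C C' by (simp add: m_assoc[symmetric])
    then show ?thesis using False a cls_Cons[OF sV wV, of b] cls_Cons[OF sV V(2), of b] IH by simp
  qed
qed

lemma height_partition: "height A w = height A (filter P w @ filter (\<lambda>x. \<not> P x) w)"
  by (induction w) auto

lemma relabel_inv_word: "relabel \<phi> (inv_word w) = inv_word (relabel \<phi> w)"
  by (induction w) (auto simp: relabel_def inv_word_def)

text \<open>A word splits as \<open>x y\<close> with \<open>x\<close> over the \<open>K i\<close>
  and \<open>y\<close> over the \<open>L i\<close>. A letter of \<open>K i\<close> need not be
  adjacent to \<open>k i\<close>, so \<open>x\<close> is sent to \<open>k\<close> by way of
  \<open>l\<close>, and \<open>y\<close> directly. Each replacement costs at most one generator per
  letter, in total at most \<open>2 * length x + length y\<close>.\<close>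

lemma bb_subgroup_join_linear:
  fixes K L :: "nat \<Rightarrow> 'v set"
  assumes part: "\<And>i. i \<in> lab ` V \<Longrightarrow> label_class i = K i \<union> L i"
    and ne: "\<And>i. i \<in> lab ` V \<Longrightarrow> K i \<noteq> {} \<and> L i \<noteq> {}"
    and join: "\<And>i s t. i \<in> lab ` V \<Longrightarrow> s \<in> K i \<Longrightarrow> t \<in> L i \<Longrightarrow> (s, t) \<in> E"
    and comm: "\<And>s t. s \<in> V \<Longrightarrow> t \<in> V \<Longrightarrow> lab s \<noteq> lab t \<Longrightarrow> (s, t) \<in> E"
  shows "linear_distortion G bb_subgroup"
proof -
  define k where "k i = (SOME s. s \<in> K i)" for i
  define l where "l i = (SOME s. s \<in> L i)" for i
  have k: "k i \<in> K i" and l: "l i \<in> L i" if "i \<in> lab ` V" for i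
    using ne[OF that] by (auto simp: k_def l_def some_in_eq)
  have KL: "s \<in> V" "lab s = i" if "i \<in> lab ` V" "s \<in> K i \<union> L i" for s i
    using that part[of i] by (auto simp: label_class_def)
  have adj: "(s, t) \<in> E" if "s \<in> K (lab s)" "t \<in> L (lab t)" "s \<in> V" "t \<in> V" for s t
    using that join[of "lab s" s t] comm[of s t] by (cases "lab s = lab t") auto
  have adj': "(t, s) \<in> E" if "s \<in> K (lab s)" "t \<in> L (lab t)" "s \<in> V" "t \<in> V" for s t
    using adj[OF that] sym_E by (auto dest: symD)
  have kV: "k i \<in> V" "lab (k i) = i" and lV: "l i \<in> V" "lab (l i) = i" if "i \<in> lab ` V" for i
    using KL[OF that, of "k i"] KL[OF that, of "l i"] k[OF that] l[OF that] by auto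
  have to_l: "spelled G edge_gens (length w) (cls w \<otimes>\<^bsub>G\<^esub> inv\<^bsub>G\<^esub> cls (relabel (\<lambda>s. l (lab s)) w))"
    if w: "w \<in> words V" "\<And>s. s \<in> fst ` set w \<Longrightarrow> s \<in> K (lab s)" for w
  proof (rule spelled_relabel[OF w(1)])
    have inV: "s \<in> V" if "s \<in> fst ` set w" for s using that w(1) by auto
    fix s assume s: "s \<in> fst ` set w"
    show "l (lab s) \<in> V \<and> (l (lab s) = s \<or> (s, l (lab s)) \<in> E \<and> lab (l (lab s)) = lab s)"
      using lV[of "lab s"] l[of "lab s"] adj[of s "l (lab s)"] w(2)[OF s] inV[OF s] by auto
    fix t assume t: "t \<in> fst ` set w"
    show "(l (lab s), t) \<in> E \<or> l (lab s) = t"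
      using lV[of "lab s"] l[of "lab s"] adj'[of t "l (lab s)"] w(2)[OF t] inV[OF t] inV[OF s] by auto
    show "(l (lab s), l (lab t)) \<in> E \<or> l (lab s) = l (lab t)"
      using lV[of "lab s"] lV[of "lab t"] inV[OF t] inV[OF s] comm[of "l (lab s)" "l (lab t)"]
      by (cases "lab s = lab t") auto
  qed
  have to_k: "spelled G edge_gens (length w) (cls w \<otimes>\<^bsub>G\<^esub> inv\<^bsub>G\<^esub> cls (relabel (\<lambda>s. k (lab s)) w))"
    if w: "w \<in> words V" "\<And>s. s \<in> fst ` set w \<Longrightarrow> s \<in> L (lab s)" for w
  proof (rule spelled_relabel[OF w(1)])
    have inV: "s \<in> V" if "s \<in> fst ` set w" for s using that w(1) by auto
    fix s assume s: "s \<in> fst ` set w"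
    show "k (lab s) \<in> V \<and> (k (lab s) = s \<or> (s, k (lab s)) \<in> E \<and> lab (k (lab s)) = lab s)"
      using kV[of "lab s"] k[of "lab s"] adj'[of "k (lab s)" s] w(2)[OF s] inV[OF s] by auto
    fix t assume t: "t \<in> fst ` set w"
    show "(k (lab s), t) \<in> E \<or> k (lab s) = t"
      using kV[of "lab s"] k[of "lab s"] adj[of "k (lab s)" t] w(2)[OF t] inV[OF t] inV[OF s] by auto
    show "(k (lab s), k (lab t)) \<in> E \<or> k (lab s) = k (lab t)"
      using kV[of "lab s"] kV[of "lab t"] inV[OF t] inV[OF s] comm[of "k (lab s)" "k (lab t)"]
      by (cases "lab s = lab t") auto
  qed
  show ?thesis
  proof (rule bb_subgroup_linear[where C = 2])
    fix w assume w: "w \<in> words V" "\<forall>i. height (label_class i) w = 0"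
    define P where "P s \<longleftrightarrow> s \<in> K (lab s)" for s
    define x where "x = filter (\<lambda>x. P (fst x)) w"
    define y where "y = filter (\<lambda>x. \<not> P (fst x)) w"
    have V: "x \<in> words V" "y \<in> words V" using w(1) by (auto simp: x_def y_def)
    have xK: "s \<in> K (lab s)" if "s \<in> fst ` set x" for s using that by (auto simp: x_def P_def)
    have L: "s \<in> L (lab s)" if "s \<in> V" "\<not> P s" for s
      using part[of "lab s"] that by (auto simp: P_def label_class_def)
    have yL: "s \<in> L (lab s)" if "s \<in> fst ` set y" for s
    proof -
      have "s \<in> V" "\<not> P s" using that w(1) by (auto simp: y_def)
      then show ?thesis by (rule L)
    qed
    have split: "cls w = cls x \<otimes>\<^bsub>G\<^esub> cls y"
      unfolding x_def y_def
    proof (rule cls_partition[OF w(1)])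
      fix s t assume st: "s \<in> fst ` set w" "t \<in> fst ` set w" "\<not> P s" "P t"
      then have "s \<in> V" "t \<in> V" using w(1) by auto
      then show "(s, t) \<in> E" using adj'[of t s] L[of s] st by (simp add: P_def)
    qed
    have len: "length x + length y = length w"
      unfolding x_def y_def by (rule sum_length_filter_compl)
    let ?k = "relabel (\<lambda>s. k (lab s))" and ?l = "relabel (\<lambda>s. l (lab s))"
    have fstV: "s \<in> V" if "v \<in> words V" "s \<in> fst ` set v" for s v using that by auto
    have rV: "?k v \<in> words V" "?l v \<in> words V" if v: "v \<in> words V" for v
    proof -
      have "k (lab s) \<in> V" "l (lab s) \<in> V" if "s \<in> fst ` set v" for s
        using kV(1)[of "lab s"] lV(1)[of "lab s"] fstV[OF v that] by auto
      then show "?k v \<in> words V" "?l v \<in> words V" by (auto intro!: relabel_in_words)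
    qed
    have kl: "?k (?l x) = ?k x"
      using V(1) lV(2) by (fastforce simp: relabel_def)
    note C = cls_closed[OF V(1)] cls_closed[OF V(2)] cls_closed[OF rV(1)[OF V(1)]] cls_closed[OF rV(2)[OF V(1)]]
      cls_closed[OF rV(1)[OF V(2)]]
    have 1: "spelled G edge_gens (length x) (cls x \<otimes>\<^bsub>G\<^esub> inv\<^bsub>G\<^esub> cls (?l x))" by (rule to_l[OF V(1) xK])
    have 2: "spelled G edge_gens (length x) (cls (?l x) \<otimes>\<^bsub>G\<^esub> inv\<^bsub>G\<^esub> cls (?k x))"
    proof -
      have "s \<in> L (lab s)" if "s \<in> fst ` set (?l x)" for s
      proof -
        obtain r where r: "r \<in> fst ` set x" "s = l (lab r)" using \<open>s \<in> fst ` set (?l x)\<close> unfolding set_relabel by blast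
        then show ?thesis using l[of "lab r"] lV(2)[of "lab r"] fstV[OF V(1)] by auto
      qed
      from to_k[OF rV(2)[OF V(1)] this] show ?thesis unfolding kl by (simp add: relabel_def)
    qed
    \<comment> \<open>For \<open>y\<close> the quotient is needed on the left of the word, hence
      \<open>to_k\<close> is applied to the inverse word and the result is inverted.\<close>
    have 3: "spelled G edge_gens (length y) (inv\<^bsub>G\<^esub> cls (?k y) \<otimes>\<^bsub>G\<^esub> cls y)"
    proof -
      have set_inv: "fst ` set (inv_word y) = fst ` set y" by (force simp: inv_word_def)
      have "spelled G edge_gens (length (inv_word y)) (cls (inv_word y) \<otimes>\<^bsub>G\<^esub> inv\<^bsub>G\<^esub> cls (?k (inv_word y)))"
        by (rule to_k[OF inv_word_in_words[OF V(2)]]) (use yL set_inv in simp)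
      then have "spelled G edge_gens (length y) (inv\<^bsub>G\<^esub> cls y \<otimes>\<^bsub>G\<^esub> cls (?k y))"
        using V(2) rV(1) C by (simp add: relabel_inv_word cls_inv_word) (simp add: inv_word_def)
      from spelled_inv[OF edge_gens_subset this] show ?thesis using C by (simp add: inv_mult_group)
    qed
    \<comment> \<open>The relabelled halves are inverse to each other, which lets the three factors
      below multiply to \<open>cls x\<close> times \<open>cls y\<close>.\<close>
    have "cls (?k (x @ y)) = \<one>\<^bsub>G\<^esub>"
    proof (rule zero_height_trivial)
      fix i j assume "i \<in> lab ` V" "j \<in> lab ` V" "i \<noteq> j"
      then show "(k i, k j) \<in> E" using comm[of "k i" "k j"] kV[of i] kV[of j] by simp
    next
      show "\<forall>i. height (label_class i) (x @ y) = 0"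
        using w(2) height_partition[of _ w "\<lambda>x. P (fst x)"] unfolding x_def y_def by metis
    qed (use kV V in auto)
    then have "cls (?k x) \<otimes>\<^bsub>G\<^esub> cls (?k y) = \<one>\<^bsub>G\<^esub>"
      using cls_append[OF rV(1)[OF V(1)] rV(1)[OF V(2)]] by simp
    then have inv: "inv\<^bsub>G\<^esub> cls (?k y) = cls (?k x)" using C by (simp add: inv_equality)
    have "cls w = (cls x \<otimes>\<^bsub>G\<^esub> inv\<^bsub>G\<^esub> cls (?l x)) \<otimes>\<^bsub>G\<^esub> ((cls (?l x) \<otimes>\<^bsub>G\<^esub> inv\<^bsub>G\<^esub> cls (?k x)) \<otimes>\<^bsub>G\<^esub> (inv\<^bsub>G\<^esub> cls (?k y) \<otimes>\<^bsub>G\<^esub> cls y))"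
    proof -
      have c: "inv\<^bsub>G\<^esub> p \<otimes>\<^bsub>G\<^esub> (p \<otimes>\<^bsub>G\<^esub> q) = q" if "p \<in> carrier G" "q \<in> carrier G" for p q
        using that by (simp add: m_assoc[symmetric])
      show ?thesis unfolding inv split using C by (simp add: m_assoc c)
    qed
    then have "spelled G edge_gens (length x + (length x + length y)) (cls w)"
      using spelled_mult[OF edge_gens_subset 1 spelled_mult[OF edge_gens_subset 2 3]] by simp
    then show "spelled G edge_gens (2 * length w) (cls w)"
      by (rule spelled_mono[OF edge_gens_subset]) (use len in simp)
  qed
qed

end

section \<open>Walks in the complement graph\<close>

lemma rtrancl_walk:
  assumes "(a, b) \<in> N\<^sup>*" "N \<subseteq> A \<times> A" "a \<in> A"
  shows "\<exists>q. q \<noteq> [] \<and> successively (\<lambda>x y. (x, y) \<in> N) q \<and> hd q = a \<and> last q = b \<and> set q \<subseteq> A"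
  using assms(1)
proof (induction rule: rtrancl_induct)
  case base
  then show ?case using assms(3) by (intro exI[of _ "[a]"]) simp
next
  case (step b c)
  then obtain q where "q \<noteq> []" "successively (\<lambda>x y. (x, y) \<in> N) q" "hd q = a" "last q = b" "set q \<subseteq> A" by blast
  then show ?case using step(2) assms(2)
    by (intro exI[of _ "q @ [c]"]) (auto simp: successively_append_iff)
qed

lemma walk_concat:
  assumes "p \<noteq> []" "successively P p" "q \<noteq> []" "successively P q" "last p = hd q"
  shows "successively P (p @ tl q) \<and> hd (p @ tl q) = hd p \<and> last (p @ tl q) = last q \<and>
    set (p @ tl q) = set p \<union> set q"
proof -
  obtain x xs where q: "q = x # xs" using assms(3) by (cases q) auto
  have "x \<in> set p" using assms(1,5) q by (metis last_in_set list.sel(1))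
  then show ?thesis using assms q by (auto simp: successively_append_iff successively_Cons last_append)
qed

text \<open>For each further vertex \<open>b\<close> a detour from \<open>a\<close> to
  \<open>b\<close> and back is appended.\<close>

lemma covering_closed_walk:
  assumes conn: "\<And>x y. x \<in> A \<Longrightarrow> y \<in> A \<Longrightarrow> (x, y) \<in> N\<^sup>*" and N: "N \<subseteq> A \<times> A" and a: "a \<in> A"
  shows "finite F \<Longrightarrow> F \<subseteq> A \<Longrightarrow>
    \<exists>p. p \<noteq> [] \<and> successively (\<lambda>x y. (x, y) \<in> N) p \<and> hd p = a \<and> last p = a \<and> F \<subseteq> set p \<and> set p \<subseteq> A"
proof (induction F rule: finite_induct)
  case empty
  show ?case using a by (intro exI[of _ "[a]"]) simp
next
  case (insert b F)
  then obtain p where p: "p \<noteq> []" "successively (\<lambda>x y. (x, y) \<in> N) p" "hd p = a" "last p = a"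
    "F \<subseteq> set p" "set p \<subseteq> A" by blast
  have b: "b \<in> A" using insert.prems by simp
  obtain q where q: "q \<noteq> []" "successively (\<lambda>x y. (x, y) \<in> N) q" "hd q = a" "last q = b" "set q \<subseteq> A"
    using rtrancl_walk[OF conn[OF a b] N a] by blast
  obtain r where r: "r \<noteq> []" "successively (\<lambda>x y. (x, y) \<in> N) r" "hd r = b" "last r = a" "set r \<subseteq> A"
    using rtrancl_walk[OF conn[OF b a] N b] by blast
  have pq: "successively (\<lambda>x y. (x, y) \<in> N) (p @ tl q)" "hd (p @ tl q) = a" "last (p @ tl q) = b"
    "set (p @ tl q) = set p \<union> set q" "p @ tl q \<noteq> []"
    using walk_concat[OF p(1,2) q(1,2)] p q by auto
  have "b \<in> set q" using q(1,4) last_in_set by blast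
  then show ?case
    using walk_concat[OF pq(5,1) r(1,2)] pq r p q
    by (intro exI[of _ "(p @ tl q) @ tl r"]) auto
qed

lemma periodic_covering_walk:
  assumes conn: "\<And>x y. x \<in> A \<Longrightarrow> y \<in> A \<Longrightarrow> (x, y) \<in> N\<^sup>*" and N: "N \<subseteq> A \<times> A"
    and A: "finite A" "card A \<ge> 2"
  shows "\<exists>\<gamma> k. (\<forall>j. \<gamma> j \<in> A) \<and> (\<forall>j. (\<gamma> j, \<gamma> (Suc j)) \<in> N) \<and> (\<forall>j. \<gamma> (j + k) = \<gamma> j) \<and>
    (\<forall>v\<in>A. \<forall>j. \<exists>i<k. \<gamma> (j + i) = v)"
proof -
  obtain a where a: "a \<in> A" using A by fastforce
  obtain p where p: "p \<noteq> []" "successively (\<lambda>x y. (x, y) \<in> N) p" "hd p = a" "last p = a" "set p = A"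
    using covering_closed_walk[OF conn N a A(1) subset_refl] by blast
  \<comment> \<open>The last vertex of \<open>p\<close> repeats the first and is left out of the
    period. With at least two vertices to visit, \<open>k\<close> is positive.\<close>
  define k where "k = length p - 1"
  have "card A \<le> length p" using p(5) card_length by blast
  then have k: "k > 0" "length p = Suc k" using A(2) by (auto simp: k_def)
  have pk: "p ! k = p ! 0" using p(1,3,4) by (simp add: k_def hd_conv_nth last_conv_nth)
  have step: "(p ! i, p ! Suc i) \<in> N" if "i < k" for i
    using p(2) that k(2) unfolding successively_conv_nth by simp
  define \<gamma> where "\<gamma> j = p ! (j mod k)" for j
  have "\<gamma> j \<in> A" for j
    using nth_mem[of "j mod k" p] k p(5) less_SucI[OF mod_less_divisor[OF k(1)]] by (simp add: \<gamma>_def)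
  moreover have "(\<gamma> j, \<gamma> (Suc j)) \<in> N" for j
  proof -
    have "j mod k < k" using k by simp
    moreover have "p ! Suc (j mod k) = p ! (Suc j mod k)"
      using pk by (simp add: mod_Suc)
    ultimately show ?thesis using step[of "j mod k"] by (simp add: \<gamma>_def)
  qed
  moreover have "\<gamma> (j + k) = \<gamma> j" for j by (simp add: \<gamma>_def)
  moreover have "\<exists>i<k. \<gamma> (j + i) = v" if v: "v \<in> A" for v j
  proof -
    obtain t\<^sub>0 where t\<^sub>0: "t\<^sub>0 < length p" "p ! t\<^sub>0 = v" using v unfolding p(5)[symmetric] in_set_conv_nth by blast
    define t where "t = (if t\<^sub>0 = k then 0 else t\<^sub>0)"
    have t: "t < k" "p ! t = v" using t\<^sub>0 pk k by (auto simp: t_def)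
    \<comment> \<open>The offset modulo \<open>k\<close> from \<open>j\<close> forward to the
      position \<open>t\<close> of \<open>v\<close>.\<close>
    define i where "i = (t + (k - j mod k)) mod k"
    have "j mod k < k" using k by simp
    have "(j + i) mod k = (j mod k + (t + (k - j mod k))) mod k"
      unfolding i_def by (simp only: mod_add_left_eq mod_add_right_eq)
    also have "j mod k + (t + (k - j mod k)) = t + k" using \<open>j mod k < k\<close> by simp
    also have "(t + k) mod k = t" using t by simp
    finally have "\<gamma> (j + i) = v" using t by (simp add: \<gamma>_def)
    moreover have "i < k" using k by (simp add: i_def)
    ultimately show ?thesis by blast
  qed
  ultimately show ?thesis by blast
qed

text \<open>If the component \<open>C\<close> of \<open>x\<close> in the complement graph misses
  \<open>y\<close>, every vertex of \<open>C\<close> is adjacent to every vertex of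
  \<open>A - C\<close>. The induced graph is then the join of the graphs induced on these two
  nonempty sets.\<close>

lemma complement_connected:
  fixes \<Gamma> :: "'v pair_pre_digraph"
  assumes "pair_graph \<Gamma>" and A: "A \<subseteq> pverts \<Gamma>" and no_join: "\<not> is_join (with_proj \<Gamma> \<restriction> A)"
    and x: "x \<in> A" and y: "y \<in> A"
  shows "(x, y) \<in> {(a, b). a \<in> A \<and> b \<in> A \<and> a \<noteq> b \<and> (a, b) \<notin> parcs \<Gamma>}\<^sup>*"
proof (rule ccontr)
  interpret raag_graph \<Gamma> by (rule raag_graph.intro[OF assms(1)])
  let ?N = "{(a, b). a \<in> A \<and> b \<in> A \<and> a \<noteq> b \<and> (a, b) \<notin> E}"
  assume y': "(x, y) \<notin> ?N\<^sup>*"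
  define C where "C = {z \<in> A. (x, z) \<in> ?N\<^sup>*}"
  have cross: "(a, b) \<in> E" "(b, a) \<in> E" if "a \<in> C" "b \<in> A - C" for a b
  proof -
    show "(a, b) \<in> E"
    proof (rule ccontr)
      assume "(a, b) \<notin> E"
      then have "(a, b) \<in> ?N" using that by (auto simp: C_def)
      then show False using that by (auto simp: C_def intro: rtrancl_into_rtrancl)
    qed
    then show "(b, a) \<in> E" using sym_E by (auto dest: symD)
  qed
  define G1 where "G1 = \<lparr>pverts = C, parcs = E \<inter> C \<times> C\<rparr>"
  define G2 where "G2 = \<lparr>pverts = A - C, parcs = E \<inter> (A - C) \<times> (A - C)\<rparr>"
  have "is_join (with_proj \<Gamma> \<restriction> A)"
    unfolding is_join_def
  proof (rule exI[of _ G1], rule exI[of _ G2], intro conjI)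
    have wf: "wf_digraph (with_proj \<Gamma> \<restriction> A)" by unfold_locales (auto simp: induce_subgraph_def)
    have wf1: "wf_digraph (with_proj G1)" by unfold_locales (auto simp: G1_def)
    have wf2: "wf_digraph (with_proj G2)" by unfold_locales (auto simp: G2_def)
    show "subgraph (with_proj G1) (with_proj \<Gamma> \<restriction> A)"
      unfolding subgraph_def compatible_def using wf wf1 by (auto simp: induce_subgraph_def G1_def C_def)
    show "subgraph (with_proj G2) (with_proj \<Gamma> \<restriction> A)"
      unfolding subgraph_def compatible_def using wf wf2 by (auto simp: induce_subgraph_def G2_def)
    show "pverts G1 \<noteq> {}" using x by (auto simp: G1_def C_def)
    show "pverts G2 \<noteq> {}" using y y' by (auto simp: G2_def C_def)
    show "pverts G1 \<inter> pverts G2 = {}" by (auto simp: G1_def G2_def)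
    have CA: "C \<subseteq> A" by (auto simp: C_def)
    have "{e \<in> E. fst e \<in> A \<and> snd e \<in> A} =
        E \<inter> C \<times> C \<union> E \<inter> (A - C) \<times> (A - C) \<union> C \<times> (A - C) \<union> (A - C) \<times> C"
      using cross CA by auto
    moreover have "C \<union> (A - C) = A" using CA by auto
    ultimately show "with_proj \<Gamma> \<restriction> A = with_proj (graph_join G1 G2)"
      by (simp add: induce_subgraph_def with_proj_def graph_join_def G1_def G2_def)
  qed
  then show False using no_join by simp
qed

section \<open>Generalized Bestvina--Brady subgroups\<close>

locale bestvina_brady_setup =
  fixes \<Gamma> :: "'v pair_pre_digraph" and d :: nat and lab :: "'v \<Rightarrow> nat"
    and \<Phi> :: "'v word set \<Rightarrow> nat \<Rightarrow> int"
  assumes pair_graph: "pair_graph \<Gamma>"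
    and labelling: "labelling_epi \<Gamma> d lab \<Phi>"
    and strong: "strong_bb \<Gamma> d \<Phi>"
begin

sublocale labelled_raag \<Gamma> lab
  by (intro labelled_raag.intro raag_graph.intro pair_graph)

lemma lab_range: "v \<in> V \<Longrightarrow> lab v \<in> {1..d}"
  and hom: "\<Phi> \<in> hom G (int_lattice d)"
  and \<Phi>_gen: "v \<in> V \<Longrightarrow> \<Phi> (raag_gen \<Gamma> v) = basis_vec d (lab v)"
  using labelling by (auto simp: labelling_epi_def epi_def)

lemma basis_vec_eq_iff: "i \<in> {1..d} \<Longrightarrow> basis_vec d j = basis_vec d i \<longleftrightarrow> j = i"
proof
  assume i: "i \<in> {1..d}" and "basis_vec d j = basis_vec d i"
  then have "basis_vec d j i = basis_vec d i i" by simp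
  then show "j = i" using i by (simp add: basis_vec_def split: if_splits)
qed simp

lemma verts_basis_subgraph: "i \<in> {1..d} \<Longrightarrow> verts (basis_subgraph \<Gamma> d \<Phi> i) = label_class i"
  using \<Phi>_gen basis_vec_eq_iff by (auto simp: basis_subgraph_def label_class_def)

lemma generated_subgraph_conv:
  "I \<subseteq> {1..d} \<Longrightarrow> generated_subgraph \<Gamma> d \<Phi> I = with_proj \<Gamma> \<restriction> label_union I"
proof -
  assume I: "I \<subseteq> {1..d}"
  then have "(\<Union>i\<in>I. verts (basis_subgraph \<Gamma> d \<Phi> i)) = (\<Union>i\<in>I. label_class i)"
    using verts_basis_subgraph by (intro SUP_cong) auto
  also have "\<dots> = label_union I" by (auto simp: label_class_def label_union_def)
  finally show ?thesis by (simp add: generated_subgraph_def)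
qed

lemma basis_subgraph_conv: "i \<in> {1..d} \<Longrightarrow> basis_subgraph \<Gamma> d \<Phi> i = with_proj \<Gamma> \<restriction> label_class i"
  using verts_basis_subgraph[of i] by (simp add: basis_subgraph_def)

lemma \<Phi>_mult:
  assumes "x \<in> carrier G" "y \<in> carrier G" "i \<in> {1..d}"
  shows "\<Phi> (x \<otimes>\<^bsub>G\<^esub> y) i = \<Phi> x i + \<Phi> y i"
  using hom_mult[OF hom assms(1,2)] assms(3) by (simp add: int_lattice_def)

lemma \<Phi>_one: "i \<in> {1..d} \<Longrightarrow> \<Phi> \<one>\<^bsub>G\<^esub> i = 0"
  using \<Phi>_mult[of "\<one>\<^bsub>G\<^esub>" "\<one>\<^bsub>G\<^esub>" i] by simp

lemma \<Phi>_cls: "w \<in> words V \<Longrightarrow> i \<in> {1..d} \<Longrightarrow> \<Phi> (cls w) i = height (label_class i) w"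
proof (induction w rule: list.induct)
  case Nil
  then show ?case using \<Phi>_one by (simp add: cls_Nil)
next
  case (Cons a w)
  obtain s b where a: "a = (s, b)" by force
  have sV: "s \<in> V" and wV: "w \<in> words V" using Cons.prems(1) a by auto
  have C: "cls [(s, c)] \<in> carrier G" for c using sV by (intro cls_closed) auto
  have T: "\<Phi> (cls [(s, True)]) i = letter_height (label_class i) (s, True)"
    using \<Phi>_gen[OF sV] Cons.prems(2) sV
    by (auto simp: raag_gen_conv basis_vec_def letter_height_def label_class_def)
  have "\<Phi> (cls [(s, True)]) i + \<Phi> (cls [(s, False)]) i = 0"
    using \<Phi>_mult[OF C C Cons.prems(2), of True False] cls_cancel[OF sV, of True] \<Phi>_one[OF Cons.prems(2)] by simp
  then have "\<Phi> (cls [(s, b)]) i = letter_height (label_class i) (s, b)"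
    using T by (cases b) (auto simp: letter_height_def)
  then show ?case
    using a cls_Cons[OF sV wV, of b] \<Phi>_mult[OF C cls_closed[OF wV] Cons.prems(2), of b] Cons.IH[OF wV Cons.prems(2)]
    by simp
qed

text \<open>The coordinate of \<Phi> at \<open>i\<close> is the exponent sum over the class of
  \<open>i\<close>. For \<open>i\<close> outside \<open>{1..d}\<close> this class is empty and the
  sum vanishes; conversely, an extensional function is determined by its values on
  \<open>{1..d}\<close>.\<close>

lemma bestvina_brady_conv: "bestvina_brady \<Gamma> d \<Phi> = bb_subgroup"
proof -
  have "\<Phi> (cls w) = \<one>\<^bsub>int_lattice d\<^esub> \<longleftrightarrow> (\<forall>i. height (label_class i) w = 0)" if w: "w \<in> words V" for w
  proof
    assume eq: "\<Phi> (cls w) = \<one>\<^bsub>int_lattice d\<^esub>"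
    show "\<forall>i. height (label_class i) w = 0"
    proof
      fix i
      show "height (label_class i) w = 0"
      proof (cases "i \<in> {1..d}")
        case True
        then show ?thesis using \<Phi>_cls[OF w True] eq by (simp add: int_lattice_def)
      next
        case False
        then have "label_class i = {}" using lab_range by (auto simp: label_class_def)
        moreover have "height {} v = 0" for v :: "'v word" by (induction v) (auto simp: letter_height_def)
        ultimately show ?thesis by simp
      qed
    qed
  next
    assume h: "\<forall>i. height (label_class i) w = 0"
    have "\<Phi> (cls w) \<in> carrier (int_lattice d)" using hom_in_carrier[OF hom cls_closed[OF w]] .
    then have "\<Phi> (cls w) \<in> extensional {1..d}" by (simp add: int_lattice_def PiE_def)
    then show "\<Phi> (cls w) = \<one>\<^bsub>int_lattice d\<^esub>"
      using \<Phi>_cls[OF w] h by (intro extensionalityI[of _ "{1..d}"]) (auto simp: int_lattice_def)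
  qed
  then show ?thesis unfolding bestvina_brady_def kernel_def bb_subgroup_def carrier_raag by blast
qed

text \<open>Each class contains its dominating vertex, so every label occurs.\<close>

lemma lab_image: "lab ` V = {1..d}"
proof
  show "lab ` V \<subseteq> {1..d}" using lab_range by blast
  show "{1..d} \<subseteq> lab ` V"
  proof
    fix i assume i: "i \<in> {1..d}"
    then have "\<exists>v. v \<in> verts (basis_subgraph \<Gamma> d \<Phi> i)"
      using strong by (auto simp: strong_bb_def strongly_dominating_def)
    then show "i \<in> lab ` V" using verts_basis_subgraph[OF i] by (auto simp: label_class_def)
  qed
qed

text \<open>Connectedness refers to the symmetric closure of the subgraph. As \<open>E\<close> is
  symmetric, a path in this closure is a path in the graph itself.\<close>

lemma basis_subgraph_path:
  assumes "v \<in> V" "w \<in> V" "lab v = lab w"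
  shows "(v, w) \<in> {(v, w). (v, w) \<in> E \<and> lab v = lab w}\<^sup>*"
proof -
  let ?i = "lab v"
  have i: "?i \<in> {1..d}" using lab_range assms(1) by blast
  let ?M = "mk_symmetric (basis_subgraph \<Gamma> d \<Phi> ?i)"
  have "Digraph_Component.connected (basis_subgraph \<Gamma> d \<Phi> ?i)" using strong i by (simp add: strong_bb_def)
  moreover have "v \<in> pverts ?M" "w \<in> pverts ?M"
    using verts_basis_subgraph[OF i] assms by (auto simp: mk_symmetric_def label_class_def)
  ultimately have "v \<rightarrow>\<^sup>*\<^bsub>with_proj ?M\<^esub> w"
    by (simp add: connected_def strongly_connected_def)
  then have "(v, w) \<in> (parcs ?M)\<^sup>*" using reachable_rtranclI by fastforce
  moreover have "parcs ?M \<subseteq> {(v, w). (v, w) \<in> E \<and> lab v = lab w}"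
    unfolding basis_subgraph_conv[OF i] using sym_E
    by (auto simp: mk_symmetric_def induce_subgraph_def label_class_def dest: symD)
  ultimately show ?thesis using rtrancl_mono by blast
qed

lemma dominated_raagI:
  assumes "\<And>i. i \<in> {1..d} \<Longrightarrow> u i \<in> label_class i"
    and "\<And>i v. i \<in> {1..d} \<Longrightarrow> v \<in> V \<Longrightarrow> lab v \<noteq> i \<Longrightarrow> (u i, v) \<in> E"
  shows "dominated_raag \<Gamma> lab u"
proof unfold_locales
  fix v assume "v \<in> V"
  then show "(u (lab v), v) \<in> {(v, w). (v, w) \<in> E \<and> lab v = lab w}\<^sup>*"
    using assms(1)[OF lab_range[OF \<open>v \<in> V\<close>]] by (intro basis_subgraph_path) (auto simp: label_class_def)
qed (use assms lab_image in \<open>auto simp: label_class_def\<close>)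

text \<open>Consecutive letters of the walk must be distinct and not adjacent. Such a walk exists
  because the complement graph on the class union is connected and has at least two
  vertices.\<close>

lemma quadratic:
  assumes I: "I \<subseteq> {1..d}" and card: "card (verts (generated_subgraph \<Gamma> d \<Phi> I)) \<ge> 2"
    and no_join: "\<not> is_join (generated_subgraph \<Gamma> d \<Phi> I)"
  shows "quadratic_distortion G bb_subgroup"
proof -
  have "\<exists>u. \<forall>i\<in>{1..d}. u i \<in> label_class i \<and> (\<forall>v\<in>V - label_class i. (u i, v) \<in> E)"
    using strong verts_basis_subgraph
    by (intro bchoice) (auto simp: strong_bb_def strongly_dominating_def)
  then obtain u where u: "\<And>i. i \<in> {1..d} \<Longrightarrow> u i \<in> label_class i"
    "\<And>i v. i \<in> {1..d} \<Longrightarrow> v \<in> V - label_class i \<Longrightarrow> (u i, v) \<in> E" by blast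
  interpret dominated_raag \<Gamma> lab u
    by (rule dominated_raagI) (use u in \<open>auto simp: label_class_def\<close>)
  let ?A = "label_union I" and ?N = "{(a, b). a \<in> label_union I \<and> b \<in> label_union I \<and> a \<noteq> b \<and> (a, b) \<notin> E}"
  have A: "?A \<subseteq> V" by (auto simp: label_union_def)
  have conn: "(x, y) \<in> ?N\<^sup>*" if "x \<in> ?A" "y \<in> ?A" for x y
    using complement_connected[OF pair_graph A _ that] no_join generated_subgraph_conv[OF I] by simp
  have "card ?A \<ge> 2" using card generated_subgraph_conv[OF I] by simp
  moreover have "?N \<subseteq> ?A \<times> ?A" by auto
  moreover have "finite ?A" using A finite_V finite_subset by blast
  ultimately obtain \<gamma> k where "\<forall>j. \<gamma> j \<in> ?A" "\<forall>j. (\<gamma> j, \<gamma> (Suc j)) \<in> ?N" "\<forall>j. \<gamma> (j + k) = \<gamma> j"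
    "\<forall>v\<in>?A. \<forall>j. \<exists>i<k. \<gamma> (j + i) = v"
    using periodic_covering_walk[of ?A ?N] conn by blast
  then show ?thesis by (intro bb_subgroup_quadratic[of \<gamma> I k]) auto
qed

lemma special_linear:
  assumes "special_bb \<Gamma> d \<Phi>"
  shows "linear_distortion G bb_subgroup"
proof -
  have "\<exists>u. \<forall>i\<in>{1..d}. u i \<in> label_class i \<and> (\<forall>v\<in>V - {u i}. (u i, v) \<in> E)"
    using assms verts_basis_subgraph
    by (intro bchoice) (auto simp: special_bb_def specially_dominating_def)
  then obtain u where u: "\<And>i. i \<in> {1..d} \<Longrightarrow> u i \<in> label_class i"
    "\<And>i v. i \<in> {1..d} \<Longrightarrow> v \<in> V - {u i} \<Longrightarrow> (u i, v) \<in> E" by blast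
  interpret dominated_raag \<Gamma> lab u
    by (rule dominated_raagI) (use u in \<open>auto simp: label_class_def\<close>)
  show ?thesis by (rule bb_subgroup_special_linear) (use u lab_image in auto)
qed

lemma is_join_partition:
  assumes "is_join (with_proj \<Gamma> \<restriction> A)"
  shows "\<exists>K L. A = K \<union> L \<and> K \<noteq> {} \<and> L \<noteq> {} \<and> K \<times> L \<subseteq> E"
proof -
  obtain G1 G2 where G: "pverts G1 \<noteq> {}" "pverts G2 \<noteq> {}" "with_proj \<Gamma> \<restriction> A = with_proj (graph_join G1 G2)"
    using assms unfolding is_join_def by blast
  have "verts (with_proj \<Gamma> \<restriction> A) = pverts G1 \<union> pverts G2" unfolding G(3) by (simp add: graph_join_def)
  then have "A = pverts G1 \<union> pverts G2" by simp
  moreover have "pverts G1 \<times> pverts G2 \<subseteq> arcs (with_proj \<Gamma> \<restriction> A)" unfolding G(3) by (auto simp: graph_join_def)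
  then have "pverts G1 \<times> pverts G2 \<subseteq> E" by (auto simp: induce_subgraph_def)
  ultimately show ?thesis using G(1,2) by blast
qed

lemma join_linear:
  assumes join: "\<forall>i\<in>{1..d}. is_join (basis_subgraph \<Gamma> d \<Phi> i)"
    and comm: "\<forall>i\<in>{1..d}. \<forall>j\<in>{1..d}. i \<noteq> j \<longrightarrow>
      subgraphs_commute (with_proj \<Gamma>) (basis_subgraph \<Gamma> d \<Phi> i) (basis_subgraph \<Gamma> d \<Phi> j)"
  shows "linear_distortion G bb_subgroup"
proof -
  have "\<forall>i\<in>{1..d}. \<exists>p. label_class i = fst p \<union> snd p \<and> fst p \<noteq> {} \<and> snd p \<noteq> {} \<and> fst p \<times> snd p \<subseteq> E"
  proof
    fix i assume i: "i \<in> {1..d}"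
    then obtain K L where "label_class i = K \<union> L \<and> K \<noteq> {} \<and> L \<noteq> {} \<and> K \<times> L \<subseteq> E"
      using is_join_partition[of "label_class i"] join basis_subgraph_conv by auto
    then show "\<exists>p. label_class i = fst p \<union> snd p \<and> fst p \<noteq> {} \<and> snd p \<noteq> {} \<and> fst p \<times> snd p \<subseteq> E"
      by (intro exI[of _ "(K, L)"]) simp
  qed
  from bchoice[OF this] obtain p where p: "\<And>i. i \<in> {1..d} \<Longrightarrow> label_class i = fst (p i) \<union> snd (p i)"
    "\<And>i. i \<in> {1..d} \<Longrightarrow> fst (p i) \<noteq> {} \<and> snd (p i) \<noteq> {}" "\<And>i. i \<in> {1..d} \<Longrightarrow> fst (p i) \<times> snd (p i) \<subseteq> E"
    by blast
  show ?thesis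
  proof (rule bb_subgroup_join_linear[of "\<lambda>i. fst (p i)" "\<lambda>i. snd (p i)", unfolded lab_image])
    show "(s, t) \<in> E" if "s \<in> V" "t \<in> V" "lab s \<noteq> lab t" for s t
    proof -
      have st: "lab s \<in> {1..d}" "lab t \<in> {1..d}" using lab_range that by blast+
      then have "subgraphs_commute (with_proj \<Gamma>) (basis_subgraph \<Gamma> d \<Phi> (lab s)) (basis_subgraph \<Gamma> d \<Phi> (lab t))"
        using comm that(3) by blast
      then show ?thesis
        using verts_basis_subgraph[OF st(1)] verts_basis_subgraph[OF st(2)] that
        by (auto simp: subgraphs_commute_def label_class_def)
    qed
  qed (use p in blast)+
qed

end

text \<open>The cardinality condition excludes a single vertex, which is not a join either. For the
  one-vertex graph the kernel is trivial, so its distortion is not quadratic.\<close>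

theorem theorem1p9:
  fixes \<Gamma> :: "'v pair_pre_digraph" and d :: nat and lab :: "'v \<Rightarrow> nat"
    and \<Phi> :: "'v word set \<Rightarrow> nat \<Rightarrow> int"
  assumes "pair_graph \<Gamma>" and "Digraph_Component.connected (with_proj \<Gamma>)"
    and "labelling_epi \<Gamma> d lab \<Phi>"
    and "strong_bb \<Gamma> d \<Phi>"
  shows "((\<exists>I. I \<noteq> {} \<and> I \<subseteq> {1..d} \<and>
            card (verts (generated_subgraph \<Gamma> d \<Phi> I)) \<ge> 2 \<and>
            \<not> is_join (generated_subgraph \<Gamma> d \<Phi> I))
          \<longrightarrow> quadratic_distortion (raag \<Gamma>) (bestvina_brady \<Gamma> d \<Phi>))
       \<and> (special_bb \<Gamma> d \<Phi> \<or>
          (\<forall>i\<in>{1..d}. is_join (basis_subgraph \<Gamma> d \<Phi> i)) \<and>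
          (\<forall>i\<in>{1..d}. \<forall>j\<in>{1..d}. i \<noteq> j \<longrightarrow>
             subgraphs_commute (with_proj \<Gamma>) (basis_subgraph \<Gamma> d \<Phi> i) (basis_subgraph \<Gamma> d \<Phi> j))
          \<longrightarrow> linear_distortion (raag \<Gamma>) (bestvina_brady \<Gamma> d \<Phi>))"
proof -
  interpret bestvina_brady_setup \<Gamma> d lab \<Phi>
    by (intro bestvina_brady_setup.intro assms)
  show ?thesis unfolding bestvina_brady_conv using quadratic special_linear join_linear by blast
qed

end
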